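(* Let $N=(G,+,<)$ be elementarily equivalent to an archimedean ordered abelian group with small quotients, and let $M$ be a reduct (but not necessarily a $0$-reduct) of $N$ that is a proper expansion of $(G,+)$. Then there exists $b\in G\cup\{\infty\}$ such that the interval $I:=(0,b)=\{g\in G: 0<g<b\}$ is infinite and definable in $M$, and the restriction of $<$ to $I$ is definable in $M$.
   Context: "Definable" without a specified parameter set means definable with parameters from the structure. For structures $M,N$ with the same universe and a subset $A$ of that universe, $M$ is an $A$-reduct of $N$ (equivalently $N$ is an $A$-expansion of $M$) if every $X\subseteq M^k$ (any $k$) that is $\emptyset$-definable in $M$ is $A$-definable in $N$. When $A$ is the whole universe one says reduct/expansion; when $A=\emptyset$ one says $0$-reduct/$0$-expansion. Two structures are interdefinable if each is a reduct of the other. $M$ is a proper expansion of $(G,+)$ if it is an expansion of $(G,+)$ that is not interdefinable with $(G,+)$. An ordered abelian group is an abelian group with a linear order $<$ such that $a<b$ implies $a+c<b+c$. It is archimedean if for every $a,b\in G$ with $a\neq 0$ there is $n\in\mathbb{Z}$ with $b<na$. An abelian group $(G,+)$ has small quotients if for all $1\le n<\omega$ the index $[G:nG]$ is finite. *)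

theory Defs
  imports Main
begin

section \<open>First-order structures and definability\<close>

datatype 'f fo_term = Var nat | Fun 'f "'f fo_term list"

datatype ('f, 'r) formula =
    Eq "'f fo_term" "'f fo_term"
  | Rel 'r "'f fo_term list"
  | Neg "('f, 'r) formula"
  | And "('f, 'r) formula" "('f, 'r) formula"
  | Exists nat "('f, 'r) formula"

text \<open>A language is a set of function symbols and a set of relation symbols, each paired with its
  arity. The universe of a structure is the whole type \<open>'a\<close>; an interpretation is only ever
  applied to symbols of the language and to argument lists of the right length.\<close>

record ('f, 'r) language =
  fun_symbols :: "('f \<times> nat) set"
  rel_symbols :: "('r \<times> nat) set"

record ('f, 'r, 'a) fo_structure =
  lang :: "('f, 'r) language"
  fun_interp :: "'f \<Rightarrow> 'a list \<Rightarrow> 'a"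
  rel_interp :: "'r \<Rightarrow> 'a list \<Rightarrow> bool"

primrec term_in :: "('f, 'r) language \<Rightarrow> 'f fo_term \<Rightarrow> bool" where
  "term_in L (Var i) \<longleftrightarrow> True"
| "term_in L (Fun f ts) \<longleftrightarrow> (f, length ts) \<in> fun_symbols L \<and> list_all (term_in L) ts"

primrec formula_in :: "('f, 'r) language \<Rightarrow> ('f, 'r) formula \<Rightarrow> bool" where
  "formula_in L (Eq s t) \<longleftrightarrow> term_in L s \<and> term_in L t"
| "formula_in L (Rel r ts) \<longleftrightarrow> (r, length ts) \<in> rel_symbols L \<and> list_all (term_in L) ts"
| "formula_in L (Neg \<phi>) \<longleftrightarrow> formula_in L \<phi>"
| "formula_in L (And \<phi> \<psi>) \<longleftrightarrow> formula_in L \<phi> \<and> formula_in L \<psi>"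
| "formula_in L (Exists i \<phi>) \<longleftrightarrow> formula_in L \<phi>"

primrec term_vars :: "'f fo_term \<Rightarrow> nat set" where
  "term_vars (Var i) = {i}"
| "term_vars (Fun f ts) = \<Union> (set (map term_vars ts))"

primrec free_vars :: "('f, 'r) formula \<Rightarrow> nat set" where
  "free_vars (Eq s t) = term_vars s \<union> term_vars t"
| "free_vars (Rel r ts) = \<Union> (set (map term_vars ts))"
| "free_vars (Neg \<phi>) = free_vars \<phi>"
| "free_vars (And \<phi> \<psi>) = free_vars \<phi> \<union> free_vars \<psi>"
| "free_vars (Exists i \<phi>) = free_vars \<phi> - {i}"

primrec term_value :: "('f, 'r, 'a) fo_structure \<Rightarrow> (nat \<Rightarrow> 'a) \<Rightarrow> 'f fo_term \<Rightarrow> 'a" where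
  "term_value M e (Var i) = e i"
| "term_value M e (Fun f ts) = fun_interp M f (map (term_value M e) ts)"

primrec sat :: "('f, 'r, 'a) fo_structure \<Rightarrow> (nat \<Rightarrow> 'a) \<Rightarrow> ('f, 'r) formula \<Rightarrow> bool" where
  "sat M e (Eq s t) \<longleftrightarrow> term_value M e s = term_value M e t"
| "sat M e (Rel r ts) \<longleftrightarrow> rel_interp M r (map (term_value M e) ts)"
| "sat M e (Neg \<phi>) \<longleftrightarrow> \<not> sat M e \<phi>"
| "sat M e (And \<phi> \<psi>) \<longleftrightarrow> sat M e \<phi> \<and> sat M e \<psi>"
| "sat M e (Exists i \<phi>) \<longleftrightarrow> (\<exists>x. sat M (e(i := x)) \<phi>)"

text \<open>The value of a sentence does not depend on the valuation.\<close>

definition elementarily_equivalent ::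
  "('f, 'r, 'a) fo_structure \<Rightarrow> ('f, 'r, 'b) fo_structure \<Rightarrow> bool" where
  "elementarily_equivalent M N \<longleftrightarrow> lang M = lang N \<and>
     (\<forall>\<phi>. formula_in (lang M) \<phi> \<and> free_vars \<phi> = {} \<longrightarrow>
        ((\<forall>e. sat M e \<phi>) \<longleftrightarrow> (\<forall>e. sat N e \<phi>)))"

text \<open>\<open>definable M A k X\<close>: the \<open>k\<close>-ary relation \<open>X\<close>, a set of lists of length \<open>k\<close>, is
  \<open>A\<close>-definable in \<open>M\<close>. The variables below \<open>k\<close> stand for the coordinates, and the remaining free
  variables are replaced by parameters from \<open>A\<close>, given by \<open>p\<close>. In particular, a formula witnessing
  \<open>{}\<close>-definability has no free variables other than those below \<open>k\<close>.\<close>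

definition definable :: "('f, 'r, 'a) fo_structure \<Rightarrow> 'a set \<Rightarrow> nat \<Rightarrow> 'a list set \<Rightarrow> bool" where
  "definable M A k X \<longleftrightarrow>
     (\<exists>\<phi> p. formula_in (lang M) \<phi> \<and> (\<forall>i\<in>free_vars \<phi>. k \<le> i \<longrightarrow> p i \<in> A) \<and>
        X = {xs. length xs = k \<and> sat M (\<lambda>i. if i < k then xs ! i else p i) \<phi>})"

definition reduct_over ::
  "'a set \<Rightarrow> ('f, 'r, 'a) fo_structure \<Rightarrow> ('g, 's, 'a) fo_structure \<Rightarrow> bool" where
  "reduct_over A M N \<longleftrightarrow> (\<forall>k X. definable M {} k X \<longrightarrow> definable N A k X)"

abbreviation reduct :: "('f, 'r, 'a) fo_structure \<Rightarrow> ('g, 's, 'a) fo_structure \<Rightarrow> bool" where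
  "reduct M N \<equiv> reduct_over UNIV M N"

definition interdefinable ::
  "('f, 'r, 'a) fo_structure \<Rightarrow> ('g, 's, 'a) fo_structure \<Rightarrow> bool" where
  "interdefinable M N \<longleftrightarrow> reduct M N \<and> reduct N M"

definition proper_expansion ::
  "('f, 'r, 'a) fo_structure \<Rightarrow> ('g, 's, 'a) fo_structure \<Rightarrow> bool" where
  "proper_expansion M N \<longleftrightarrow> reduct N M \<and> \<not> interdefinable M N"

section \<open>Ordered abelian groups\<close>

datatype group_symbol = Plus
datatype order_symbol = Less

text \<open>\<open>(G, +)\<close> and \<open>(G, +, <)\<close>, where \<open>G\<close> is the type \<open>'a\<close>.\<close>

definition group_structure :: "(group_symbol, order_symbol, 'a::ab_group_add) fo_structure" where
  "group_structure =
     \<lparr>lang = \<lparr>fun_symbols = {(Plus, 2)}, rel_symbols = {}\<rparr>,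
      fun_interp = (\<lambda>_ xs. xs ! 0 + xs ! 1),
      rel_interp = (\<lambda>_ _. False)\<rparr>"

definition ordered_group_structure ::
  "(group_symbol, order_symbol, 'a::linordered_ab_group_add) fo_structure" where
  "ordered_group_structure =
     \<lparr>lang = \<lparr>fun_symbols = {(Plus, 2)}, rel_symbols = {(Less, 2)}\<rparr>,
      fun_interp = (\<lambda>_ xs. xs ! 0 + xs ! 1),
      rel_interp = (\<lambda>_ xs. xs ! 0 < xs ! 1)\<rparr>"

definition int_multiple :: "int \<Rightarrow> 'a::ab_group_add \<Rightarrow> 'a" where
  "int_multiple n a = (if 0 \<le> n then (\<Sum>i<nat n. a) else - (\<Sum>i<nat (- n). a))"

definition archimedean_group :: "'a::linordered_ab_group_add itself \<Rightarrow> bool" where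
  "archimedean_group _ \<longleftrightarrow> (\<forall>a b :: 'a. a \<noteq> 0 \<longrightarrow> (\<exists>n. b < int_multiple n a))"

text \<open>The set below is \<open>G / nG\<close>, the set of cosets of \<open>nG\<close>.\<close>

definition small_quotients :: "'a::ab_group_add itself \<Rightarrow> bool" where
  "small_quotients _ \<longleftrightarrow>
     (\<forall>n::nat. 1 \<le> n \<longrightarrow> finite (range (\<lambda>g::'a. (+) g ` range (int_multiple (int n)))))"

text \<open>\<open>(0, b)\<close> for \<open>b \<in> G \<union> {\<infinity>}\<close>, with \<open>None\<close> in the role of \<open>\<infinity>\<close>.\<close>

fun interval_from_zero :: "'a::linordered_ab_group_add option \<Rightarrow> 'a set" where
  "interval_from_zero (Some b) = {0<..<b}"
| "interval_from_zero None = {0<..}"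

end

theory Submission
  imports Defs
begin

text \<open>
  Why the theorem holds. A group \<open>N\<close> that is elementarily equivalent to an archimedean ordered group
  with small quotients admits elimination of quantifiers: its definable relations are Boolean
  combinations of linear inequalities with integer coefficients and of congruences modulo \<open>n G\<close>
  (\<open>presburger_ex\<close>). As \<open>n G\<close> has finite index and its cosets are definable in the group, every
  definable relation can be cut into finitely many pieces each of which becomes polyhedral after a
  substitution \<open>x = a + n w\<close>, that is, a Boolean combination of inequalities only. The order on
  an interval \<open>I = (0, b)\<close> is recovered from \<open>I\<close> itself, because \<open>x < y\<close> means \<open>y - x \<in> I\<close> for
  \<open>x, y \<in> I\<close>. So suppose that \<open>M\<close> defines no infinite interval \<open>(0, b)\<close>; it has to be shown that \<open>M\<close>
  defines nothing beyond the group.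

  First, consider polyhedral sets on a line that are definable in \<open>M\<close>. Each of them turns out to be
  finite or cofinite, and in a definable family the sizes of the finite ones are bounded
  (\<open>fibres_finite_or_cofinite\<close>). Taking the difference of a set and a translate reduces this to
  bounded sets. In a dense group, the set of all \<open>s\<close> such that \<open>x + s\<close> is in a bounded set whenever
  \<open>x\<close> and \<open>x + w\<close> are is the interval \<open>[0, w]\<close>, if \<open>w\<close> is small and the set has been adjusted at finitely many
  points (\<open>dense_bounded_finite\<close>). In a discrete group such as the integers, single bounded
  sets can be finite, and it is the families that matter: if their sizes were unbounded, then one
  could intersect with translates and erode until families of single intervals of
  unbounded lengths are left, and their lengths fill up an infinite interval (\<open>bounded_family\<close>).

  Secondly, let \<open>P\<close> be a polyhedral relation in several variables, definable in \<open>M\<close>. By the first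
  part, the truth value of \<open>P\<close> at a point away from finitely many hyperplanes is shared by almost
  all points on each line through it that is parallel to an axis
  (\<open>lines_through_generic_points\<close>). Moving along such lines, any two such points can be joined,
  so \<open>P\<close> is constant outside these hyperplanes. On a hyperplane one coordinate is determined by
  the others, and induction on the number of variables shows that \<open>P\<close> is definable in the group
  (\<open>definable_in_group\<close>).
\<close>

section \<open>A calculus of definable predicates\<close>

lemma term_value_cong:
  "(\<And>i. i \<in> term_vars t \<Longrightarrow> e i = e' i) \<Longrightarrow> term_value M e t = term_value M e' t"
proof (induction t)
  case (Fun f ts)
  then have "map (term_value M e) ts = map (term_value M e') ts"
    by auto
  then show ?case by (simp only: term_value.simps)
qed simp

lemma sat_cong:
  "(\<And>i. i \<in> free_vars \<phi> \<Longrightarrow> e i = e' i) \<Longrightarrow> sat M e \<phi> = sat M e' \<phi>"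
proof (induction \<phi> arbitrary: e e')
  case (Eq s t)
  then have "term_value M e s = term_value M e' s" "term_value M e t = term_value M e' t"
    by (auto intro: term_value_cong)
  then show ?case by simp
next
  case (Rel r ts)
  have "map (term_value M e) ts = map (term_value M e') ts"
    using Rel by (auto intro!: term_value_cong)
  then show ?case by (simp only: sat.simps)
next
  case (And \<phi> \<psi>)
  have "sat M e \<phi> = sat M e' \<phi>" "sat M e \<psi> = sat M e' \<psi>"
    by (rule And.IH; use And.prems in simp)+
  then show ?case by simp
next
  case (Neg \<phi>)
  have "sat M e \<phi> = sat M e' \<phi>"
    by (rule Neg.IH) (use Neg.prems in simp)
  then show ?case by simp
next
  case (Exists i \<phi>)
  have "sat M (e(i := x)) \<phi> = sat M (e'(i := x)) \<phi>" for x
    by (rule Exists.IH) (use Exists.prems in simp)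
  then show ?case by simp
qed

lemma finite_term_vars: "finite (term_vars t)"
  by (induction t) auto

lemma finite_free_vars: "finite (free_vars \<phi>)"
  by (induction \<phi>) (auto simp: finite_term_vars)

primrec rename_term :: "(nat \<Rightarrow> nat) \<Rightarrow> 'f fo_term \<Rightarrow> 'f fo_term" where
  "rename_term \<tau> (Var i) = Var (\<tau> i)"
| "rename_term \<tau> (Fun f ts) = Fun f (map (rename_term \<tau>) ts)"

lemma term_value_rename: "term_value M e (rename_term \<tau> t) = term_value M (\<lambda>i. e (\<tau> i)) t"
proof (induction t)
  case (Fun f ts)
  then have "map (term_value M e) (map (rename_term \<tau>) ts) = map (term_value M (\<lambda>i. e (\<tau> i))) ts"
    by auto
  then show ?case by (simp only: term_value.simps rename_term.simps)
qed simp

lemma term_in_rename: "term_in L t \<Longrightarrow> term_in L (rename_term \<tau> t)"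
  by (induction t) (auto simp: list_all_iff)

text \<open>The renaming need not be injective: a bound variable is replaced by one that the free
  variables are not mapped to, so nothing is captured.\<close>

lemma rename_formula:
  fixes \<phi> :: "('f, 'r) formula"
  shows "\<exists>\<psi>. (formula_in L \<phi> \<longrightarrow> formula_in L \<psi>) \<and>
    (\<forall>(M :: ('f, 'r, 'a) fo_structure) e. sat M e \<psi> = sat M (\<lambda>i. e (\<tau> i)) \<phi>)"
proof (induction \<phi> arbitrary: \<tau>)
  case (Eq s t)
  show ?case
    by (rule exI[of _ "Eq (rename_term \<tau> s) (rename_term \<tau> t)"])
       (auto simp: term_value_rename term_in_rename)
next
  case (Rel r ts)
  have "map (term_value M e) (map (rename_term \<tau>) ts) = map (term_value M (\<lambda>i. e (\<tau> i))) ts"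
    for M :: "('f, 'r, 'a) fo_structure" and e
    by (auto simp: term_value_rename)
  then show ?case
    by (intro exI[of _ "Rel r (map (rename_term \<tau>) ts)"])
       (auto simp: list_all_iff term_in_rename simp del: map_map)
next
  case (Neg \<phi>)
  from Neg[of \<tau>] obtain \<psi> where "(formula_in L \<phi> \<longrightarrow> formula_in L \<psi>) \<and>
    (\<forall>(M :: ('f, 'r, 'a) fo_structure) e. sat M e \<psi> = sat M (\<lambda>i. e (\<tau> i)) \<phi>)" by blast
  then show ?case by (intro exI[of _ "Neg \<psi>"]) auto
next
  case (And \<phi>1 \<phi>2)
  from And(1)[of \<tau>] obtain \<psi>1 where "(formula_in L \<phi>1 \<longrightarrow> formula_in L \<psi>1) \<and>
    (\<forall>(M :: ('f, 'r, 'a) fo_structure) e. sat M e \<psi>1 = sat M (\<lambda>i. e (\<tau> i)) \<phi>1)" by blast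
  moreover from And(2)[of \<tau>] obtain \<psi>2 where "(formula_in L \<phi>2 \<longrightarrow> formula_in L \<psi>2) \<and>
    (\<forall>(M :: ('f, 'r, 'a) fo_structure) e. sat M e \<psi>2 = sat M (\<lambda>i. e (\<tau> i)) \<phi>2)" by blast
  ultimately show ?case by (intro exI[of _ "And \<psi>1 \<psi>2"]) auto
next
  case (Exists i \<phi>)
  obtain v where v: "v \<notin> \<tau> ` free_vars \<phi>"
    using ex_new_if_finite[OF infinite_UNIV_nat] finite_free_vars by blast
  from Exists[of "\<tau>(i := v)"] obtain \<psi> where \<psi>: "formula_in L \<phi> \<longrightarrow> formula_in L \<psi>"
    "\<And>(M :: ('f, 'r, 'a) fo_structure) e. sat M e \<psi> = sat M (\<lambda>k. e ((\<tau>(i := v)) k)) \<phi>"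
    by blast
  have "sat M (e(v := x)) \<psi> = sat M ((\<lambda>k. e (\<tau> k))(i := x)) \<phi>"
    for M :: "('f, 'r, 'a) fo_structure" and e x
    unfolding \<psi>(2) by (rule sat_cong) (use v in auto)
  then show ?case
    using \<psi>(1) by (intro exI[of _ "Exists v \<psi>"]) auto
qed

text \<open>Coordinates and parameters live on the even and the odd variables. Predicates on
  valuations avoid any bookkeeping of arities: a predicate of arity \<open>k\<close> is one that only
  looks at the first \<open>k\<close> coordinates.\<close>

definition interleave :: "(nat \<Rightarrow> 'a) \<Rightarrow> (nat \<Rightarrow> 'a) \<Rightarrow> nat \<Rightarrow> 'a" where
  "interleave e p i = (if even i then e (i div 2) else p (i div 2))"

definition dfn :: "('f, 'r, 'a) fo_structure \<Rightarrow> ((nat \<Rightarrow> 'a) \<Rightarrow> bool) \<Rightarrow> bool" where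
  "dfn M P \<longleftrightarrow> (\<exists>\<phi> p. formula_in (lang M) \<phi> \<and> (\<forall>e. P e \<longleftrightarrow> sat M (interleave e p) \<phi>))"

lemma dfn_cong: "dfn M P \<Longrightarrow> (\<And>e. P e \<longleftrightarrow> Q e) \<Longrightarrow> dfn M Q"
  by (simp add: dfn_def)

lemma dfnI:
  fixes M :: "('f, 'r, 'a) fo_structure"
  assumes "formula_in (lang M) \<phi>"
    and "\<And>e. P e \<longleftrightarrow> sat M (\<lambda>i. case \<sigma> i of Inl j \<Rightarrow> e j | Inr a \<Rightarrow> a) \<phi>"
  shows "dfn M P"
proof -
  define \<tau> where "\<tau> i = (case \<sigma> i of Inl j \<Rightarrow> 2 * j | Inr (a :: 'a) \<Rightarrow> 2 * i + 1)" for i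
  define p where "p i = (case \<sigma> i of Inl j \<Rightarrow> undefined | Inr a \<Rightarrow> a)" for i
  have *: "(\<lambda>i. case \<sigma> i of Inl j \<Rightarrow> e j | Inr a \<Rightarrow> a) = (\<lambda>i. interleave e p (\<tau> i))" for e
    by (auto simp: fun_eq_iff interleave_def \<tau>_def p_def split: sum.splits)
  obtain \<psi> where "formula_in (lang M) \<phi> \<longrightarrow> formula_in (lang M) \<psi>"
    "\<And>e. sat M e \<psi> = sat M (\<lambda>i. e (\<tau> i)) \<phi>"
    using rename_formula[of "lang M" \<phi> \<tau>] by blast
  with assms * show ?thesis
    unfolding dfn_def by (intro exI[of _ \<psi>] exI[of _ p]) simp
qed

lemma dfn_inst:
  assumes "dfn M P"
  shows "dfn M (\<lambda>e. P (\<lambda>j. case \<sigma> j of Inl k \<Rightarrow> e k | Inr a \<Rightarrow> a))"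
proof -
  obtain \<phi> p where \<phi>: "formula_in (lang M) \<phi>" "\<And>e. P e \<longleftrightarrow> sat M (interleave e p) \<phi>"
    using assms by (auto simp: dfn_def)
  have "interleave (\<lambda>j. case \<sigma> j of Inl k \<Rightarrow> e k | Inr a \<Rightarrow> a) p =
    (\<lambda>i. case (if even i then \<sigma> (i div 2) else Inr (p (i div 2))) of Inl j \<Rightarrow> e j | Inr a \<Rightarrow> a)" for e
    by (auto simp: interleave_def fun_eq_iff)
  then show ?thesis
    by (intro dfnI[OF \<phi>(1), of _ "\<lambda>i. if even i then \<sigma> (i div 2) else Inr (p (i div 2))"])
       (simp add: \<phi>(2))
qed

lemma dfn_rename: "dfn M P \<Longrightarrow> dfn M (\<lambda>e. P (\<lambda>j. e (\<tau> j)))"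
  by (rule dfn_cong[OF dfn_inst[of M P "\<lambda>j. Inl (\<tau> j)"]]) simp_all

lemma dfn_finite_support:
  assumes "dfn M P"
  obtains K where "\<And>e e'. (\<And>i. i < K \<Longrightarrow> e i = e' i) \<Longrightarrow> P e = P e'"
proof -
  obtain \<phi> p where \<phi>: "\<And>e. P e \<longleftrightarrow> sat M (interleave e p) \<phi>"
    using assms by (auto simp: dfn_def)
  obtain K where K: "\<forall>i\<in>free_vars \<phi>. i < K"
    using finite_free_vars finite_nat_set_iff_bounded by metis
  have "P e = P e'" if "\<And>i. i < K \<Longrightarrow> e i = e' i" for e e'
    unfolding \<phi>
  proof (rule sat_cong)
    fix i assume "i \<in> free_vars \<phi>"
    then have "i < K" using K by blast
    then show "interleave e p i = interleave e' p i"
      using that by (auto simp: interleave_def)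
  qed
  then show ?thesis using that by blast
qed

lemma dfn_not: "dfn M P \<Longrightarrow> dfn M (\<lambda>e. \<not> P e)"
  unfolding dfn_def
proof (elim exE)
  fix \<phi> p
  assume "formula_in (lang M) \<phi> \<and> (\<forall>e. P e = sat M (interleave e p) \<phi>)"
  then show "\<exists>\<phi> p. formula_in (lang M) \<phi> \<and> (\<forall>e. (\<not> P e) = sat M (interleave e p) \<phi>)"
    by (intro exI[of _ "Neg \<phi>"] exI[of _ p]) simp
qed

lemma dfn_conj:
  assumes "dfn M P" "dfn M Q"
  shows "dfn M (\<lambda>e. P e \<and> Q e)"
proof -
  obtain \<phi> p where \<phi>: "formula_in (lang M) \<phi>" "\<And>e. P e \<longleftrightarrow> sat M (interleave e p) \<phi>"
    using assms(1) by (auto simp: dfn_def)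
  obtain \<psi> q where \<psi>: "formula_in (lang M) \<psi>" "\<And>e. Q e \<longleftrightarrow> sat M (interleave e q) \<psi>"
    using assms(2) by (auto simp: dfn_def)
  \<comment> \<open>The two formulas have their own parameters, which are interleaved once more.\<close>
  define r where "r = interleave p q"
  let ?s = "\<lambda>b i. if even i then i else 4 * (i div 2) + b :: nat"
  obtain \<phi>' where \<phi>': "formula_in (lang M) \<phi>'"
    "\<And>e. sat M e \<phi>' = sat M (\<lambda>i. e (?s 1 i)) \<phi>"
    using rename_formula[of "lang M" \<phi> "?s 1"] \<phi>(1) by blast
  obtain \<psi>' where \<psi>': "formula_in (lang M) \<psi>'"
    "\<And>e. sat M e \<psi>' = sat M (\<lambda>i. e (?s 3 i)) \<psi>"
    using rename_formula[of "lang M" \<psi> "?s 3"] \<psi>(1) by blast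
  have *: "(4 * k + 1) div 2 = 2 * k" "(4 * k + 3) div 2 = 2 * k + 1" for k :: nat by auto
  have "(\<lambda>i. interleave e r (?s 1 i)) = interleave e p"
    "(\<lambda>i. interleave e r (?s 3 i)) = interleave e q" for e
    by (auto simp: fun_eq_iff interleave_def r_def * elim!: oddE simp del: div_mult_self1 div_mult_self2)
  then show ?thesis
    unfolding dfn_def using \<phi> \<psi> \<phi>' \<psi>'
    by (intro exI[of _ "And \<phi>' \<psi>'"] exI[of _ r]) simp
qed

lemma dfn_disj: "dfn M P \<Longrightarrow> dfn M Q \<Longrightarrow> dfn M (\<lambda>e. P e \<or> Q e)"
  by (rule dfn_cong[OF dfn_not[OF dfn_conj[OF dfn_not dfn_not], of M P Q]]) simp_all

lemma dfn_imp: "dfn M P \<Longrightarrow> dfn M Q \<Longrightarrow> dfn M (\<lambda>e. P e \<longrightarrow> Q e)"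
  by (rule dfn_cong[OF dfn_disj[OF dfn_not, of M P Q]]) simp_all

lemma dfn_eq_var: "dfn M (\<lambda>e. e i = e j)"
  by (rule dfnI[of _ "Eq (Var 0) (Var 1)" _ "\<lambda>k. Inl (if k = 0 then i else j)"]) auto

lemma dfn_const: "dfn M (\<lambda>e. b)"
proof (cases b)
  case True
  show ?thesis by (rule dfn_cong[OF dfn_eq_var[of M 0 0]]) (simp add: True)
next
  case False
  show ?thesis by (rule dfn_cong[OF dfn_not[OF dfn_eq_var[of M 0 0]]]) (simp add: False)
qed

lemma dfn_ball:
  assumes "finite A" "\<And>a. a \<in> A \<Longrightarrow> dfn M (P a)"
  shows "dfn M (\<lambda>e. \<forall>a\<in>A. P a e)"
  using assms by (induction A rule: finite_induct) (auto intro: dfn_conj dfn_const)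

lemma dfn_bex:
  assumes "finite A" "\<And>a. a \<in> A \<Longrightarrow> dfn M (P a)"
  shows "dfn M (\<lambda>e. \<exists>a\<in>A. P a e)"
  using assms by (induction A rule: finite_induct) (auto intro: dfn_disj dfn_const)

lemma dfn_ex_upd:
  assumes "dfn M P"
  shows "dfn M (\<lambda>e. \<exists>x. P (e(j := x)))"
proof -
  obtain \<phi> p where \<phi>: "formula_in (lang M) \<phi>" "\<And>e. P e \<longleftrightarrow> sat M (interleave e p) \<phi>"
    using assms by (auto simp: dfn_def)
  have "(interleave e p)(2 * j := x) = interleave (e(j := x)) p" for e x
    by (auto simp: fun_eq_iff interleave_def)
  then show ?thesis
    unfolding dfn_def using \<phi> by (intro exI[of _ "Exists (2 * j) \<phi>"] exI[of _ p]) simp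
qed

text \<open>The body of a quantifier is a predicate in de Bruijn style: coordinate \<open>0\<close> is the bound
  variable and the others are shifted. This keeps freshness conditions out of the rules.\<close>

abbreviation dfn1 :: "('f, 'r, 'a) fo_structure \<Rightarrow> ((nat \<Rightarrow> 'a) \<Rightarrow> 'a \<Rightarrow> bool) \<Rightarrow> bool" where
  "dfn1 M R \<equiv> dfn M (\<lambda>e. R (\<lambda>i. e (Suc i)) (e 0))"

lemma dfn_ex:
  assumes "dfn1 M R"
  shows "dfn M (\<lambda>e. \<exists>x. R e x)"
  by (rule dfn_cong[OF dfn_rename[OF dfn_ex_upd[OF assms, of 0], of "\<lambda>j. j - 1"]]) simp

lemma dfn_all: "dfn1 M R \<Longrightarrow> dfn M (\<lambda>e. \<forall>x. R e x)"
  by (rule dfn_cong[OF dfn_not[OF dfn_ex[OF dfn_not, of M R]]]) simp_all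

lemma dfn_ex_below:
  assumes "dfn M P"
  shows "dfn M (\<lambda>e. \<exists>x. P (\<lambda>i. if i < K then x i else e i))"
proof (induction K)
  case 0
  show ?case by (rule dfn_cong[OF assms]) simp
next
  case (Suc K)
  have "(\<exists>x. P (\<lambda>i. if i < Suc K then x i else e i)) \<longleftrightarrow>
    (\<exists>y x. P (\<lambda>i. if i < K then x i else (e(K := y)) i))" for e
  proof
    assume "\<exists>x. P (\<lambda>i. if i < Suc K then x i else e i)"
    then obtain x where "P (\<lambda>i. if i < Suc K then x i else e i)" by blast
    moreover have "(\<lambda>i. if i < Suc K then x i else e i) = (\<lambda>i. if i < K then x i else (e(K := x K)) i)"
      by (auto simp: fun_eq_iff)
    ultimately show "\<exists>y x. P (\<lambda>i. if i < K then x i else (e(K := y)) i)" by metis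
  next
    assume "\<exists>y x. P (\<lambda>i. if i < K then x i else (e(K := y)) i)"
    then obtain x y where "P (\<lambda>i. if i < K then x i else (e(K := y)) i)" by blast
    moreover have "(\<lambda>i. if i < Suc K then (x(K := y)) i else e i) =
        (\<lambda>i. if i < K then x i else (e(K := y)) i)"
      by (auto simp: fun_eq_iff)
    ultimately show "\<exists>x. P (\<lambda>i. if i < Suc K then x i else e i)" by metis
  qed
  then show ?case
    using dfn_ex_upd[OF Suc, of K] by simp
qed

text \<open>A function is definable if its graph is, again with the value on coordinate \<open>0\<close>.\<close>

definition dfnf :: "('f, 'r, 'a) fo_structure \<Rightarrow> ((nat \<Rightarrow> 'a) \<Rightarrow> 'a) \<Rightarrow> bool" where
  "dfnf M f \<longleftrightarrow> dfn1 M (\<lambda>e y. y = f e)"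

lemma dfn_subst:
  assumes Q: "dfn M Q" and F: "\<And>j. dfnf M (F j)"
  shows "dfn M (\<lambda>e. Q (\<lambda>j. F j e))"
proof -
  obtain K where K: "\<And>e e'. (\<And>i. i < K \<Longrightarrow> e i = e' i) \<Longrightarrow> Q e = Q e'"
    using dfn_finite_support[OF Q] by blast
  have "dfn M (\<lambda>e. e j = F j (\<lambda>i. e (K + i)))" for j
    using dfn_rename[OF F[unfolded dfnf_def], of "\<lambda>i. if i = 0 then j else K + (i - 1)"] by simp
  then have "dfn M (\<lambda>e. (\<forall>j\<in>{..<K}. e j = F j (\<lambda>i. e (K + i))) \<and> Q e)"
    by (intro dfn_conj dfn_ball Q) auto
  from dfn_rename[OF dfn_ex_below[OF this, of K], of "\<lambda>i. i - K"]
  have *: "dfn M (\<lambda>e. \<exists>x. (\<forall>j\<in>{..<K}. x j = F j e) \<and> Q (\<lambda>i. if i < K then x i else e (i - K)))"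
    by (simp cong: conj_cong)
  have "Q (\<lambda>i. if i < K then x i else e (i - K)) = Q (\<lambda>j. F j e)" if "\<forall>j\<in>{..<K}. x j = F j e" for x e
    by (rule K) (use that in auto)
  then have "(\<exists>x. (\<forall>j\<in>{..<K}. x j = F j e) \<and> Q (\<lambda>i. if i < K then x i else e (i - K))) \<longleftrightarrow>
    Q (\<lambda>j. F j e)" for e
    by (metis (no_types, lifting))
  with * show ?thesis by (rule dfn_cong)
qed

lemma dfnf_var: "dfnf M (\<lambda>e. e i)"
  unfolding dfnf_def by (rule dfn_eq_var)

lemma dfnf_const: "dfnf M (\<lambda>e. a)"
  unfolding dfnf_def
  by (rule dfn_cong[OF dfn_inst[OF dfn_eq_var[of M 0 1], of "\<lambda>j. if j = 0 then Inl 0 else Inr a"]]) simp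

lemma dfnf_subst:
  assumes f: "dfnf M f" and F: "\<And>j. dfnf M (F j)"
  shows "dfnf M (\<lambda>e. f (\<lambda>j. F j e))"
  unfolding dfnf_def
proof -
  have "dfnf M (\<lambda>e. case j of 0 \<Rightarrow> e 0 | Suc j' \<Rightarrow> F j' (\<lambda>i. e (Suc i)))" for j
  proof (cases j)
    case 0 then show ?thesis by (simp add: dfnf_var)
  next
    case (Suc j')
    show ?thesis unfolding dfnf_def Suc
      using dfn_rename[OF F[unfolded dfnf_def], of "\<lambda>i. case i of 0 \<Rightarrow> 0 | Suc i \<Rightarrow> Suc (Suc i)"]
      by simp
  qed
  from dfn_subst[OF f[unfolded dfnf_def], where F = "\<lambda>j e. case j of 0 \<Rightarrow> e 0 | Suc j' \<Rightarrow> F j' (\<lambda>i. e (Suc i))", OF this]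
  show "dfn M (\<lambda>e. e 0 = f (\<lambda>j. F j (\<lambda>i. e (Suc i))))" by simp
qed

lemma dfn_subst1:
  assumes R: "dfn1 M R" and f: "dfnf M f" and F: "\<And>j. dfnf M (F j)"
  shows "dfn M (\<lambda>e. R (\<lambda>j. F j e) (f e))"
proof -
  have "dfnf M (\<lambda>e. case j of 0 \<Rightarrow> f e | Suc j' \<Rightarrow> F j' e)" for j
    using f F by (cases j) auto
  from dfn_subst[OF R, where F = "\<lambda>j e. case j of 0 \<Rightarrow> f e | Suc j' \<Rightarrow> F j' e", OF this] show ?thesis by simp
qed

text \<open>Quantifying over a whole valuation only involves the finitely many coordinates that matter.\<close>

lemma dfn_ex_all:
  assumes "dfn1 M R"
  shows "dfn M (\<lambda>e. \<exists>e'. R e' (e 0))"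
proof -
  obtain K where K: "\<And>e e' :: nat \<Rightarrow> _. (\<And>i. i < K \<Longrightarrow> e i = e' i) \<Longrightarrow>
      R (\<lambda>i. e (Suc i)) (e 0) = R (\<lambda>i. e' (Suc i)) (e' 0)"
    using dfn_finite_support[OF assms] by blast
  have "dfn M (\<lambda>e. R (\<lambda>i. e i) (e K))"
    using dfn_rename[OF assms, of "\<lambda>j. case j of 0 \<Rightarrow> K | Suc j \<Rightarrow> j"] by simp
  from dfn_rename[OF dfn_ex_below[OF this, of K], of "\<lambda>i. 0"]
  have *: "dfn M (\<lambda>e. \<exists>x. R (\<lambda>i. if i < K then x i else e 0) (e 0))" by simp
  have "(\<exists>x. R (\<lambda>i. if i < K then x i else e 0) (e 0)) \<longleftrightarrow> (\<exists>e'. R e' (e 0))" for e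
  proof
    assume "\<exists>e'. R e' (e 0)"
    then obtain e' where "R e' (e 0)" by blast
    then have "R (\<lambda>i. if i < K then e' i else e 0) (e 0)"
      using K[of "case_nat (e 0) e'" "case_nat (e 0) (\<lambda>i. if i < K then e' i else e 0)"]
      by (simp split: nat.split)
    then show "\<exists>x. R (\<lambda>i. if i < K then x i else e 0) (e 0)" by (rule exI[of _ e'])
  qed blast
  with * show ?thesis by (rule dfn_cong)
qed

lemma dfn_of_definable:
  assumes "definable M A k X"
  obtains P where "dfn M P" "\<And>e e'. (\<And>i. i < k \<Longrightarrow> e i = e' i) \<Longrightarrow> P e = P e'"
    "X = {xs. length xs = k \<and> P (\<lambda>i. xs ! i)}"
proof -
  obtain \<phi> p where \<phi>: "formula_in (lang M) \<phi>"
    "X = {xs. length xs = k \<and> sat M (\<lambda>i. if i < k then xs ! i else p i) \<phi>}"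
    using assms by (auto simp: definable_def)
  define P where "P e = sat M (\<lambda>i. if i < k then e i else p i) \<phi>" for e
  have "(\<lambda>i. case if i < k then Inl i else Inr (p i) of Inl j \<Rightarrow> e j | Inr a \<Rightarrow> a) =
    (\<lambda>i. if i < k then e i else p i)" for e
    by (auto simp: fun_eq_iff)
  then have "dfn M P"
    by (intro dfnI[OF \<phi>(1), of _ "\<lambda>i. if i < k then Inl i else Inr (p i)"]) (simp add: P_def)
  moreover have "P e = P e'" if "\<And>i. i < k \<Longrightarrow> e i = e' i" for e e'
  proof -
    have "(\<lambda>i. if i < k then e i else p i) = (\<lambda>i. if i < k then e' i else p i)"
      using that by auto
    then show ?thesis by (simp add: P_def)
  qed
  moreover have "X = {xs. length xs = k \<and> P (\<lambda>i. xs ! i)}"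
    unfolding \<phi>(2) P_def ..
  ultimately show ?thesis using that by blast
qed

lemma definable_of_dfn:
  assumes "dfn M P" "\<And>e e'. (\<And>i. i < k \<Longrightarrow> e i = e' i) \<Longrightarrow> P e = P e'"
  shows "definable M UNIV k {xs. length xs = k \<and> P (\<lambda>i. xs ! i)}"
proof -
  obtain \<phi> p where \<phi>: "formula_in (lang M) \<phi>" "\<And>e. P e \<longleftrightarrow> sat M (interleave e p) \<phi>"
    using assms(1) by (auto simp: dfn_def)
  let ?t = "\<lambda>i. if even i \<and> i div 2 < k then i div 2 else k + i"
  obtain \<psi> where \<psi>: "formula_in (lang M) \<psi>" "\<And>e. sat M e \<psi> = sat M (\<lambda>i. e (?t i)) \<phi>"
    using rename_formula[of "lang M" \<phi> ?t] \<phi>(1) by blast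
  let ?q = "\<lambda>i. p ((i - k) div 2)"
  have "P (\<lambda>i. xs ! i) \<longleftrightarrow> sat M (\<lambda>i. if i < k then xs ! i else ?q i) \<psi>" for xs
  proof -
    let ?e = "\<lambda>i. if i < k then xs ! i else p i"
    have *: "(\<lambda>i. (\<lambda>i. if i < k then xs ! i else ?q i) (?t i)) = interleave ?e p"
      by (auto simp: fun_eq_iff interleave_def)
    have "P (\<lambda>i. xs ! i) = P ?e" by (rule assms(2)) simp
    also have "\<dots> = sat M (\<lambda>i. (\<lambda>i. if i < k then xs ! i else ?q i) (?t i)) \<phi>"
      by (subst *) (rule \<phi>(2))
    finally show ?thesis by (simp only: \<psi>(2))
  qed
  then show ?thesis
    unfolding definable_def using \<psi>(1) by (intro exI[of _ \<psi>] exI[of _ ?q]) auto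
qed

lemma dfn_reduct:
  assumes "reduct M N" "dfn M P"
  shows "dfn N P"
proof -
  obtain \<phi> p where \<phi>: "formula_in (lang M) \<phi>" "\<And>e. P e \<longleftrightarrow> sat M (interleave e p) \<phi>"
    using assms(2) by (auto simp: dfn_def)
  obtain K where K: "\<forall>i\<in>free_vars \<phi>. i < K"
    using finite_free_vars finite_nat_set_iff_bounded by metis
  define X where "X = {xs. length xs = K \<and> sat M (\<lambda>i. if i < K then xs ! i else undefined i) \<phi>}"
  have "definable M {} K X"
    unfolding definable_def X_def using \<phi>(1) K by (intro exI[of _ \<phi>] exI[of _ undefined]) auto
  then have "definable N UNIV K X"
    using assms(1) by (auto simp: reduct_over_def)
  then obtain Q where Q: "dfn N Q" "\<And>e e'. (\<And>i. i < K \<Longrightarrow> e i = e' i) \<Longrightarrow> Q e = Q e'"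
    "X = {xs. length xs = K \<and> Q (\<lambda>i. xs ! i)}"
    by (rule dfn_of_definable) blast
  have "P e = Q (interleave e p)" for e
  proof -
    let ?xs = "map (interleave e p) [0..<K]"
    have "P e = sat M (\<lambda>i. if i < K then ?xs ! i else undefined i) \<phi>"
      unfolding \<phi>(2) by (rule sat_cong) (use K in auto)
    also have "\<dots> = (?xs \<in> X)" by (simp add: X_def)
    also have "\<dots> = Q (\<lambda>i. ?xs ! i)" by (simp add: Q(3))
    also have "\<dots> = Q (interleave e p)" by (rule Q(2)) simp
    finally show ?thesis .
  qed
  moreover have "interleave e p =
    (\<lambda>j. case if even j then Inl (j div 2) else Inr (p (j div 2)) of Inl k \<Rightarrow> e k | Inr a \<Rightarrow> a)" for e
    by (auto simp: fun_eq_iff interleave_def)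
  ultimately have "P e = Q (\<lambda>j. case if even j then Inl (j div 2) else Inr (p (j div 2)) of Inl k \<Rightarrow> e k | Inr a \<Rightarrow> a)" for e
    by presburger
  then show ?thesis
    using dfn_inst[OF Q(1), of "\<lambda>j. if even j then Inl (j div 2) else Inr (p (j div 2))"]
    by (auto elim: dfn_cong)
qed

section \<open>Integer multiples\<close>

notation int_multiple (infixr "\<cdot>" 75)

lemma int_multiple_0 [simp]: "0 \<cdot> a = 0"
  by (simp add: int_multiple_def)

lemma int_multiple_Suc: "(m + 1) \<cdot> a = m \<cdot> a + a"
proof (cases "0 \<le> m")
  case True
  then have "nat (m + 1) = Suc (nat m)" by simp
  then show ?thesis using True by (simp add: int_multiple_def)
next
  case False
  then have "nat (- m) = Suc (nat (- (m + 1)))" by simp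
  then have "(\<Sum>i<nat (- m). a) = (\<Sum>i<nat (- (m + 1)). a) + a" by simp
  then show ?thesis using False by (auto simp: int_multiple_def)
qed

lemma int_multiple_1 [simp]: "1 \<cdot> a = a"
  using int_multiple_Suc[of 0 a] by simp

lemma int_multiple_add_left: "(m + n) \<cdot> a = m \<cdot> a + n \<cdot> a"
proof (induction n rule: int_induct[where k = 0])
  case (step1 i)
  then show ?case using int_multiple_Suc[of "m + i" a] int_multiple_Suc[of i a]
    by (simp add: add.assoc)
next
  case (step2 i)
  then show ?case using int_multiple_Suc[of "m + (i - 1)" a] int_multiple_Suc[of "i - 1" a]
    by (simp add: algebra_simps)
qed simp

lemma int_multiple_minus_left: "(- m) \<cdot> a = - (m \<cdot> a)"
  using int_multiple_add_left[of "- m" m a] by (simp add: eq_neg_iff_add_eq_0)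

lemma int_multiple_diff_left: "(m - n) \<cdot> a = m \<cdot> a - n \<cdot> a"
  using int_multiple_add_left[of m "- n" a] by (simp add: int_multiple_minus_left)

lemma int_multiple_add_right: "m \<cdot> (a + b) = m \<cdot> a + m \<cdot> b"
  by (simp add: int_multiple_def sum.distrib)

lemma int_multiple_0_right [simp]: "m \<cdot> 0 = 0"
  by (simp add: int_multiple_def)

lemma int_multiple_minus_right: "m \<cdot> (- a) = - (m \<cdot> a)"
  using int_multiple_add_right[of m "- a" a] by (simp add: eq_neg_iff_add_eq_0)

lemma int_multiple_diff_right: "m \<cdot> (a - b) = m \<cdot> a - m \<cdot> b"
  using int_multiple_add_right[of m a "- b"] by (simp add: int_multiple_minus_right)

lemma int_multiple_assoc: "m \<cdot> n \<cdot> a = (m * n) \<cdot> a"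
  by (induction m rule: int_induct[where k = 0])
     (simp_all add: int_multiple_add_left int_multiple_diff_left distrib_right left_diff_distrib)

lemma int_multiple_sum: "m \<cdot> (\<Sum>i\<in>A. f i) = (\<Sum>i\<in>A. m \<cdot> f i)"
  by (induction A rule: infinite_finite_induct) (auto simp: int_multiple_add_right)

lemma int_multiple_pos:
  fixes a :: "'a::linordered_ab_group_add"
  assumes "0 < m" "0 < a"
  shows "0 < m \<cdot> a"
proof -
  have "0 < nat m" using assms by simp
  then have "0 \<in> {..<nat m}" by simp
  then have "{..<nat m} \<noteq> {}" by blast
  then have "0 < (\<Sum>i<nat m. a)" using assms(2) by (intro sum_pos) simp_all
  then show ?thesis using assms by (simp add: int_multiple_def)
qed

lemma int_multiple_less_iff:
  fixes a b :: "'a::linordered_ab_group_add"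
  assumes "0 < m"
  shows "m \<cdot> a < m \<cdot> b \<longleftrightarrow> a < b"
proof -
  have "m \<cdot> x < m \<cdot> y" if "x < y" for x y :: 'a
    using int_multiple_pos[of m "y - x"] assms that by (simp add: int_multiple_diff_right)
  then show ?thesis by (metis less_asym linorder_less_linear)
qed

lemma int_multiple_le_iff:
  fixes a b :: "'a::linordered_ab_group_add"
  shows "0 < m \<Longrightarrow> m \<cdot> a \<le> m \<cdot> b \<longleftrightarrow> a \<le> b"
  using int_multiple_less_iff[of m b a] by (simp add: linorder_not_less[symmetric])

lemma int_multiple_eq_iff:
  fixes a b :: "'a::linordered_ab_group_add"
  shows "m \<noteq> 0 \<Longrightarrow> m \<cdot> a = m \<cdot> b \<longleftrightarrow> a = b"
  using int_multiple_less_iff[of m a b] int_multiple_less_iff[of m b a]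
    int_multiple_less_iff[of "- m" a b] int_multiple_less_iff[of "- m" b a]
  by (cases "0 < m"; cases a b rule: linorder_cases) (force simp: int_multiple_minus_left)+

lemma int_multiple_mono_left:
  fixes a :: "'a::linordered_ab_group_add"
  assumes "m \<le> n" "0 \<le> a"
  shows "m \<cdot> a \<le> n \<cdot> a"
proof (cases "m = n \<or> a = 0")
  case False
  then have "0 < (n - m) \<cdot> a" using assms by (intro int_multiple_pos) auto
  then show ?thesis by (simp add: int_multiple_diff_left)
qed auto

lemma int_multiple_less_left_iff:
  fixes a :: "'a::linordered_ab_group_add"
  assumes "0 < a"
  shows "m \<cdot> a < n \<cdot> a \<longleftrightarrow> m < n"
proof -
  have "x \<cdot> a < y \<cdot> a" if "x < y" for x y
    using int_multiple_pos[of "y - x" a] assms that by (simp add: int_multiple_diff_left)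
  then show ?thesis by (metis less_asym linorder_less_linear)
qed

section \<open>Definability in expansions of a group\<close>

definition defines_plus :: "('f, 'r, 'a::ab_group_add) fo_structure \<Rightarrow> bool" where
  "defines_plus M \<longleftrightarrow> dfn M (\<lambda>e. e 0 = e 1 + e 2)"

lemma defines_plus_group: "defines_plus (group_structure :: (_, _, 'a::ab_group_add) fo_structure)"
  unfolding defines_plus_def
  by (rule dfnI[of _ "Eq (Var 0) (Fun Plus [Var 1, Var 2])" _ Inl])
     (auto simp: group_structure_def)

lemma defines_plus_ordered_group:
  "defines_plus (ordered_group_structure :: (_, _, 'a::linordered_ab_group_add) fo_structure)"
  unfolding defines_plus_def
  by (rule dfnI[of _ "Eq (Var 0) (Fun Plus [Var 1, Var 2])" _ Inl])
     (auto simp: ordered_group_structure_def)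

lemma defines_plus_expansion: "reduct M N \<Longrightarrow> defines_plus M \<Longrightarrow> defines_plus N"
  unfolding defines_plus_def by (rule dfn_reduct)

lemma dfn_subst2:
  assumes "dfn M (\<lambda>e. Q (e 0) (e 1))" "dfnf M f" "dfnf M g"
  shows "dfn M (\<lambda>e. Q (f e) (g e))"
proof -
  have "dfnf M (\<lambda>e. if j = 0 then f e else g e)" for j :: nat using assms by (cases "j = 0") auto
  from dfn_subst[OF assms(1), where F = "\<lambda>j e. if j = 0 then f e else g e", OF this]
  show ?thesis by simp
qed

lemma dfnf_subst2:
  assumes "dfnf M (\<lambda>e. h (e 0) (e 1))" "dfnf M f" "dfnf M g"
  shows "dfnf M (\<lambda>e. h (f e) (g e))"
proof -
  have "dfnf M (\<lambda>e. if j = 0 then f e else g e)" for j :: nat using assms by (cases "j = 0") auto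
  from dfnf_subst[OF assms(1), where F = "\<lambda>j e. if j = 0 then f e else g e", OF this]
  show ?thesis by simp
qed

lemma dfn_eq: "dfnf M f \<Longrightarrow> dfnf M g \<Longrightarrow> dfn M (\<lambda>e. f e = g e)"
  by (rule dfn_subst2[OF dfn_eq_var[of M 0 1]])

lemma dfnf_add:
  assumes M: "defines_plus M" and "dfnf M f" "dfnf M g"
  shows "dfnf M (\<lambda>e. f e + g e)"
proof (rule dfnf_subst2[OF _ assms(2,3)])
  show "dfnf M (\<lambda>e. e 0 + e 1)"
    unfolding dfnf_def using M by (simp add: defines_plus_def numeral_2_eq_2)
qed

lemma dfnf_diff:
  assumes M: "defines_plus M" and "dfnf M f" "dfnf M g"
  shows "dfnf M (\<lambda>e. f e - g e)"
proof (rule dfnf_subst2[OF _ assms(2,3)])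
  have "dfn M (\<lambda>e. e 1 = e 0 + e 2)"
    using dfn_rename[OF M[unfolded defines_plus_def], of "\<lambda>i. if i = 0 then 1 else if i = 1 then 0 else 2"]
    by simp
  then have "dfn M (\<lambda>e. e 0 = e 1 - e 2)"
    by (rule dfn_cong) (auto simp: algebra_simps)
  then show "dfnf M (\<lambda>e. e 0 - e 1)"
    unfolding dfnf_def by (simp add: numeral_2_eq_2)
qed

lemma dfnf_uminus: "defines_plus M \<Longrightarrow> dfnf M f \<Longrightarrow> dfnf M (\<lambda>e. - f e)"
  using dfnf_diff[OF _ dfnf_const[of M 0], of f] by simp

lemma dfnf_int_multiple:
  assumes M: "defines_plus M" and f: "dfnf M f"
  shows "dfnf M (\<lambda>e. m \<cdot> f e)"
proof (induction m rule: int_induct[where k = 0])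
  case base
  show ?case using dfnf_const[of M 0] by simp
next
  case (step1 i)
  show ?case using dfnf_add[OF M step1(2) f] by (simp add: int_multiple_add_left)
next
  case (step2 i)
  show ?case using dfnf_diff[OF M step2(2) f] by (simp add: int_multiple_diff_left)
qed

lemma dfnf_sum:
  assumes M: "defines_plus M" and "\<And>i. i \<in> A \<Longrightarrow> dfnf M (f i)"
  shows "dfnf M (\<lambda>e. \<Sum>i\<in>A. f i e)"
  using assms(2)
proof (induction A rule: infinite_finite_induct)
  case (insert i A)
  then have "dfnf M (\<lambda>e. f i e + (\<Sum>i\<in>A. f i e))" by (intro dfnf_add[OF M]) auto
  then show ?case using insert.hyps by simp
qed (use dfnf_const[of M 0] in simp_all)

lemma ordered_group_structure_simps [simp]:
  "lang ordered_group_structure = \<lparr>fun_symbols = {(Plus, 2)}, rel_symbols = {(Less, 2)}\<rparr>"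
  "fun_interp ordered_group_structure f xs = xs ! 0 + xs ! 1"
  "rel_interp ordered_group_structure r xs = (xs ! 0 < xs ! 1)"
  by (simp_all add: ordered_group_structure_def)

lemma dfn_less:
  "dfnf ordered_group_structure f \<Longrightarrow> dfnf ordered_group_structure g \<Longrightarrow>
   dfn ordered_group_structure (\<lambda>e. f e < (g e :: 'a::linordered_ab_group_add))"
proof (rule dfn_subst2)
  show "dfn ordered_group_structure (\<lambda>e. e 0 < (e 1 :: 'a))"
    by (rule dfnI[of _ "Rel Less [Var 0, Var 1]" _ Inl]) auto
qed

section \<open>What elementary equivalence to an archimedean group gives\<close>

text \<open>Passing to the universal closure, elementary equivalence covers the validity of formulas with
  free variables. All transfer arguments below use open formulas.\<close>

lemma elementarily_equivalent_valid:
  fixes M :: "('f, 'r, 'a) fo_structure" and N :: "('f, 'r, 'b) fo_structure"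
  assumes MN: "elementarily_equivalent M N" and "formula_in (lang M) \<phi>"
  shows "(\<forall>e. sat M e \<phi>) \<longleftrightarrow> (\<forall>e. sat N e \<phi>)"
  using assms(2)
proof (induction "card (free_vars \<phi>)" arbitrary: \<phi>)
  case 0
  then have "free_vars \<phi> = {}" using finite_free_vars[of \<phi>] by simp
  then show ?case using MN 0 unfolding elementarily_equivalent_def by blast
next
  case (Suc n)
  then obtain i where i: "i \<in> free_vars \<phi>" by (metis card.empty ex_in_conv nat.distinct(1))
  let ?\<psi> = "Neg (Exists i (Neg \<phi>))"
  have closure: "(\<forall>e. sat S e ?\<psi>) \<longleftrightarrow> (\<forall>e. sat S e \<phi>)" for S :: "('f, 'r, 'c) fo_structure"
  proof
    assume *: "\<forall>e. sat S e ?\<psi>"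
    have "sat S (e(i := e i)) \<phi>" for e using *[rule_format, of e] by (simp del: fun_upd_triv)
    then show "\<forall>e. sat S e \<phi>" by simp
  qed simp
  have "n = card (free_vars ?\<psi>)"
    using Suc.hyps(2) i finite_free_vars[of \<phi>] by simp
  moreover have "formula_in (lang M) ?\<psi>" using Suc.prems by simp
  ultimately have "(\<forall>e. sat M e ?\<psi>) \<longleftrightarrow> (\<forall>e. sat N e ?\<psi>)" by (rule Suc.hyps(1))
  then show ?case by (simp only: closure)
qed

text \<open>The term \<open>(n + 1) t\<close>; the language has no name for zero.\<close>

primrec multiple_term :: "nat \<Rightarrow> group_symbol fo_term \<Rightarrow> group_symbol fo_term" where
  "multiple_term 0 t = t"
| "multiple_term (Suc n) t = Fun Plus [multiple_term n t, t]"

lemma multiple_term_in: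
  "term_in (lang ordered_group_structure) t \<Longrightarrow>
   term_in (lang ordered_group_structure) (multiple_term n t)"
  by (induction n) auto

lemma term_value_multiple [simp]:
  "term_value ordered_group_structure e (multiple_term n t) =
   (int n + 1) \<cdot> term_value ordered_group_structure e t"
proof (induction n)
  case (Suc n)
  then show ?case using int_multiple_Suc[of "int n + 1" "term_value ordered_group_structure e t"]
    by (simp add: add.commute)
qed simp

text \<open>The consequence of being archimedean that elimination of quantifiers rests on: above any \<open>c\<close>, the
  multiples of \<open>m\<close> either have a first element or come arbitrarily close to \<open>c\<close>. Unlike the
  archimedean property, it is first-order for each \<open>m\<close>.\<close>

definition regular_group :: "'a::linordered_ab_group_add itself \<Rightarrow> bool" where
  "regular_group _ \<longleftrightarrow> (\<forall>m\<ge>1. \<forall>c :: 'a.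
     (\<exists>s. c < m \<cdot> s \<and> (\<forall>t. c < m \<cdot> t \<longrightarrow> s \<le> t)) \<or> (\<forall>d>c. \<exists>t. c < m \<cdot> t \<and> m \<cdot> t < d))"

definition finite_index :: "'a::ab_group_add itself \<Rightarrow> bool" where
  "finite_index _ \<longleftrightarrow> (\<forall>n\<ge>1. \<exists>R :: 'a set. finite R \<and> (\<forall>x. \<exists>r\<in>R. \<exists>y. x = r + n \<cdot> y))"

definition least_positive :: "'a::linordered_ab_group_add \<Rightarrow> bool" where
  "least_positive u \<longleftrightarrow> 0 < u \<and> (\<forall>x>0. u \<le> x)"

text \<open>By the archimedean property, each element of \<open>T\<close> is finitely many steps of length \<open>u\<close> above the
  bound \<open>b\<close>, so an element with the least number of steps is a minimum.\<close>

lemma archimedean_discrete_min: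
  fixes u :: "'a::linordered_ab_group_add"
  assumes arch: "archimedean_group TYPE('a)" and u: "least_positive u"
    and T: "t \<in> T" "\<And>t :: 'a. t \<in> T \<Longrightarrow> b \<le> t"
  shows "\<exists>s\<in>T. \<forall>t\<in>T. s \<le> t"
proof -
  define \<mu> where "\<mu> t = (LEAST n. t - b < int n \<cdot> u)" for t
  have ex: "\<exists>n. t - b < int n \<cdot> u" for t
  proof -
    obtain n where "t - b < n \<cdot> u"
      using arch u unfolding archimedean_group_def least_positive_def by fastforce
    also have "n \<cdot> u \<le> int (nat n) \<cdot> u"
      using u by (intro int_multiple_mono_left) (auto simp: least_positive_def)
    finally show ?thesis by blast
  qed
  have \<mu>: "t - b < int (\<mu> t) \<cdot> u" for t
    unfolding \<mu>_def by (rule LeastI_ex[OF ex])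
  obtain s where s: "s \<in> T" "\<And>t. t \<in> T \<Longrightarrow> \<mu> s \<le> \<mu> t"
    using ex_has_least_nat[of "\<lambda>t. t \<in> T" t \<mu>] T(1) by blast
  have "s \<le> t" if "t \<in> T" for t
  proof (rule ccontr)
    assume "\<not> s \<le> t"
    then have "u \<le> s - t" using u by (auto simp: least_positive_def)
    then have less: "t - b + u < int (\<mu> s) \<cdot> u"
      using add_le_less_mono[OF _ \<mu>[of s], of u "s - t"] by (simp add: algebra_simps)
    have "\<mu> s \<noteq> 0"
    proof
      assume "\<mu> s = 0"
      then show False using \<mu>[of s] T(2)[OF s(1)] by simp
    qed
    then have "int (\<mu> s) = int (\<mu> s - 1) + 1" by simp
    then have "int (\<mu> s) \<cdot> u = int (\<mu> s - 1) \<cdot> u + u" by (metis int_multiple_Suc)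
    then have "t - b < int (\<mu> s - 1) \<cdot> u" using less by simp
    then have "\<mu> t \<le> \<mu> s - 1" unfolding \<mu>_def[of t] by (rule Least_le)
    then show False using s(2)[OF that] \<open>\<mu> s \<noteq> 0\<close> by simp
  qed
  then show ?thesis using s(1) by blast
qed

lemma dense_small_multiple:
  fixes \<delta> :: "'a::linordered_ab_group_add"
  assumes "\<nexists>u :: 'a. least_positive u" "0 < \<delta>"
  shows "\<exists>\<epsilon>>0. int n \<cdot> \<epsilon> < \<delta>"
  using assms(2)
proof (induction n arbitrary: \<delta>)
  case 0
  then show ?case by auto
next
  case (Suc n)
  from Suc.prems obtain x where x: "0 < x" "x < \<delta>"
    using assms(1) unfolding least_positive_def by force
  from Suc.IH[OF x(1)] obtain \<epsilon> where \<epsilon>: "0 < \<epsilon>" "int n \<cdot> \<epsilon> < x" by blast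
  let ?e = "min \<epsilon> (\<delta> - x)"
  have "int n \<cdot> ?e \<le> int n \<cdot> \<epsilon>"
    by (cases "n = 0") (auto simp: int_multiple_le_iff)
  then have "int n \<cdot> ?e < x" using \<epsilon> by simp
  moreover have "?e \<le> \<delta> - x" by simp
  ultimately have "int n \<cdot> ?e + ?e < x + (\<delta> - x)" by (rule add_less_le_mono)
  then have "int (Suc n) \<cdot> ?e < \<delta>" using int_multiple_Suc[of "int n" ?e] by (simp add: add.commute)
  moreover have "0 < ?e" using \<epsilon> x by simp
  ultimately show ?case by blast
qed

text \<open>In the discrete case, the multiples above \<open>c\<close> have a first element. In the dense case there is \<open>\<epsilon>\<close>
  with \<open>m \<epsilon>\<close> shorter than a given interval, and the first of the integer multiples of \<open>m \<epsilon>\<close> beyond the lower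
  end of the interval is inside it.\<close>

lemma archimedean_regular:
  assumes arch: "archimedean_group TYPE('a::linordered_ab_group_add)"
  shows "regular_group TYPE('a)"
  unfolding regular_group_def
proof (intro allI impI)
  fix m :: int and c :: 'a
  assume m: "1 \<le> m"
  show "(\<exists>s. c < m \<cdot> s \<and> (\<forall>t. c < m \<cdot> t \<longrightarrow> s \<le> t)) \<or> (\<forall>d>c. \<exists>t. c < m \<cdot> t \<and> m \<cdot> t < d)"
  proof (cases "\<exists>u :: 'a. least_positive u")
    case True
    then obtain u :: 'a where u: "least_positive u" by blast
    then have u0: "0 < u" by (simp add: least_positive_def)
    define B where "B = max c (- c)"
    have B: "c \<le> B" "- B \<le> c" "0 \<le> B"
      by (auto simp: B_def minus_le_iff le_max_iff_disj)
    have "m \<cdot> (B + u) \<ge> 1 \<cdot> (B + u)"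
      using m u0 B by (intro int_multiple_mono_left) (auto intro: add_nonneg_nonneg)
    moreover have "c < B + u" using u0 B(1) by (metis add.commute add_strict_increasing)
    ultimately have 1: "B + u \<in> {t. c < m \<cdot> t}" by simp
    have 2: "- B \<le> t" if "t \<in> {t. c < m \<cdot> t}" for t
    proof (rule ccontr)
      assume "\<not> - B \<le> t"
      then have t: "B < - t" by (metis less_minus_iff linorder_not_le)
      have "1 \<cdot> (- t) \<le> m \<cdot> (- t)"
        using m less_imp_le[OF le_less_trans[OF B(3) t]] by (rule int_multiple_mono_left)
      with t have "B < m \<cdot> (- t)" by simp
      then have "B < - (m \<cdot> t)" by (simp only: int_multiple_minus_right)
      then have "m \<cdot> t < - B" by (metis less_minus_iff)
      then show False using that B(2) by simp
    qed
    from archimedean_discrete_min[OF arch u 1 2] show ?thesis by auto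
  next
    case False
    have "\<exists>t. c < m \<cdot> t \<and> m \<cdot> t < d" if "c < d" for d
    proof -
      obtain \<epsilon> where \<epsilon>: "0 < \<epsilon>" "int (nat m) \<cdot> \<epsilon> < d - c"
        using dense_small_multiple[OF False, of "d - c" "nat m"] \<open>c < d\<close> by auto
      define w where "w = m \<cdot> \<epsilon>"
      have w: "0 < w" "w < d - c" using \<epsilon> m int_multiple_pos[of m \<epsilon>] by (auto simp: w_def)
      obtain n n' where n: "c < n \<cdot> w" and n': "- c < n' \<cdot> w"
        using arch w(1) unfolding archimedean_group_def by (metis less_irrefl)
      have lower: "(- n') \<cdot> w < c" using n' by (metis int_multiple_minus_left minus_less_iff)
      then have "(- n') \<cdot> w < n \<cdot> w" using n by (rule less_trans)
      then have "- n' < n" using w(1) by (simp only: int_multiple_less_left_iff)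
      then have "- n' + int (nat (n + n')) = n" by simp
      then have ex: "\<exists>j. c < (- n' + int j) \<cdot> w" using n by metis
      define j where "j = (LEAST j. c < (- n' + int j) \<cdot> w)"
      have j: "c < (- n' + int j) \<cdot> w" unfolding j_def by (rule LeastI_ex[OF ex])
      have "j \<noteq> 0"
      proof
        assume "j = 0"
        then show False using j lower by simp
      qed
      then have "j - 1 < (LEAST j. c < (- n' + int j) \<cdot> w)" unfolding j_def[symmetric] by simp
      then have "\<not> c < (- n' + int (j - 1)) \<cdot> w" by (rule not_less_Least)
      moreover have "(- n' + int j) \<cdot> w = (- n' + int (j - 1)) \<cdot> w + w"
      proof -
        have "- n' + int j = (- n' + int (j - 1)) + 1" using \<open>j \<noteq> 0\<close> by simp
        then show ?thesis by (metis int_multiple_Suc)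
      qed
      ultimately have "(- n' + int j) \<cdot> w \<le> c + w" by simp
      also have "c + w < d" using w(2) by (simp add: less_diff_eq add.commute)
      finally have "(- n' + int j) \<cdot> w < d" .
      moreover have "(- n' + int j) \<cdot> w = m \<cdot> ((- n' + int j) \<cdot> \<epsilon>)"
        unfolding w_def by (simp only: int_multiple_assoc mult.commute)
      ultimately show ?thesis using j by metis
    qed
    then show ?thesis by blast
  qed
qed

lemma all_valuations: "(\<forall>e :: nat \<Rightarrow> 'c. P (e 0)) \<longleftrightarrow> (\<forall>c. P c)"
proof
  assume *: "\<forall>e :: nat \<Rightarrow> 'c. P (e 0)"
  show "\<forall>c. P c" using *[rule_format, of "\<lambda>_. _"] by simp
qed simp

lemma regular_transfer:
  assumes eq: "elementarily_equivalent
      (ordered_group_structure :: (_, _, 'a::linordered_ab_group_add) fo_structure)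
      (ordered_group_structure :: (_, _, 'h::linordered_ab_group_add) fo_structure)"
    and reg: "regular_group TYPE('h)"
  shows "regular_group TYPE('a)"
  unfolding regular_group_def
proof (rule allI, rule impI)
  fix m :: int assume m: "1 \<le> m"
  define k where "k = nat (m - 1)"
  have k: "int k + 1 = m" using m by (simp add: k_def)
  let ?m = "\<lambda>i. multiple_term k (Var i)"
  let ?has_least = "Exists 1 (And (Rel Less [Var 0, ?m 1])
    (Neg (Exists 2 (And (Rel Less [Var 0, ?m 2]) (Rel Less [Var 2, Var 1])))))"
  let ?not_close = "Exists 3 (And (Rel Less [Var 0, Var 3])
    (Neg (Exists 2 (And (Rel Less [Var 0, ?m 2]) (Rel Less [?m 2, Var 3])))))"
  let ?\<phi> = "Neg (And (Neg ?has_least) ?not_close)"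
  have sat: "(\<forall>e. sat (ordered_group_structure :: (_, _, 'c::linordered_ab_group_add) fo_structure) e ?\<phi>) \<longleftrightarrow>
    (\<forall>c::'c. (\<exists>s. c < m \<cdot> s \<and> (\<forall>t. c < m \<cdot> t \<longrightarrow> s \<le> t)) \<or> (\<forall>d>c. \<exists>t. c < m \<cdot> t \<and> m \<cdot> t < d))"
    (is "_ = (\<forall>c. ?P c)")
  proof -
    have "sat (ordered_group_structure :: (_, _, 'c) fo_structure) e ?\<phi> \<longleftrightarrow> ?P (e 0)" for e
      using k by (simp add: linorder_not_less[symmetric])
    then have "(\<forall>e. sat (ordered_group_structure :: (_, _, 'c) fo_structure) e ?\<phi>) \<longleftrightarrow> (\<forall>e :: nat \<Rightarrow> 'c. ?P (e 0))"
      by (simp only:)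
    also have "\<dots> \<longleftrightarrow> (\<forall>c. ?P c)" by (rule all_valuations)
    finally show ?thesis .
  qed
  have "formula_in (lang (ordered_group_structure :: (_, _, 'a) fo_structure)) ?\<phi>"
    using multiple_term_in[of "Var _" k] by simp
  from elementarily_equivalent_valid[OF eq this] reg m
  show "\<forall>c::'a. (\<exists>s. c < m \<cdot> s \<and> (\<forall>t. c < m \<cdot> t \<longrightarrow> s \<le> t)) \<or> (\<forall>d>c. \<exists>t. c < m \<cdot> t \<and> m \<cdot> t < d)"
    unfolding sat by (auto simp: regular_group_def)
qed

lemma finite_index_of_small_quotients:
  assumes "small_quotients TYPE('a::ab_group_add)"
  shows "finite_index TYPE('a)"
  unfolding finite_index_def
proof (intro allI impI)
  fix n :: int assume n: "1 \<le> n"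
  define q where "q g = (+) g ` range (int_multiple n)" for g :: 'a
  have "1 \<le> nat n" using n by simp
  then have "finite (range (\<lambda>g::'a. (+) g ` range (int_multiple (int (nat n)))))"
    using assms unfolding small_quotients_def by blast
  then have fin: "finite (range q)" using n by (simp add: q_def[abs_def])
  define R where "R = (\<lambda>C. SOME g. C = q g) ` range q"
  have "\<exists>r\<in>R. \<exists>y. x = r + n \<cdot> y" for x
  proof -
    let ?r = "SOME g. q x = q g"
    have "q x = q ?r" by (rule someI[of _ x]) simp
    moreover have "x \<in> q x" using rangeI[of "int_multiple n" "0::'a"] by (force simp: q_def)
    ultimately have "x \<in> q ?r" by simp
    moreover have "?r \<in> R" by (simp add: R_def)
    ultimately show ?thesis by (auto simp: q_def)
  qed
  moreover have "finite R" using fin by (simp add: R_def)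
  ultimately show "\<exists>R :: 'a set. finite R \<and> (\<forall>x. \<exists>r\<in>R. \<exists>y. x = r + n \<cdot> y)" by blast
qed

text \<open>If variable \<open>0\<close> is bound by an existential quantifier and the candidates for representatives are the free
  variables \<open>2, ..., k + 1\<close>, then the formula is invalid if and only if \<open>k\<close> representatives modulo
  \<open>n + 1\<close> suffice. Leaving them free avoids a block of quantifiers.\<close>

primrec uncovered :: "nat \<Rightarrow> nat \<Rightarrow> (group_symbol, order_symbol) formula" where
  "uncovered n 0 = Eq (Var 0) (Var 0)"
| "uncovered n (Suc k) = And (uncovered n k)
     (Neg (Exists 1 (Eq (Var 0) (Fun Plus [Var (k + 2), multiple_term n (Var 1)]))))"

lemma sat_uncovered:
  "sat (ordered_group_structure :: (_, _, 'c::linordered_ab_group_add) fo_structure) e (uncovered n k) \<longleftrightarrow>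
   (\<forall>j<k. \<nexists>y. e 0 = e (j + 2) + (int n + 1) \<cdot> y)"
  by (induction k) (simp_all add: All_less_Suc conj_commute)

lemma uncovered_in: "formula_in (lang ordered_group_structure) (uncovered n k)"
  using multiple_term_in[of "Var _" n]
  by (induction k) auto

lemma finite_index_transfer:
  assumes eq: "elementarily_equivalent
      (ordered_group_structure :: (_, _, 'a::linordered_ab_group_add) fo_structure)
      (ordered_group_structure :: (_, _, 'h::linordered_ab_group_add) fo_structure)"
    and idx: "finite_index TYPE('h)"
  shows "finite_index TYPE('a)"
  unfolding finite_index_def
proof (intro allI impI)
  fix m :: int assume m: "1 \<le> m"
  define n where "n = nat (m - 1)"
  have n: "int n + 1 = m" using m by (simp add: n_def)
  from idx m obtain R :: "'h set" where R: "finite R" "\<And>x. \<exists>r\<in>R. \<exists>y. x = r + m \<cdot> y"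
    unfolding finite_index_def by blast
  obtain k and f :: "nat \<Rightarrow> 'h" where f: "R = f ` {j. j < k}"
    using finite_imp_nat_seg_image_inj_on[OF R(1)] by blast
  let ?\<phi> = "Exists 0 (uncovered n k)"
  have sat: "sat (ordered_group_structure :: (_, _, 'c::linordered_ab_group_add) fo_structure) e ?\<phi> \<longleftrightarrow>
      (\<exists>x. \<forall>j<k. \<nexists>y. x = e (j + 2) + m \<cdot> y)" for e
    by (simp add: sat_uncovered n)
  have "\<not> sat ordered_group_structure (\<lambda>i. f (i - 2)) ?\<phi>"
    using R(2) unfolding sat f by force
  moreover have "formula_in (lang (ordered_group_structure :: (_, _, 'a) fo_structure)) ?\<phi>"
    using uncovered_in by simp
  ultimately obtain e :: "nat \<Rightarrow> 'a" where "\<not> sat ordered_group_structure e ?\<phi>"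
    using elementarily_equivalent_valid[OF eq] by blast
  then have "\<exists>j<k. \<exists>y. x = e (j + 2) + m \<cdot> y" for x unfolding sat by blast
  then show "\<exists>R :: 'a set. finite R \<and> (\<forall>x. \<exists>r\<in>R. \<exists>y. x = r + m \<cdot> y)"
    by (intro exI[of _ "(\<lambda>j. e (j + 2)) ` {..<k}"]) (auto simp: Bex_def)
qed

text \<open>A group elementarily equivalent to a discrete archimedean group inherits from it that
  bounded definable sets have maxima.\<close>

lemma definable_max_transfer:
  fixes A :: "'a::linordered_ab_group_add set"
  assumes eq: "elementarily_equivalent
      (ordered_group_structure :: (_, _, 'a) fo_structure)
      (ordered_group_structure :: (_, _, 'h::linordered_ab_group_add) fo_structure)"
    and arch: "archimedean_group TYPE('h)" and u: "least_positive (u :: 'a)"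
    and A: "dfn ordered_group_structure (\<lambda>e. e 0 \<in> A)" "a \<in> A" "\<And>x. x \<in> A \<Longrightarrow> x \<le> b"
  shows "\<exists>s\<in>A. \<forall>t\<in>A. t \<le> s"
proof -
  let ?H = "ordered_group_structure :: (_, _, 'h) fo_structure"
  let ?G = "ordered_group_structure :: (_, _, 'a) fo_structure"
  let ?pos = "\<lambda>i. Rel Less [Var i, Fun Plus [Var i, Var i]]"
  let ?discrete = "Exists 0 (And (?pos 0) (Neg (Exists 1 (And (?pos 1) (Rel Less [Var 1, Var 0])))))"
  have sat_discrete: "sat (ordered_group_structure :: (_, _, 'c::linordered_ab_group_add) fo_structure) e ?discrete \<longleftrightarrow>
      (\<exists>v::'c. least_positive v)" for e
    by (simp add: least_positive_def linorder_not_less[symmetric])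
  have "formula_in (lang ?G) (Neg ?discrete)" by simp
  from elementarily_equivalent_valid[OF eq this] u obtain v :: 'h where v: "least_positive v"
    by (auto simp only: sat.simps(3) sat_discrete)
  have max_h: "\<exists>s\<in>T. \<forall>t\<in>T. t \<le> s" if "T \<noteq> {}" "\<And>t. t \<in> T \<Longrightarrow> t \<le> d" for T :: "'h set" and d
  proof -
    obtain t where "t \<in> T" using \<open>T \<noteq> {}\<close> by (meson ex_in_conv)
    then have "- t \<in> uminus ` T" by simp
    moreover have "- d \<le> x" if "x \<in> uminus ` T" for x
      using that \<open>\<And>t. t \<in> T \<Longrightarrow> t \<le> d\<close> by auto
    ultimately have "\<exists>s\<in>uminus ` T. \<forall>t\<in>uminus ` T. s \<le> t"
      by (rule archimedean_discrete_min[OF arch v])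
    then show ?thesis by auto
  qed
  obtain \<phi> p where \<phi>: "formula_in (lang ?G) \<phi>" "\<And>e. e 0 \<in> A \<longleftrightarrow> sat ?G (interleave e p) \<phi>"
    using A(1) by (auto simp: dfn_def)
  obtain K where K: "\<forall>i\<in>free_vars \<phi>. i < K"
    using finite_free_vars finite_nat_set_iff_bounded by metis
  \<comment> \<open>Variables \<open>K + 1\<close> and \<open>K + 2\<close> are fresh for \<open>\<phi>\<close>, also when no variable of \<open>\<phi>\<close> is free.\<close>
  have fresh: "sat S (e(Suc K := x)) \<phi> = sat S e \<phi>" "sat S (e(Suc K := x, 0 := y)) \<phi> = sat S (e(0 := y)) \<phi>"
    "sat S (e(Suc (Suc K) := x, 0 := y)) \<phi> = sat S (e(0 := y)) \<phi>"
    for S :: "(group_symbol, order_symbol, 'c::linordered_ab_group_add) fo_structure" and e x y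
    using K by (auto intro!: sat_cong)
  let ?bounded = "Exists (K + 1) (Neg (Exists 0 (And \<phi> (Rel Less [Var (K + 1), Var 0]))))"
  let ?max = "Exists (K + 2) (And (Exists 0 (And \<phi> (Eq (Var 0) (Var (K + 2)))))
    (Neg (Exists 0 (And \<phi> (Rel Less [Var (K + 2), Var 0])))))"
  let ?\<psi> = "Neg (And (And (Exists 0 \<phi>) ?bounded) (Neg ?max))"
  have sat_\<psi>: "sat (ordered_group_structure :: (_, _, 'c::linordered_ab_group_add) fo_structure) e ?\<psi> \<longleftrightarrow>
     (\<forall>D. D = {x. sat ordered_group_structure (e(0 := x)) \<phi>} \<longrightarrow>
       D \<noteq> {} \<and> (\<exists>d. \<forall>x\<in>D. x \<le> d) \<longrightarrow> (\<exists>s\<in>D. \<forall>x\<in>D. x \<le> s))" for e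
    by (simp add: fresh linorder_not_less[symmetric]) blast
  have "sat ?H e ?\<psi>" for e
    unfolding sat_\<psi> using max_h by metis
  moreover have "formula_in (lang ?G) ?\<psi>"
    using \<phi>(1) by simp
  ultimately have "sat ?G (interleave (\<lambda>_. 0) p) ?\<psi>"
    using elementarily_equivalent_valid[OF eq] by blast
  moreover have "A = {x. sat ?G ((interleave (\<lambda>_. 0) p)(0 := x)) \<phi>}"
  proof -
    have "(interleave (\<lambda>_. 0) p)(0 := x) = interleave ((\<lambda>_. 0)(0 := x)) p" for x
      by (auto simp: interleave_def fun_eq_iff elim!: evenE)
    then show ?thesis using \<phi>(2)[of "(\<lambda>_. 0)(0 := _)"] by auto
  qed
  ultimately show ?thesis unfolding sat_\<psi> using A by blast
qed

lemma regular_dense: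
  fixes c d :: "'a::linordered_ab_group_add"
  assumes reg: "regular_group TYPE('a)" and dense: "\<nexists>u :: 'a. least_positive u"
    and m: "1 \<le> m" and "c < d"
  shows "\<exists>t. c < m \<cdot> t \<and> m \<cdot> t < d"
proof (rule ccontr)
  assume "\<not> ?thesis"
  then obtain s where s: "c < m \<cdot> s" "\<And>t. c < m \<cdot> t \<Longrightarrow> s \<le> t"
    using reg m \<open>c < d\<close> unfolding regular_group_def by metis
  obtain \<epsilon> where \<epsilon>: "0 < \<epsilon>" "int (nat m) \<cdot> \<epsilon> < m \<cdot> s - c"
    using dense_small_multiple[OF dense, of "m \<cdot> s - c" "nat m"] s(1) by auto
  then have "c < m \<cdot> (s - \<epsilon>)" using m by (simp add: int_multiple_diff_right algebra_simps)
  from s(2)[OF this] \<epsilon>(1) show False by simp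
qed

section \<open>Definable relations of a regular group\<close>

definition lin :: "nat set \<Rightarrow> (nat \<Rightarrow> int) \<Rightarrow> (nat \<Rightarrow> 'a::ab_group_add) \<Rightarrow> 'a" where
  "lin V z e = (\<Sum>i\<in>V. z i \<cdot> e i)"

lemma lin_cong: "(\<And>i. i \<in> V \<Longrightarrow> e i = e' i) \<Longrightarrow> lin V z e = lin V z e'"
  by (simp add: lin_def cong: sum.cong)

lemma lin_upd:
  assumes "finite V" "i \<in> V"
  shows "lin V z (e(i := t)) = lin V (z(i := 0)) e + z i \<cdot> t"
proof -
  have "(\<Sum>j\<in>V - {i}. z j \<cdot> (e(i := t)) j) = (\<Sum>j\<in>V - {i}. (z(i := 0)) j \<cdot> e j)"
    by (rule sum.cong) auto
  then show ?thesis
    unfolding lin_def sum.remove[OF assms] by (simp add: add.commute)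
qed

lemma lin_shift: "lin V z (\<lambda>i. a i + n \<cdot> w i) = lin V z a + n \<cdot> lin V z w"
  by (simp add: lin_def int_multiple_add_right sum.distrib int_multiple_sum int_multiple_assoc mult.commute)

lemma lin_scale: "lin V (\<lambda>i. k * z i) e = k \<cdot> lin V z e"
  by (simp add: lin_def int_multiple_sum int_multiple_assoc)

lemma lin_diff: "lin V (\<lambda>i. z i - z' i) e = lin V z e - lin V z' e"
  by (simp add: lin_def int_multiple_diff_left sum_subtractf)

lemma lin_add: "lin V (\<lambda>i. z i + z' i) e = lin V z e + lin V z' e"
  by (simp add: lin_def int_multiple_add_left sum.distrib)

text \<open>Equality with \<open>c\<close> is covered by putting both \<open>(z, c)\<close> and \<open>(- z, - c)\<close> into \<open>F\<close>.\<close>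

definition same_sides ::
  "nat set \<Rightarrow> ((nat \<Rightarrow> int) \<times> 'a) set \<Rightarrow> (nat \<Rightarrow> 'a::linordered_ab_group_add) \<Rightarrow> (nat \<Rightarrow> 'a) \<Rightarrow> bool" where
  "same_sides V F e e' \<longleftrightarrow> (\<forall>(z, c)\<in>F. lin V z e < c \<longleftrightarrow> lin V z e' < c)"

text \<open>Being a Boolean combination of finitely many conditions is expressed as being invariant
  under changes of the valuation that respect all these conditions.\<close>

definition polyhedral :: "nat set \<Rightarrow> ((nat \<Rightarrow> 'a::linordered_ab_group_add) \<Rightarrow> bool) \<Rightarrow> bool" where
  "polyhedral V P \<longleftrightarrow> (\<exists>F. finite F \<and> (\<forall>e e'. same_sides V F e e' \<longrightarrow> P e = P e'))"

definition presburger :: "nat set \<Rightarrow> ((nat \<Rightarrow> 'a::linordered_ab_group_add) \<Rightarrow> bool) \<Rightarrow> bool" where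
  "presburger V P \<longleftrightarrow> (\<exists>n\<ge>1. \<exists>F. finite F \<and>
     (\<forall>e e'. same_sides V F e e' \<and> (\<forall>i\<in>V. \<exists>y. e' i = e i + n \<cdot> y) \<longrightarrow> P e = P e'))"

lemma presburgerE:
  assumes "presburger V P"
  obtains n F where "n \<ge> 1" "finite F"
    "\<And>e e'. same_sides V F e e' \<Longrightarrow> (\<And>i. i \<in> V \<Longrightarrow> \<exists>y. e' i = e i + n \<cdot> y) \<Longrightarrow> P e = P e'"
proof -
  obtain n F where "n \<ge> 1" "finite F"
    and *: "\<forall>e e'. same_sides V F e e' \<and> (\<forall>i\<in>V. \<exists>y. e' i = e i + n \<cdot> y) \<longrightarrow> P e = P e'"
    using assms unfolding presburger_def by (elim exE conjE)
  then show thesis by (intro that[of n F]) simp_all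
qed

lemma presburger_polyhedral_cosets:
  assumes "presburger V P"
  obtains n where "n \<ge> 1" "\<And>a. polyhedral V (\<lambda>w. P (\<lambda>i. a i + n \<cdot> w i))"
proof -
  obtain n F where n: "n \<ge> 1" and F: "finite F"
    "\<And>e e'. same_sides V F e e' \<Longrightarrow> (\<And>i. i \<in> V \<Longrightarrow> \<exists>y. e' i = e i + n \<cdot> y) \<Longrightarrow> P e = P e'"
    by (fact presburgerE[OF assms])
  have "polyhedral V (\<lambda>w. P (\<lambda>i. a i + n \<cdot> w i))" for a
    unfolding polyhedral_def
  proof (intro exI conjI allI impI)
    show "finite ((\<lambda>(z, c). (\<lambda>i. n * z i, c - lin V z a)) ` F)" using F(1) by simp
    fix w w' assume w: "same_sides V ((\<lambda>(z, c). (\<lambda>i. n * z i, c - lin V z a)) ` F) w w'"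
    show "P (\<lambda>i. a i + n \<cdot> w i) = P (\<lambda>i. a i + n \<cdot> w' i)"
    proof (rule F(2))
      show "same_sides V F (\<lambda>i. a i + n \<cdot> w i) (\<lambda>i. a i + n \<cdot> w' i)"
        using w by (auto simp: same_sides_def lin_shift lin_scale less_diff_eq add.commute)
      show "\<exists>y. a i + n \<cdot> w' i = a i + n \<cdot> w i + n \<cdot> y" for i
        by (rule exI[of _ "w' i - w i"]) (simp add: int_multiple_diff_right)
    qed
  qed
  with n show ?thesis by (rule that)
qed

text \<open>For a fixed coordinate \<open>i\<close>, all conditions on it can be put into the form of a comparison
  of \<open>m \<cdot> t\<close> with the value of an affine function at the other coordinates, with one \<open>m\<close>.\<close>

lemma fibre_normal_form:
  fixes F :: "((nat \<Rightarrow> int) \<times> 'a::linordered_ab_group_add) set"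
  assumes V: "finite V" "i \<in> V" and F: "finite F"
  obtains m H F0 where "m \<ge> 1" "finite H" "finite F0"
    "\<And>e e' t t'. same_sides V F0 e e' \<Longrightarrow>
      (\<And>z c. (z, c) \<in> H \<Longrightarrow> (m \<cdot> t < lin V z e + c \<longleftrightarrow> m \<cdot> t' < lin V z e' + c) \<and>
         (lin V z e + c < m \<cdot> t \<longleftrightarrow> lin V z e' + c < m \<cdot> t')) \<Longrightarrow>
      same_sides V F (e(i := t)) (e'(i := t'))"
proof -
  define F1 where "F1 = {f \<in> F. fst f i \<noteq> 0}"
  define m where "m = (\<Prod>f\<in>F1. \<bar>fst f i\<bar>)"
  define q where "q z = m div z i" for z :: "nat \<Rightarrow> int"
  define H where "H = (\<lambda>(z, c). (\<lambda>j. - q z * (z(i := 0)) j, q z \<cdot> c)) ` F1"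
  define F0 where "F0 = {f \<in> F. fst f i = 0}"
  have fin: "finite F1" using F by (simp add: F1_def)
  have "0 < m" unfolding m_def by (rule prod_pos) (auto simp: F1_def)
  have q: "q z * z i = m" if "(z, c) \<in> F1" for z c
  proof -
    have "\<bar>fst (z, c) i\<bar> dvd m" unfolding m_def by (rule dvd_prodI[OF fin that])
    then show ?thesis by (simp add: q_def)
  qed
  have "lin V z (e(i := t)) < c \<longleftrightarrow> (if 0 < z i then m \<cdot> t < q z \<cdot> (c - lin V (z(i := 0)) e)
      else q z \<cdot> (c - lin V (z(i := 0)) e) < m \<cdot> t)" if zc: "(z, c) \<in> F1" for z c e t
  proof -
    let ?g = "lin V (z(i := 0)) e"
    have m: "m \<cdot> t = q z \<cdot> z i \<cdot> t" using q[OF zc] by (simp add: int_multiple_assoc)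
    have "lin V z (e(i := t)) < c \<longleftrightarrow> z i \<cdot> t < c - ?g"
      by (simp add: lin_upd[OF V] less_diff_eq add.commute)
    also have "\<dots> \<longleftrightarrow> (if 0 < z i then m \<cdot> t < q z \<cdot> (c - ?g) else q z \<cdot> (c - ?g) < m \<cdot> t)"
    proof (cases "0 < z i")
      case True
      then have "0 < q z" using q[OF zc] \<open>0 < m\<close> by (metis zero_less_mult_pos2)
      then show ?thesis using True by (simp add: m int_multiple_less_iff)
    next
      case False
      then have "z i < 0" using zc by (auto simp: F1_def)
      then have "0 < - q z" using q[OF zc] \<open>0 < m\<close>
        by (metis less_le_not_le linorder_not_less mult_nonneg_nonpos neg_0_less_iff_less)
      then have "z i \<cdot> t < c - ?g \<longleftrightarrow> (- q z) \<cdot> z i \<cdot> t < (- q z) \<cdot> (c - ?g)"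
        by (simp only: int_multiple_less_iff)
      then show ?thesis using False by (simp add: m int_multiple_minus_left)
    qed
    finally show ?thesis .
  qed
  note side = this
  have val: "lin V (\<lambda>j. - q z * (z(i := 0)) j) e + q z \<cdot> c = q z \<cdot> (c - lin V (z(i := 0)) e)" for z c e
    by (simp only: lin_scale int_multiple_minus_left int_multiple_diff_right) simp
  have "same_sides V F (e(i := t)) (e'(i := t'))"
    if F0: "same_sides V F0 e e'" and
      H: "\<And>z c. (z, c) \<in> H \<Longrightarrow> (m \<cdot> t < lin V z e + c \<longleftrightarrow> m \<cdot> t' < lin V z e' + c) \<and>
         (lin V z e + c < m \<cdot> t \<longleftrightarrow> lin V z e' + c < m \<cdot> t')" for e e' t t'
    unfolding same_sides_def
  proof clarify
    fix z c assume zc: "(z, c) \<in> F"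
    show "lin V z (e(i := t)) < c \<longleftrightarrow> lin V z (e'(i := t')) < c"
    proof (cases "z i = 0")
      case True
      then have "(z, c) \<in> F0" "z(i := 0) = z" using zc by (auto simp: F0_def)
      then show ?thesis using F0 True by (auto simp: same_sides_def lin_upd[OF V])
    next
      case False
      then have F1: "(z, c) \<in> F1" using zc by (simp add: F1_def)
      then have "(\<lambda>j. - q z * (z(i := 0)) j, q z \<cdot> c) \<in> H" unfolding H_def by force
      from H[OF this] show ?thesis unfolding side[OF F1] val by auto
    qed
  qed
  moreover have "1 \<le> m" "finite H" "finite F0"
    using \<open>0 < m\<close> fin F by (auto simp: H_def F0_def)
  ultimately show ?thesis using that by blast
qed

text \<open>Whether the open interval \<open>(c, d)\<close> meets \<open>k G\<close> depends only on the length \<open>d - c\<close> and the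
  class of \<open>c\<close> modulo \<open>k\<close>: either there are points of \<open>k G\<close> arbitrarily close above \<open>c\<close>, or there is
  a first one, whose distance from \<open>c\<close> only depends on that class. As there are finitely
  many classes, finitely many thresholds \<open>\<Theta>\<close> for \<open>d - c\<close> decide the question.\<close>

lemma regular_gap:
  fixes k :: int
  assumes reg: "regular_group TYPE('a::linordered_ab_group_add)" and idx: "finite_index TYPE('a)"
    and k: "1 \<le> k"
  obtains \<Theta> :: "'a::linordered_ab_group_add set" where "finite \<Theta>"
    "\<And>c c' d d' y s. c' = c + k \<cdot> y \<Longrightarrow> (\<And>\<theta>. \<theta> \<in> \<Theta> \<Longrightarrow> \<theta> < d - c \<longleftrightarrow> \<theta> < d' - c') \<Longrightarrow>
       c < k \<cdot> s \<Longrightarrow> k \<cdot> s < d \<Longrightarrow> \<exists>s. c' < k \<cdot> s \<and> k \<cdot> s < d'"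
proof -
  obtain R :: "'a set" where R: "finite R" "\<And>x. \<exists>r\<in>R. \<exists>y. x = r + k \<cdot> y"
    using idx k unfolding finite_index_def by blast
  define first where "first r s \<longleftrightarrow> r < k \<cdot> s \<and> (\<forall>t. r < k \<cdot> t \<longrightarrow> s \<le> t)" for r s :: 'a
  define \<Theta> where "\<Theta> = insert 0 ((\<lambda>r. k \<cdot> (SOME s. first r s) - r) ` R)"
  have main: "\<exists>s. c' < k \<cdot> s \<and> k \<cdot> s < d'"
    if c': "c' = c + k \<cdot> y" and \<Theta>: "\<And>\<theta>. \<theta> \<in> \<Theta> \<Longrightarrow> \<theta> < d - c \<longleftrightarrow> \<theta> < d' - c'"
      and s: "c < k \<cdot> s" "k \<cdot> s < d" for c c' d d' y s
  proof -
    obtain r x where r: "r \<in> R" and c: "c = r + k \<cdot> x" using R(2) by blast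
    show ?thesis
    proof (cases "\<exists>s. first r s")
      case True
      define f where "f = (SOME s. first r s)"
      have f: "first r f" unfolding f_def by (rule someI_ex[OF True])
      have \<theta>: "k \<cdot> f - r \<in> \<Theta>" using r by (auto simp: \<Theta>_def f_def)
      have "r < k \<cdot> (s - x)" using s(1) by (simp add: c int_multiple_diff_right less_diff_eq)
      then have "f \<le> s - x" using f by (simp add: first_def)
      then have "k \<cdot> f \<le> k \<cdot> (s - x)" using k by (simp add: int_multiple_le_iff)
      then have "k \<cdot> f + k \<cdot> x \<le> k \<cdot> s" by (simp add: int_multiple_diff_right le_diff_eq)
      then have "k \<cdot> f - r < d - c" using s(2) by (simp add: c algebra_simps)
      then have "k \<cdot> f - r < d' - c'" using \<Theta>[OF \<theta>] by simp
      then have "k \<cdot> (f + x + y) < d'"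
        by (simp add: c' c int_multiple_add_right algebra_simps)
      moreover have "c' < k \<cdot> (f + x + y)"
        using f by (simp add: first_def c' c int_multiple_add_right)
      ultimately show ?thesis by blast
    next
      case False
      have "0 < d - c" using s by simp
      then have "0 < d' - c'" using \<Theta>[of 0] by (simp add: \<Theta>_def)
      then have "r < d' - k \<cdot> (x + y)"
        by (simp add: c' c int_multiple_add_right algebra_simps)
      moreover have "\<forall>d>r. \<exists>t. r < k \<cdot> t \<and> k \<cdot> t < d"
        using reg k False unfolding regular_group_def first_def by blast
      ultimately obtain t where t: "r < k \<cdot> t" "k \<cdot> t < d' - k \<cdot> (x + y)" by blast
      have "c' < k \<cdot> (t + x + y)" using t(1) by (simp add: c' c int_multiple_add_right)
      moreover have "k \<cdot> (t + x + y) < d'"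
        using t(2) by (simp add: int_multiple_add_right less_diff_eq algebra_simps)
      ultimately show ?thesis by blast
    qed
  qed
  have "finite \<Theta>" using R(1) by (simp add: \<Theta>_def)
  then show thesis using main by (rule that)
qed

lemma finite_lower_bound:
  fixes x :: "'b \<Rightarrow> 'a::linordered_ab_group_add"
  assumes "finite H"
  shows "\<exists>s. \<forall>h\<in>H. s \<le> x h"
proof (cases "H = {}")
  case False
  then show ?thesis using assms by (intro exI[of _ "Min (x ` H)"]) auto
qed auto

lemma finite_argmax:
  fixes x :: "'b \<Rightarrow> 'a::linorder"
  assumes "finite H" "H \<noteq> {}"
  obtains h where "h \<in> H" "\<And>h'. h' \<in> H \<Longrightarrow> x h' \<le> x h"
proof -
  have "Max (x ` H) \<in> x ` H" using assms by simp
  then obtain h where "h \<in> H" "x h = Max (x ` H)" by auto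
  then show ?thesis using that[of h] assms by auto
qed

lemma finite_argmin:
  fixes x :: "'b \<Rightarrow> 'a::linorder"
  assumes "finite H" "H \<noteq> {}"
  obtains h where "h \<in> H" "\<And>h'. h' \<in> H \<Longrightarrow> x h \<le> x h'"
proof -
  have "Min (x ` H) \<in> x ` H" using assms by simp
  then obtain h where "h \<in> H" "x h = Min (x ` H)" by auto
  then show ?thesis using that[of h] assms by auto
qed

text \<open>The step of quantifier elimination. Given a witness \<open>t\<close> for \<open>e\<close>, a witness for \<open>e'\<close> is sought
  in the class of \<open>t\<close> modulo \<open>n\<close> and in the same position relative to the bounds \<open>v e'\<close> as \<open>t\<close>
  is to the bounds \<open>v e\<close>. Only the nearest bounds on the two sides matter, and these are
  handled by \<open>regular_gap\<close>.\<close>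

lemma presburger_ex:
  fixes P :: "(nat \<Rightarrow> 'a::linordered_ab_group_add) \<Rightarrow> bool"
  assumes reg: "regular_group TYPE('a)" and idx: "finite_index TYPE('a)"
    and V: "finite V" "i \<in> V" and P: "presburger V P"
  shows "presburger V (\<lambda>e. \<exists>t. P (e(i := t)))"
proof -
  obtain n F where n: "n \<ge> 1" and F: "finite F"
    "\<And>e e'. same_sides V F e e' \<Longrightarrow> (\<And>i. i \<in> V \<Longrightarrow> \<exists>y. e' i = e i + n \<cdot> y) \<Longrightarrow> P e = P e'"
    by (fact presburgerE[OF P])
  obtain m H F0 where m: "m \<ge> 1" and H: "finite H" "finite F0"
    "\<And>e e' t t'. same_sides V F0 e e' \<Longrightarrow>
      (\<And>z c. (z, c) \<in> H \<Longrightarrow> (m \<cdot> t < lin V z e + c \<longleftrightarrow> m \<cdot> t' < lin V z e' + c) \<and>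
         (lin V z e + c < m \<cdot> t \<longleftrightarrow> lin V z e' + c < m \<cdot> t')) \<Longrightarrow>
      same_sides V F (e(i := t)) (e'(i := t'))"
    by (fact fibre_normal_form[OF V F(1)])
  define k where "k = n * m"
  have k: "1 \<le> k" using n m mult_mono[of 1 n 1 m] by (simp add: k_def)
  obtain \<Theta> :: "'a set" where \<Theta>: "finite \<Theta>"
    "\<And>c c' d d' y s. c' = c + k \<cdot> y \<Longrightarrow> (\<And>\<theta>. \<theta> \<in> \<Theta> \<Longrightarrow> \<theta> < d - c \<longleftrightarrow> \<theta> < d' - c') \<Longrightarrow>
       c < k \<cdot> s \<Longrightarrow> k \<cdot> s < d \<Longrightarrow> \<exists>s. c' < k \<cdot> s \<and> k \<cdot> s < d'"
    by (fact regular_gap[OF reg idx k])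
  define v where "v h e = lin V (fst h) e + snd h" for h :: "(nat \<Rightarrow> int) \<times> 'a" and e
  define F' where "F' = F0 \<union> (\<lambda>(h1, h2, \<theta>). (\<lambda>j. fst h1 j - fst h2 j, snd h2 - snd h1 - \<theta>)) `
    (H \<times> H \<times> insert 0 \<Theta>)"
  have transfer: "\<exists>t. P (e'(i := t))"
    if same: "same_sides V F' e e'" and res: "\<forall>i\<in>V. \<exists>y. e' i = e i + k \<cdot> y" and t: "P (e(i := t))"
    for e e' t
  proof -
    have F0: "same_sides V F0 e e'" using same by (auto simp: F'_def same_sides_def)
    have thr: "\<theta> < v h2 e - v h1 e \<longleftrightarrow> \<theta> < v h2 e' - v h1 e'"
      if "h1 \<in> H" "h2 \<in> H" "\<theta> \<in> insert 0 \<Theta>" for h1 h2 \<theta>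
    proof -
      have eq: "\<theta> < v h2 e - v h1 e \<longleftrightarrow> lin V (\<lambda>j. fst h1 j - fst h2 j) e < snd h2 - snd h1 - \<theta>" for e
        unfolding v_def lin_diff by (simp add: less_diff_eq diff_less_eq algebra_simps)
      have "(\<lambda>j. fst h1 j - fst h2 j, snd h2 - snd h1 - \<theta>) \<in> F'"
        unfolding F'_def using that by (intro UnI2 image_eqI[of _ _ "(h1, h2, \<theta>)"]) auto
      then show ?thesis using same unfolding eq same_sides_def by auto
    qed
    obtain y where y: "\<And>j. j \<in> V \<Longrightarrow> e' j = e j + k \<cdot> y j" using res by metis
    define x where "x h = lin V (fst h) y" for h :: "(nat \<Rightarrow> int) \<times> 'a"
    have vx: "v h e' = v h e + k \<cdot> x h" for h
    proof -
      have "lin V (fst h) e' = lin V (fst h) (\<lambda>j. e j + k \<cdot> y j)"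
        by (rule lin_cong) (simp add: y)
      then show ?thesis by (simp add: v_def x_def lin_shift)
    qed
    have "\<exists>s. \<forall>h\<in>H. (m \<cdot> t < v h e \<longleftrightarrow> m \<cdot> t + k \<cdot> s < v h e') \<and> (v h e < m \<cdot> t \<longleftrightarrow> v h e' < m \<cdot> t + k \<cdot> s)"
    proof (cases "\<exists>h\<in>H. v h e = m \<cdot> t")
      case True
      then obtain h0 where h0: "h0 \<in> H" "v h0 e = m \<cdot> t" by blast
      have "v h0 e' = m \<cdot> t + k \<cdot> x h0" using vx h0(2) by simp
      moreover have "v h0 e < v h e \<longleftrightarrow> v h0 e' < v h e'" "v h e < v h0 e \<longleftrightarrow> v h e' < v h0 e'"
        if "h \<in> H" for h
        using thr[OF h0(1) that, of 0] thr[OF that h0(1), of 0] by auto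
      ultimately show ?thesis using h0(2) by (intro exI[of _ "x h0"]) simp
    next
      case False
      define L where "L = {h \<in> H. v h e < m \<cdot> t}"
      define U where "U = {h \<in> H. m \<cdot> t < v h e}"
      have fin: "finite L" "finite U" using H(1) by (auto simp: L_def U_def)
      have "\<exists>s. (\<forall>h\<in>L. v h e' < m \<cdot> t + k \<cdot> s) \<and> (\<forall>h\<in>U. m \<cdot> t + k \<cdot> s < v h e')"
      proof (cases "L = {} \<or> U = {}")
        case True
        then show ?thesis
        proof
          assume L: "L = {}"
          obtain s where s: "\<And>h. h \<in> U \<Longrightarrow> s \<le> x h" using finite_lower_bound[OF fin(2), of x] by blast
          have "m \<cdot> t + k \<cdot> s < v h e'" if "h \<in> U" for h
            unfolding vx using that s[OF that] k
            by (intro add_less_le_mono) (auto simp: U_def int_multiple_le_iff)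
          then show ?thesis using L by blast
        next
          assume U: "U = {}"
          obtain s where s: "\<And>h. h \<in> L \<Longrightarrow> s \<le> - x h"
            using finite_lower_bound[OF fin(1), of "\<lambda>h. - x h"] by blast
          have "v h e' < m \<cdot> t + k \<cdot> (- s)" if "h \<in> L" for h
            unfolding vx using that s[OF that] k
            by (intro add_less_le_mono) (auto simp: L_def int_multiple_le_iff le_minus_iff)
          then show ?thesis using U by blast
        qed
      next
        case False
        then obtain h1 where h1: "h1 \<in> L" "\<And>h. h \<in> L \<Longrightarrow> v h e' \<le> v h1 e'"
          using finite_argmax[OF fin(1), of "\<lambda>h. v h e'"] by blast
        obtain h2 where h2: "h2 \<in> U" "\<And>h. h \<in> U \<Longrightarrow> v h2 e' \<le> v h e'"
          using finite_argmin[OF fin(2), of "\<lambda>h. v h e'"] False by blast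
        have "h1 \<in> H" "h2 \<in> H" using h1(1) h2(1) by (auto simp: L_def U_def)
        then have "\<theta> < (v h2 e - m \<cdot> t) - (v h1 e - m \<cdot> t) \<longleftrightarrow> \<theta> < (v h2 e' - m \<cdot> t) - (v h1 e' - m \<cdot> t)"
          if "\<theta> \<in> \<Theta>" for \<theta> using thr[of h1 h2 \<theta>] that by simp
        moreover have "v h1 e' - m \<cdot> t = v h1 e - m \<cdot> t + k \<cdot> x h1" by (simp add: vx)
        moreover have "v h1 e - m \<cdot> t < k \<cdot> 0" "k \<cdot> 0 < v h2 e - m \<cdot> t"
          using h1(1) h2(1) by (auto simp: L_def U_def)
        ultimately obtain s where s: "v h1 e' - m \<cdot> t < k \<cdot> s" "k \<cdot> s < v h2 e' - m \<cdot> t"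
          using \<Theta>(2)[of "v h1 e' - m \<cdot> t" "v h1 e - m \<cdot> t" "x h1" "v h2 e - m \<cdot> t" "v h2 e' - m \<cdot> t" 0]
          by blast
        have "v h1 e' < m \<cdot> t + k \<cdot> s" "m \<cdot> t + k \<cdot> s < v h2 e'"
          using s by (auto simp: less_diff_eq diff_less_eq add.commute)
        then show ?thesis using h1(2) h2(2) by (meson le_less_trans less_le_trans)
      qed
      then obtain s where s: "\<And>h. h \<in> L \<Longrightarrow> v h e' < m \<cdot> t + k \<cdot> s" "\<And>h. h \<in> U \<Longrightarrow> m \<cdot> t + k \<cdot> s < v h e'"
        by blast
      have "(m \<cdot> t < v h e \<longleftrightarrow> m \<cdot> t + k \<cdot> s < v h e') \<and> (v h e < m \<cdot> t \<longleftrightarrow> v h e' < m \<cdot> t + k \<cdot> s)"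
        if h: "h \<in> H" for h
      proof (cases "v h e < m \<cdot> t")
        case True
        then show ?thesis using s(1)[of h] h by (auto simp: L_def)
      next
        case F: False
        with False h have "m \<cdot> t < v h e" by (meson linorder_neqE)
        then show ?thesis using s(2)[of h] h by (auto simp: U_def)
      qed
      then show ?thesis by blast
    qed
    then obtain s where s: "\<And>h. h \<in> H \<Longrightarrow>
        (m \<cdot> t < v h e \<longleftrightarrow> m \<cdot> t + k \<cdot> s < v h e') \<and> (v h e < m \<cdot> t \<longleftrightarrow> v h e' < m \<cdot> t + k \<cdot> s)" by blast
    define t' where "t' = t + n \<cdot> s"
    have mt': "m \<cdot> t' = m \<cdot> t + k \<cdot> s"
      by (simp add: t'_def int_multiple_add_right int_multiple_assoc k_def mult.commute)
    have "same_sides V F (e(i := t)) (e'(i := t'))"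
    proof (rule H(3)[OF F0])
      fix z c assume "(z, c) \<in> H"
      from s[OF this] show "(m \<cdot> t < lin V z e + c \<longleftrightarrow> m \<cdot> t' < lin V z e' + c) \<and>
         (lin V z e + c < m \<cdot> t \<longleftrightarrow> lin V z e' + c < m \<cdot> t')"
        unfolding v_def mt' by simp
    qed
    moreover have "\<exists>y. (e'(i := t')) j = (e(i := t)) j + n \<cdot> y" if "j \<in> V" for j
    proof (cases "j = i")
      case False
      then show ?thesis using y[OF that] by (auto simp: k_def int_multiple_assoc[symmetric])
    qed (auto simp: t'_def)
    ultimately have "P (e'(i := t'))" using F(2) t by blast
    then show ?thesis by blast
  qed
  have "(\<exists>t. P (e(i := t))) = (\<exists>t. P (e'(i := t)))"
    if same: "same_sides V F' e e'" and res: "\<forall>i\<in>V. \<exists>y. e' i = e i + k \<cdot> y" for e e'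
  proof
    assume "\<exists>t. P (e(i := t))"
    then show "\<exists>t. P (e'(i := t))" using transfer[OF same res] by blast
  next
    have "same_sides V F' e' e" using same by (auto simp: same_sides_def)
    moreover have "\<forall>i\<in>V. \<exists>y. e i = e' i + k \<cdot> y"
    proof
      fix j assume "j \<in> V"
      then obtain y where "e' j = e j + k \<cdot> y" using res by blast
      then show "\<exists>y. e j = e' j + k \<cdot> y"
        by (intro exI[of _ "- y"]) (simp add: int_multiple_minus_right)
    qed
    moreover assume "\<exists>t. P (e'(i := t))"
    ultimately show "\<exists>t. P (e(i := t))" using transfer[of e' e] by blast
  qed
  moreover have "finite F'" using H \<Theta>(1) by (auto simp: F'_def)
  ultimately show ?thesis unfolding presburger_def using k by blast
qed

lemma term_linear:
  assumes "term_in (lang (ordered_group_structure :: (_, _, 'a::linordered_ab_group_add) fo_structure)) t"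
  shows "\<exists>z. \<forall>V e. finite V \<longrightarrow> term_vars t \<subseteq> V \<longrightarrow>
    term_value (ordered_group_structure :: (_, _, 'a) fo_structure) e t = lin V z e"
  using assms
proof (induction t)
  case (Var i)
  show ?case
  proof (intro exI[of _ "\<lambda>j. if j = i then 1 else 0"] allI impI)
    fix V :: "nat set" and e :: "nat \<Rightarrow> 'a" assume V: "finite V" "term_vars (Var i) \<subseteq> V"
    have "lin V (\<lambda>j. if j = i then 1 else 0) e = (\<Sum>j\<in>V. if j = i then e j else 0)"
      unfolding lin_def by (rule sum.cong) auto
    also have "\<dots> = e i" using V by (subst sum.delta) auto
    finally show "term_value ordered_group_structure e (Var i) = lin V (\<lambda>j. if j = i then 1 else 0) e"
      by simp
  qed
next
  case (Fun f ts)
  then have "length ts = Suc (Suc 0)" by simp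
  then obtain t1 t2 where ts: "ts = [t1, t2]" by (auto simp: length_Suc_conv)
  obtain z1 where z1: "\<forall>V e. finite V \<longrightarrow> term_vars t1 \<subseteq> V \<longrightarrow>
      term_value (ordered_group_structure :: (_, _, 'a) fo_structure) e t1 = lin V z1 e"
    using Fun.IH[of t1] Fun.prems by (auto simp: ts)
  obtain z2 where z2: "\<forall>V e. finite V \<longrightarrow> term_vars t2 \<subseteq> V \<longrightarrow>
      term_value (ordered_group_structure :: (_, _, 'a) fo_structure) e t2 = lin V z2 e"
    using Fun.IH[of t2] Fun.prems by (auto simp: ts)
  show ?case
    by (rule exI[of _ "\<lambda>i. z1 i + z2 i"]) (use z1 z2 in \<open>auto simp: ts lin_add\<close>)
qed

lemma presburger_not: "presburger V P \<Longrightarrow> presburger V (\<lambda>e. \<not> P e)"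
  unfolding presburger_def by simp

lemma presburger_conj:
  assumes "presburger V P" "presburger V Q"
  shows "presburger V (\<lambda>e. P e \<and> Q e)"
proof -
  obtain n F where n: "n \<ge> 1" and F: "finite F"
    "\<And>e e'. same_sides V F e e' \<Longrightarrow> (\<And>i. i \<in> V \<Longrightarrow> \<exists>y. e' i = e i + n \<cdot> y) \<Longrightarrow> P e = P e'"
    by (fact presburgerE[OF assms(1)])
  obtain n' F' where n': "n' \<ge> 1" and F': "finite F'"
    "\<And>e e'. same_sides V F' e e' \<Longrightarrow> (\<And>i. i \<in> V \<Longrightarrow> \<exists>y. e' i = e i + n' \<cdot> y) \<Longrightarrow> Q e = Q e'"
    by (fact presburgerE[OF assms(2)])
  have "(P e \<and> Q e) = (P e' \<and> Q e')"
    if "same_sides V (F \<union> F') e e'" and y: "\<And>i. i \<in> V \<Longrightarrow> \<exists>y. e' i = e i + (n * n') \<cdot> y" for e e'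
  proof -
    have "same_sides V F e e'" "same_sides V F' e e'" using that by (auto simp: same_sides_def)
    moreover have "\<exists>y. e' i = e i + n \<cdot> y" "\<exists>y. e' i = e i + n' \<cdot> y" if "i \<in> V" for i
      using y[OF that] by (auto simp: int_multiple_assoc[symmetric]) (metis int_multiple_assoc mult.commute)
    ultimately show ?thesis using F(2)[of e e'] F'(2)[of e e'] by blast
  qed
  moreover have "1 \<le> n * n'" using n n' mult_mono[of 1 n 1 n'] by simp
  ultimately show ?thesis unfolding presburger_def using F(1) F'(1)
    by (intro exI[of _ "n * n'"] conjI exI[of _ "F \<union> F'"]) auto
qed

lemma presburger_less:
  "presburger V (\<lambda>e. lin V z e < (lin V z' e :: 'a::linordered_ab_group_add))"
  unfolding presburger_def
proof (intro exI[of _ 1] conjI exI[of _ "{(\<lambda>i. z i - z' i, 0)}"] allI impI)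
  fix e e' :: "nat \<Rightarrow> 'a"
  assume "same_sides V {(\<lambda>i. z i - z' i, 0)} e e' \<and> (\<forall>i\<in>V. \<exists>y. e' i = e i + 1 \<cdot> y)"
  then show "(lin V z e < lin V z' e) = (lin V z e' < lin V z' e')"
    by (simp add: same_sides_def lin_diff)
qed auto

lemma presburger_term_less:
  fixes s t :: "group_symbol fo_term"
  assumes st: "term_in (lang (ordered_group_structure :: (_, _, 'a::linordered_ab_group_add) fo_structure)) s"
      "term_in (lang (ordered_group_structure :: (_, _, 'a) fo_structure)) t"
    and V: "finite V" "term_vars s \<union> term_vars t \<subseteq> V"
  shows "presburger V (\<lambda>e :: nat \<Rightarrow> 'a.
    term_value ordered_group_structure e s < term_value ordered_group_structure e t)"
proof -
  obtain z1 where z1: "\<forall>V e. finite V \<longrightarrow> term_vars s \<subseteq> V \<longrightarrow>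
      term_value (ordered_group_structure :: (_, _, 'a) fo_structure) e s = lin V z1 e"
    using term_linear[OF st(1)] by (elim exE)
  obtain z2 where z2: "\<forall>V e. finite V \<longrightarrow> term_vars t \<subseteq> V \<longrightarrow>
      term_value (ordered_group_structure :: (_, _, 'a) fo_structure) e t = lin V z2 e"
    using term_linear[OF st(2)] by (elim exE)
  have "term_value ordered_group_structure e s = lin V z1 e"
    "term_value ordered_group_structure e t = lin V z2 e" for e :: "nat \<Rightarrow> 'a"
    using V z1 z2 by simp_all
  then show ?thesis by (simp only: presburger_less)
qed

text \<open>In this lemma \<open>V\<close> has to contain the bound variables of the formula as well.\<close>

lemma presburger_sat:
  assumes reg: "regular_group TYPE('a::linordered_ab_group_add)" and idx: "finite_index TYPE('a)"
    and "formula_in (lang (ordered_group_structure :: (_, _, 'a) fo_structure)) \<phi>"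
  shows "\<exists>V0. finite V0 \<and> (\<forall>V. finite V \<longrightarrow> V0 \<subseteq> V \<longrightarrow>
    presburger V (\<lambda>e :: nat \<Rightarrow> 'a. sat ordered_group_structure e \<phi>))"
  using assms(3)
proof (induction \<phi>)
  case (Eq s t)
  have "presburger V (\<lambda>e :: nat \<Rightarrow> 'a. sat ordered_group_structure e (Eq s t))"
    if "finite V" "term_vars s \<union> term_vars t \<subseteq> V" for V
  proof -
    have "sat ordered_group_structure e (Eq s t) \<longleftrightarrow>
        \<not> term_value ordered_group_structure e s < term_value ordered_group_structure e t \<and>
        \<not> term_value ordered_group_structure e t < term_value ordered_group_structure e s"
      for e :: "nat \<Rightarrow> 'a" by auto
    then show ?thesis
      using Eq that by (simp only:) (intro presburger_conj presburger_not presburger_term_less; simp)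
  qed
  then show ?case using finite_term_vars by (intro exI[of _ "term_vars s \<union> term_vars t"]) auto
next
  case (Rel r ts)
  then have "length ts = Suc (Suc 0)" by simp
  then obtain s t where ts: "ts = [s, t]" by (auto simp: length_Suc_conv)
  have "presburger V (\<lambda>e :: nat \<Rightarrow> 'a. sat ordered_group_structure e (Rel r ts))"
    if "finite V" "term_vars s \<union> term_vars t \<subseteq> V" for V
    using presburger_term_less[where 'a = 'a, of s t V] Rel that by (simp add: ts)
  then show ?case using finite_term_vars by (intro exI[of _ "term_vars s \<union> term_vars t"]) auto
next
  case (Neg \<phi>)
  then obtain V0 where V0: "finite V0" "\<And>V. finite V \<Longrightarrow> V0 \<subseteq> V \<Longrightarrow>
      presburger V (\<lambda>e :: nat \<Rightarrow> 'a. sat ordered_group_structure e \<phi>)" by auto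
  have "presburger V (\<lambda>e :: nat \<Rightarrow> 'a. sat ordered_group_structure e (Neg \<phi>))"
    if "finite V" "V0 \<subseteq> V" for V
    using presburger_not[OF V0(2)[OF that]] by simp
  then show ?case using V0(1) by blast
next
  case (And \<phi> \<psi>)
  then obtain V0 where V0: "finite V0" "\<And>V. finite V \<Longrightarrow> V0 \<subseteq> V \<Longrightarrow>
      presburger V (\<lambda>e :: nat \<Rightarrow> 'a. sat ordered_group_structure e \<phi>)" by auto
  from And obtain V1 where V1: "finite V1" "\<And>V. finite V \<Longrightarrow> V1 \<subseteq> V \<Longrightarrow>
      presburger V (\<lambda>e :: nat \<Rightarrow> 'a. sat ordered_group_structure e \<psi>)" by auto
  have "presburger V (\<lambda>e :: nat \<Rightarrow> 'a. sat ordered_group_structure e (And \<phi> \<psi>))"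
    if "finite V" "V0 \<union> V1 \<subseteq> V" for V
    using presburger_conj[OF V0(2)[of V] V1(2)[of V]] that by simp
  then show ?case using V0(1) V1(1) by (intro exI[of _ "V0 \<union> V1"]) simp
next
  case (Exists i \<phi>)
  then obtain V0 where V0: "finite V0" "\<And>V. finite V \<Longrightarrow> V0 \<subseteq> V \<Longrightarrow>
      presburger V (\<lambda>e :: nat \<Rightarrow> 'a. sat ordered_group_structure e \<phi>)" by auto
  have "presburger V (\<lambda>e :: nat \<Rightarrow> 'a. sat ordered_group_structure e (Exists i \<phi>))"
    if "finite V" "insert i V0 \<subseteq> V" for V
    using presburger_ex[OF reg idx that(1) _ V0(2)[OF that(1)], of i] that by simp
  then show ?case using V0(1) by (intro exI[of _ "insert i V0"]) simp
qed

definition depends_on :: "nat set \<Rightarrow> ((nat \<Rightarrow> 'a) \<Rightarrow> bool) \<Rightarrow> bool" where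
  "depends_on V P \<longleftrightarrow> (\<forall>e e'. (\<forall>i\<in>V. e i = e' i) \<longrightarrow> P e = P e')"

lemma dfn_presburger:
  fixes P :: "(nat \<Rightarrow> 'a::linordered_ab_group_add) \<Rightarrow> bool"
  assumes reg: "regular_group TYPE('a)" and idx: "finite_index TYPE('a)"
    and P: "dfn ordered_group_structure P" and V: "finite V" "depends_on V P"
  shows "presburger V P"
proof -
  let ?G = "ordered_group_structure :: (_, _, 'a) fo_structure"
  obtain \<phi> p where \<phi>: "formula_in (lang ?G) \<phi>" "\<And>e. P e \<longleftrightarrow> sat ?G (interleave e p) \<phi>"
    using P by (auto simp: dfn_def)
  obtain W where W: "finite W" "presburger W (\<lambda>e. sat ?G e \<phi>)"
    using presburger_sat[OF reg idx \<phi>(1)] by blast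
  obtain n F where n: "n \<ge> 1" and F: "finite F"
    "\<And>e e'. same_sides W F e e' \<Longrightarrow> (\<And>i. i \<in> W \<Longrightarrow> \<exists>y. e' i = e i + n \<cdot> y) \<Longrightarrow> sat ?G e \<phi> = sat ?G e' \<phi>"
    by (fact presburgerE[OF W(2)])
  define restr where "restr e = (\<lambda>i. if i \<in> V then e i else 0)" for e :: "nat \<Rightarrow> 'a"
  have P_restr: "P e = sat ?G (interleave (restr e) p) \<phi>" for e
    using V(2) unfolding depends_on_def \<phi>(2)[symmetric] by (simp add: restr_def)
  define zV where "zV z i = (if 2 * i \<in> W then z (2 * i) else 0)" for z :: "nat \<Rightarrow> int" and i
  define cV where "cV z = (\<Sum>j\<in>{j \<in> W. odd j}. z j \<cdot> p (j div 2))" for z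
  have lin: "lin W z (interleave (restr e) p) = lin V (zV z) e + cV z" for z e
  proof -
    let ?f = "\<lambda>j. z j \<cdot> interleave (restr e) p j"
    have "lin W z (interleave (restr e) p) = sum ?f {j \<in> W. even j} + sum ?f {j \<in> W. odd j}"
      unfolding lin_def using W(1) by (subst sum.union_disjoint[symmetric]) (auto intro: sum.cong)
    also have "sum ?f {j \<in> W. odd j} = cV z"
      unfolding cV_def by (rule sum.cong) (auto simp: interleave_def)
    also have "sum ?f {j \<in> W. even j} = sum ?f ((*) 2 ` {i. 2 * i \<in> W})"
      by (rule sum.cong) (auto elim!: evenE)
    also have "\<dots> = (\<Sum>i\<in>{i. 2 * i \<in> W}. z (2 * i) \<cdot> restr e i)"
      by (subst sum.reindex) (auto simp: inj_on_def interleave_def)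
    also have "\<dots> = (\<Sum>i\<in>{i. 2 * i \<in> W} \<inter> V. z (2 * i) \<cdot> e i)"
    proof -
      have "finite {i. 2 * i \<in> W}"
        using finite_vimageI[OF W(1), of "(*) 2"] by (simp add: vimage_def inj_on_def)
      then show ?thesis by (intro sum.mono_neutral_cong_right) (auto simp: restr_def)
    qed
    also have "\<dots> = lin V (zV z) e"
      unfolding lin_def using V(1) by (intro sum.mono_neutral_cong_left) (auto simp: zV_def)
    finally show ?thesis .
  qed
  let ?F = "(\<lambda>(z, c). (zV z, c - cV z)) ` F"
  have "P e = P e'" if same: "same_sides V ?F e e'" and res: "\<forall>i\<in>V. \<exists>y. e' i = e i + n \<cdot> y" for e e'
    unfolding P_restr
  proof (rule F(2))
    show "same_sides W F (interleave (restr e) p) (interleave (restr e') p)"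
      using same by (auto simp: same_sides_def lin less_diff_eq)
    show "\<exists>y. interleave (restr e') p i = interleave (restr e) p i + n \<cdot> y" for i
    proof (cases "even i \<and> i div 2 \<in> V")
      case True
      then show ?thesis using res by (simp add: interleave_def restr_def)
    next
      case False
      then show ?thesis by (intro exI[of _ 0]) (auto simp: interleave_def restr_def)
    qed
  qed
  moreover have "finite ?F" using F(1) by simp
  ultimately show ?thesis unfolding presburger_def using n by blast
qed

text \<open>The analogue of polyhedral sets on a line: finite unions of convex sets with endpoints in the
  divisible hull, namely at the elements \<open>c / m\<close>.\<close>

definition cellular :: "int \<Rightarrow> 'a::linordered_ab_group_add set \<Rightarrow> 'a set \<Rightarrow> bool" where
  "cellular m C A \<longleftrightarrow> (\<forall>t t'. (\<forall>c\<in>C. (m \<cdot> t < c \<longleftrightarrow> m \<cdot> t' < c) \<and> (c < m \<cdot> t \<longleftrightarrow> c < m \<cdot> t')) \<longrightarrow>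
     (t \<in> A \<longleftrightarrow> t' \<in> A))"

lemma polyhedral_fibres_cellular:
  fixes P :: "(nat \<Rightarrow> 'a::linordered_ab_group_add) \<Rightarrow> bool"
  assumes "finite V" "i \<in> V" "polyhedral V P"
  obtains m N where "m \<ge> 1"
    "\<And>e. \<exists>C. finite C \<and> card C \<le> N \<and> cellular m C {t. P (e(i := t))}"
proof -
  obtain F where F: "finite F" "\<And>e e'. same_sides V F e e' \<Longrightarrow> P e = P e'"
    using assms(3) unfolding polyhedral_def by blast
  obtain m H F0 where m: "m \<ge> 1" and H: "finite H" "finite F0"
    "\<And>e e' t t'. same_sides V F0 e e' \<Longrightarrow>
      (\<And>z c. (z, c) \<in> H \<Longrightarrow> (m \<cdot> t < lin V z e + c \<longleftrightarrow> m \<cdot> t' < lin V z e' + c) \<and>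
         (lin V z e + c < m \<cdot> t \<longleftrightarrow> lin V z e' + c < m \<cdot> t')) \<Longrightarrow>
      same_sides V F (e(i := t)) (e'(i := t'))"
    by (fact fibre_normal_form[OF assms(1,2) F(1)])
  have "cellular m ((\<lambda>(z, c). lin V z e + c) ` H) {t. P (e(i := t))}" for e
    unfolding cellular_def mem_Collect_eq
  proof (intro allI impI F(2) H(3))
    show "same_sides V F0 e e" by (simp add: same_sides_def)
  qed force
  then have "\<exists>C. finite C \<and> card C \<le> card H \<and> cellular m C {t. P (e(i := t))}" for e
    using H(1) by (intro exI[of _ "(\<lambda>(z, c). lin V z e + c) ` H"]) (auto intro: card_image_le)
  with m show ?thesis using that by blast
qed

section \<open>Reducts that do not define an infinite interval\<close>

text \<open>The situation in which \<open>M\<close> will turn out to define nothing beyond the group. The interval is only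
  excluded as a set, since the group operation recovers the order on it.\<close>

locale reduct_without_interval =
  fixes M :: "('f, 'r, 'a::linordered_ab_group_add) fo_structure"
  assumes regular: "regular_group TYPE('a)" and index: "finite_index TYPE('a)"
    and nontrivial: "\<exists>x :: 'a. 0 < x"
    and plus: "defines_plus M"
    and reduct: "reduct M (ordered_group_structure :: (_, _, 'a) fo_structure)"
    and no_interval: "\<And>b. infinite (interval_from_zero b) \<Longrightarrow> \<not> dfn M (\<lambda>e. e 0 \<in> interval_from_zero b)"
    and definable_max: "\<And>(u :: 'a) A a (b :: 'a). least_positive u \<Longrightarrow> dfn ordered_group_structure (\<lambda>e. e 0 \<in> A) \<Longrightarrow>
      a \<in> A \<Longrightarrow> (\<And>x. x \<in> A \<Longrightarrow> x \<le> b) \<Longrightarrow> \<exists>s\<in>A. \<forall>t\<in>A. t \<le> s"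
begin

abbreviation order_definable :: "'a set \<Rightarrow> bool" where
  "order_definable A \<equiv> dfn (ordered_group_structure :: (_, _, 'a) fo_structure) (\<lambda>e. e 0 \<in> A)"

lemma dfn_member:
  assumes "dfn1 S R"
  shows "dfn S (\<lambda>e'. e' 0 \<in> {t. R e t})"
  using dfn_subst1[OF assms, of "\<lambda>e'. e' 0" "\<lambda>j e'. e j"] by (simp add: dfnf_var dfnf_const)

lemma order_definable_fibre: "dfn1 M R \<Longrightarrow> order_definable {t. R e t}"
  by (rule dfn_member, rule dfn_reduct[OF reduct])

lemma dfn_unary_subst:
  assumes "dfn S (\<lambda>e. e 0 \<in> A)" "dfnf S f"
  shows "dfn S (\<lambda>e. f e \<in> A)"
  using dfn_subst[OF assms(1), of "\<lambda>j. f"] assms(2) by simp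

lemmas dfnf_M = dfnf_var dfnf_const dfnf_add[OF plus] dfnf_diff[OF plus] dfnf_int_multiple[OF plus]

lemma not_dfn_interval_points:
  assumes "infinite {0<..<b}"
  shows "\<not> dfn M (\<lambda>e. e 0 \<in> {0..b})"
proof
  assume "dfn M (\<lambda>e. e 0 \<in> {0..b})"
  then have "dfn M (\<lambda>e. e 0 \<in> {0..b} \<and> \<not> e 0 = 0 \<and> \<not> e 0 = b)"
    by (intro dfn_conj dfn_not dfn_eq dfnf_M)
  then have "dfn M (\<lambda>e. e 0 \<in> interval_from_zero (Some b))"
    by (rule dfn_cong) auto
  then show False using no_interval[of "Some b"] assms by simp
qed

subsection \<open>Discrete groups: families of bounded sets\<close>

text \<open>For a discrete group with least positive element \<open>u\<close>, the first points of the components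
  of a set are definable from the set without the order.\<close>

definition left_ends :: "'a \<Rightarrow> 'a set \<Rightarrow> 'a set" where
  "left_ends u A = {t \<in> A. t - u \<notin> A}"

lemma definable_min:
  assumes u: "least_positive (u :: 'a)" and A: "order_definable A" "a \<in> A" "\<And>x. x \<in> A \<Longrightarrow> b \<le> x"
  shows "\<exists>s\<in>A. \<forall>t\<in>A. s \<le> t"
proof -
  have "order_definable {x. - x \<in> A}"
    using dfn_unary_subst[OF A(1), of "\<lambda>e. - e 0"] dfnf_uminus[OF defines_plus_ordered_group dfnf_var, of 0]
    by simp
  moreover have "- a \<in> {x. - x \<in> A}" using A(2) by simp
  moreover have "x \<le> - b" if "x \<in> {x. - x \<in> A}" for x
    using A(3)[of "- x"] that by (simp add: le_minus_iff)
  ultimately obtain s where "s \<in> {x. - x \<in> A}" "\<And>t. t \<in> {x. - x \<in> A} \<Longrightarrow> t \<le> s"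
    using definable_max[OF u] by metis
  then show ?thesis
    by (intro bexI[of _ "- s"]) (auto simp: minus_le_iff)
qed

lemma least_positive_less: "least_positive (u :: 'a) \<Longrightarrow> x < y \<Longrightarrow> x + u \<le> y"
  unfolding least_positive_def by (metis add.commute diff_gt_0_iff_gt le_diff_eq)

lemma left_end_after_gap:
  assumes u: "least_positive (u :: 'a)" and A: "order_definable A" and "y \<notin> A" "z \<in> A" "y < z"
  shows "\<exists>l\<in>left_ends u A. y < l \<and> l \<le> z"
proof -
  have "order_definable {x. x \<in> A \<and> y < x}"
    using A by (auto intro!: dfn_conj dfn_less dfnf_var dfnf_const)
  moreover have "z \<in> {x. x \<in> A \<and> y < x}" using assms by simp
  moreover have "y \<le> x" if "x \<in> {x. x \<in> A \<and> y < x}" for x using that by auto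
  ultimately have "\<exists>s\<in>{x. x \<in> A \<and> y < x}. \<forall>t\<in>{x. x \<in> A \<and> y < x}. s \<le> t"
    by (rule definable_min[OF u])
  then obtain l where l0: "l \<in> {x. x \<in> A \<and> y < x}" "\<forall>t\<in>{x. x \<in> A \<and> y < x}. l \<le> t"
    by (rule bexE)
  then have l: "l \<in> A" "y < l" "\<And>x. x \<in> A \<Longrightarrow> y < x \<Longrightarrow> l \<le> x" by simp_all
  have "l - u \<notin> A"
  proof
    assume *: "l - u \<in> A"
    have "0 < u" using u by (simp add: least_positive_def)
    then have "\<not> y < l - u" using l(3)[OF *] by (metis diff_add_cancel less_add_same_cancel1 linorder_not_less)
    moreover have "y \<le> l - u" using least_positive_less[OF u l(2)] by (simp add: le_diff_eq)
    ultimately show False using * \<open>y \<notin> A\<close> by auto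
  qed
  then show ?thesis using l assms by (auto simp: left_ends_def)
qed

lemma left_end_min:
  assumes u: "least_positive (u :: 'a)" and "s \<in> A" "\<And>t. t \<in> A \<Longrightarrow> s \<le> t"
  shows "s \<in> left_ends u A"
proof -
  have "s - u < s" using u by (simp add: least_positive_def)
  then have "s - u \<notin> A" using assms(3) by fastforce
  then show ?thesis using assms(2) by (simp add: left_ends_def)
qed

text \<open>A point missing between the first and the last point of \<open>A\<close> would be followed by a second left
  end.\<close>

lemma single_left_end:
  assumes u: "least_positive (u :: 'a)" and A: "order_definable A" "A \<subseteq> {a..b}" and l: "left_ends u A = {l}"
  shows "\<exists>r. A = {l..r} \<and> l \<le> r"
proof -
  have lA: "l \<in> A" using l by (auto simp: left_ends_def)
  have bounds: "\<And>x. x \<in> A \<Longrightarrow> x \<le> b" "\<And>x. x \<in> A \<Longrightarrow> a \<le> x" using A(2) by auto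
  obtain r where r: "r \<in> A" "\<And>t. t \<in> A \<Longrightarrow> t \<le> r"
    using definable_max[OF u A(1) lA bounds(1)] by blast
  obtain s where s: "s \<in> A" "\<And>t. t \<in> A \<Longrightarrow> s \<le> t"
    using definable_min[OF u A(1) lA bounds(2)] by blast
  have "s = l" using left_end_min[OF u s] l by simp
  have inside: "x \<in> A" if "l \<le> x" "x \<le> r" for x
  proof (rule ccontr)
    assume x: "x \<notin> A"
    then have "x < r" using r(1) that(2) by (auto simp: le_less)
    from left_end_after_gap[OF u A(1) x r(1) this] that(1) l show False by auto
  qed
  have "A = {l..r}"
  proof (intro equalityI subsetI)
    fix x assume "x \<in> A"
    from r(2)[OF this] s(2)[OF this] show "x \<in> {l..r}" using \<open>s = l\<close> by simp
  qed (simp add: inside)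
  then show ?thesis using r(2)[OF lA] by blast
qed

lemma multiples_between:
  assumes u: "least_positive (u :: 'a)"
  shows "0 \<le> x \<Longrightarrow> x \<le> int h \<cdot> u \<Longrightarrow> \<exists>j\<le>h. x = int j \<cdot> u"
proof (induction h arbitrary: x)
  case (Suc h)
  show ?case
  proof (cases "x = 0")
    case False
    then have "0 \<le> x - u" using Suc.prems u by (auto simp: least_positive_def)
    moreover have "x - u \<le> int h \<cdot> u"
      using Suc.prems(2) int_multiple_Suc[of "int h" u] by (simp add: add.commute diff_le_eq)
    ultimately obtain j where j: "j \<le> h" "x - u = int j \<cdot> u" using Suc.IH by blast
    then have "x = int (Suc j) \<cdot> u"
      using int_multiple_Suc[of "int j" u] by (simp add: add.commute diff_eq_eq)
    then show ?thesis using j(1) by blast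
  qed (auto intro: exI[of _ 0])
qed (auto intro: exI[of _ 0])

lemma
  assumes u: "least_positive (u :: 'a)"
  shows finite_multiples: "finite {x..x + int h \<cdot> u}"
    and card_multiples: "card {x..x + int h \<cdot> u} = Suc h"
proof -
  have u0: "0 < u" using u by (simp add: least_positive_def)
  have eq: "{x..x + int h \<cdot> u} = (\<lambda>j. x + int j \<cdot> u) ` {..h}"
  proof (intro equalityI subsetI)
    fix y assume "y \<in> {x..x + int h \<cdot> u}"
    then obtain j where "j \<le> h" "y - x = int j \<cdot> u"
      using multiples_between[OF u, of "y - x" h] by (auto simp: diff_le_eq add.commute)
    then show "y \<in> (\<lambda>j. x + int j \<cdot> u) ` {..h}" by (auto simp: algebra_simps intro!: image_eqI[of _ _ j])
  next
    fix y assume "y \<in> (\<lambda>j. x + int j \<cdot> u) ` {..h}"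
    then show "y \<in> {x..x + int h \<cdot> u}"
      using u0 int_multiple_mono_left[of 0 _ u] int_multiple_mono_left[of _ "int h" u] by auto
  qed
  have "inj_on (\<lambda>j. x + int j \<cdot> u) {..h}"
    using int_multiple_less_left_iff[OF u0] by (auto simp: inj_on_def) (metis less_irrefl linorder_neqE of_nat_eq_iff)
  then show "finite {x..x + int h \<cdot> u}" "card {x..x + int h \<cdot> u} = Suc h"
    unfolding eq by (auto simp: card_image)
qed

text \<open>The differences \<open>r - l\<close> of a definable family of intervals \<open>[l, r]\<close> fill up an initial segment
  of the nonnegative elements, which cannot be infinite.\<close>

lemma interval_family_bounded:
  assumes u: "least_positive (u :: 'a)" and R: "dfn1 M R"
    and intervals: "\<And>e. {t. R e t} = {} \<or> (\<exists>l r. {t. R e t} = {l..r} \<and> l \<le> r)"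
  obtains h where "\<And>e l r. {t. R e t} = {l..r} \<Longrightarrow> l \<le> r \<Longrightarrow> r \<le> l + int h \<cdot> u"
proof -
  have u0: "0 < u" using u by (simp add: least_positive_def)
  define J where "J = {s. \<exists>e l. R e l \<and> \<not> R e (l - u) \<and> R e (l + s)}"
  have "dfn1 M (\<lambda>e s. \<exists>l. R e l \<and> \<not> R e (l - u) \<and> R e (l + s))"
    by (intro dfn_ex dfn_conj dfn_not dfn_subst1[OF R] dfnf_M)
  from dfn_ex_all[OF this] have J: "dfn M (\<lambda>e. e 0 \<in> J)" by (simp add: J_def)
  have J_eq: "s \<in> J \<longleftrightarrow> (\<exists>e l r. {t. R e t} = {l..r} \<and> l \<le> r \<and> 0 \<le> s \<and> s \<le> r - l)" for s
  proof
    assume "s \<in> J"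
    then obtain e l where el: "R e l" "\<not> R e (l - u)" "R e (l + s)" by (auto simp: J_def)
    obtain l' r where A: "{t. R e t} = {l'..r}" "l' \<le> r" using intervals[of e] el(1) by auto
    then have mem: "R e t \<longleftrightarrow> l' \<le> t \<and> t \<le> r" for t by (metis atLeastAtMost_iff mem_Collect_eq)
    have "l - u \<le> r" using el(1) u0 unfolding mem by (metis diff_le_eq le_add_same_cancel1 less_imp_le order_trans)
    then have "l - u < l'" using el(2) unfolding mem by auto
    then have "l \<le> l'" using least_positive_less[OF u] by fastforce
    then have "l = l'" using el(1) mem by auto
    then show "\<exists>e l r. {t. R e t} = {l..r} \<and> l \<le> r \<and> 0 \<le> s \<and> s \<le> r - l"
      using A el(3) mem by (intro exI[of _ e] exI[of _ l] exI[of _ r]) (auto simp: le_diff_eq add.commute)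
  next
    assume "\<exists>e l r. {t. R e t} = {l..r} \<and> l \<le> r \<and> 0 \<le> s \<and> s \<le> r - l"
    then obtain e l r where A: "{t. R e t} = {l..r}" "l \<le> r" "0 \<le> s" "s \<le> r - l" by blast
    then have mem: "R e t \<longleftrightarrow> l \<le> t \<and> t \<le> r" for t by (metis atLeastAtMost_iff mem_Collect_eq)
    have "R e l" "\<not> R e (l - u)" "R e (l + s)"
      using A(2-4) u0 unfolding mem by (auto simp: le_diff_eq add.commute)
    then show "s \<in> J" unfolding J_def by blast
  qed
  have down: "s' \<in> J" if "s \<in> J" "0 \<le> s'" "s' \<le> s" for s s'
    using that unfolding J_eq by (meson order_trans)
  have nonneg: "0 \<le> s" if "s \<in> J" for s using that unfolding J_eq by blast
  have fin: "finite J"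
  proof (rule ccontr)
    assume inf: "infinite J"
    then obtain s0 where s0: "s0 \<in> J" using infinite_imp_nonempty by blast
    show False
    proof (cases "\<exists>b. \<forall>s\<in>J. s \<le> b")
      case True
      then obtain b where b: "b \<in> J" "\<And>s. s \<in> J \<Longrightarrow> s \<le> b"
        using definable_max[OF u dfn_reduct[OF reduct J] s0] by metis
      have eq: "J = {0..b}"
      proof (intro equalityI subsetI)
        fix x assume "x \<in> J"
        from b(2)[OF this] nonneg[OF this] show "x \<in> {0..b}" by simp
      qed (simp add: down[OF b(1)])
      have "{0..b} \<subseteq> insert 0 (insert b {0<..<b})" by auto
      then have "infinite {0<..<b}" using inf unfolding eq by (metis finite_insert finite_subset)
      then show False using not_dfn_interval_points J unfolding eq by blast
    next
      case False
      have up: "x \<in> J" if "0 \<le> x" for x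
      proof -
        obtain s where "s \<in> J" "x < s" using False by (meson not_le)
        then show ?thesis using down that by (meson less_imp_le)
      qed
      have eq: "J = {0..}"
      proof (intro equalityI subsetI)
        fix x assume "x \<in> J"
        from nonneg[OF this] show "x \<in> {0..}" by simp
      qed (simp add: up)
      have "dfn M (\<lambda>e. e 0 \<in> J \<and> \<not> e 0 = 0)"
        by (intro dfn_conj dfn_not dfn_eq dfnf_M J)
      then have "dfn M (\<lambda>e. e 0 \<in> interval_from_zero None)"
        by (rule dfn_cong) (auto simp: eq)
      moreover have "J = insert 0 {0<..}" unfolding eq by auto
      then have "infinite {0 :: 'a<..}" using inf by simp
      ultimately show False using no_interval[of None] by simp
    qed
  qed
  have bound: "s \<le> int (card J) \<cdot> u" if "s \<in> J" for s
  proof (rule ccontr)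
    assume "\<not> s \<le> int (card J) \<cdot> u"
    then have "{0..0 + int (card J) \<cdot> u} \<subseteq> J" using down[OF that] by auto
    then have "card {0..0 + int (card J) \<cdot> u} \<le> card J" by (rule card_mono[OF fin])
    then show False unfolding card_multiples[OF u] by simp
  qed
  have "r \<le> l + int (card J) \<cdot> u" if "{t. R e t} = {l..r}" "l \<le> r" for e l r
  proof -
    have "r - l \<in> J" unfolding J_eq using that by (intro exI[of _ e] exI[of _ l] exI[of _ r]) auto
    from bound[OF this] show ?thesis by (simp add: diff_le_eq add.commute)
  qed
  then show ?thesis by (rule that)
qed

definition erosion :: "'a \<Rightarrow> nat \<Rightarrow> 'a set \<Rightarrow> 'a set" where
  "erosion u h A = {t. \<forall>j\<in>{..h}. t - int j \<cdot> u \<in> A}"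

text \<open>If the first and the last component of \<open>A\<close> both have more than \<open>h + 1\<close> points, then some
  translate of \<open>A\<close> meets \<open>A\<close> in an interval of \<open>h + 2\<close> points: only the bottom of
  the translated first component reaches the top of the last one. If there is no such
  translate, then erosion kills at least one component.\<close>

lemma erosion_left_ends:
  assumes u: "least_positive (u :: 'a)" and A: "order_definable A" "A \<subseteq> {a..b}" "finite (left_ends u A)"
    and short: "\<And>d l r. {t. t \<in> A \<and> t - d \<in> A} = {l..r} \<Longrightarrow> l \<le> r \<Longrightarrow> r \<le> l + int h \<cdot> u"
    and card: "card (left_ends u A) \<le> Suc N"
  shows "finite (left_ends u (erosion u (Suc h) A))" "card (left_ends u (erosion u (Suc h) A)) \<le> N"
proof -
  have u0: "0 < u" using u by (simp add: least_positive_def)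
  define k where "k = int (Suc h) \<cdot> u"
  let ?E = "erosion u (Suc h) A"
  let ?g = "\<lambda>x. x - k"
  have sub: "?g ` left_ends u ?E \<subseteq> left_ends u A"
  proof
    fix y assume "y \<in> ?g ` left_ends u ?E"
    then obtain x where x: "x \<in> ?E" "x - u \<notin> ?E" "y = x - k" by (auto simp: left_ends_def)
    from x(2) obtain j where j: "j \<le> Suc h" "x - u - int j \<cdot> u \<notin> A" by (auto simp: erosion_def)
    have shift: "x - u - int j \<cdot> u = x - int (Suc j) \<cdot> u"
      using int_multiple_Suc[of "int j" u] by (simp add: algebra_simps)
    have "j = Suc h"
    proof (rule ccontr)
      assume "j \<noteq> Suc h"
      then have "x - int (Suc j) \<cdot> u \<in> A" using x(1) j(1) unfolding erosion_def by (auto dest: bspec[of _ _ "Suc j"])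
      then show False using j(2) unfolding shift by simp
    qed
    moreover have "x - k \<in> A" using x(1) unfolding erosion_def k_def by blast
    ultimately show "y \<in> left_ends u A"
      using j(2) by (simp add: left_ends_def x(3) k_def algebra_simps)
  qed
  have inj: "inj_on ?g (left_ends u ?E)" by (simp add: inj_on_def)
  show fin: "finite (left_ends u ?E)"
    using finite_imageD[OF finite_subset[OF sub A(3)] inj] .
  show "card (left_ends u ?E) \<le> N"
  proof (rule ccontr)
    assume "\<not> card (left_ends u ?E) \<le> N"
    then have "card (left_ends u A) \<le> card (?g ` left_ends u ?E)"
      using card by (simp add: card_image[OF inj])
    then have onto: "?g ` left_ends u ?E = left_ends u A" using card_seteq[OF A(3) sub] by blast
    have run: "{l..l + k} \<subseteq> A" if l: "l \<in> left_ends u A" for l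
    proof
      fix y assume y: "y \<in> {l..l + k}"
      obtain x where x: "x \<in> ?E" "l = x - k" using l unfolding onto[symmetric] by (auto simp: left_ends_def)
      have "0 \<le> x - y" "x - y \<le> int (Suc h) \<cdot> u"
        using y x(2) unfolding k_def[symmetric] by (auto simp: diff_le_eq add.commute)
      then obtain j where "j \<le> Suc h" "x - y = int j \<cdot> u" using multiples_between[OF u] by blast
      then have "x - (x - y) \<in> A" using x(1) unfolding erosion_def by auto
      then show "y \<in> A" by simp
    qed
    have "left_ends u A \<noteq> {}"
      using \<open>\<not> card (left_ends u ?E) \<le> N\<close> onto by auto
    define l' where "l' = Max (left_ends u A)"
    have l': "l' \<in> left_ends u A" "\<And>l. l \<in> left_ends u A \<Longrightarrow> l \<le> l'"
      unfolding l'_def using A(3) \<open>left_ends u A \<noteq> {}\<close> by auto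
    have "l' \<in> A" using l'(1) by (simp add: left_ends_def)
    have bounds: "\<And>x. x \<in> A \<Longrightarrow> x \<le> b" "\<And>x. x \<in> A \<Longrightarrow> a \<le> x" using A(2) by auto
    obtain r where r: "r \<in> A" "\<And>t. t \<in> A \<Longrightarrow> t \<le> r"
      using definable_max[OF u A(1) \<open>l' \<in> A\<close> bounds(1)] by blast
    obtain l where l: "l \<in> A" "\<And>t. t \<in> A \<Longrightarrow> l \<le> t"
      using definable_min[OF u A(1) \<open>l' \<in> A\<close> bounds(2)] by blast
    have k0: "0 < k" unfolding k_def using u0 by (intro int_multiple_pos) auto
    have last: "{l'..r} \<subseteq> A"
    proof
      fix y assume y: "y \<in> {l'..r}"
      show "y \<in> A"
      proof (rule ccontr)
        assume "y \<notin> A"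
        moreover from this have "y < r" using y r(1) by (auto simp: le_less)
        ultimately obtain m where "m \<in> left_ends u A" "y < m"
          using left_end_after_gap[OF u A(1) _ r(1)] by blast
        then show False using l'(2)[of m] y by auto
      qed
    qed
    have "l' + k \<in> A" using run[OF l'(1)] k0 by (auto simp: subset_iff)
    then have "l' + k \<le> r" by (rule r(2))
    define d where "d = r - (l + k)"
    have "{t. t \<in> A \<and> t - d \<in> A} = {r - k..r}"
    proof (intro equalityI subsetI)
      fix t assume "t \<in> {t. t \<in> A \<and> t - d \<in> A}"
      then have "t \<le> r" "l \<le> t - d" using r(2) l(2) by auto
      then show "t \<in> {r - k..r}" by (simp add: d_def algebra_simps)
    next
      fix t assume t: "t \<in> {r - k..r}"
      then have "t \<in> {l'..r}" using \<open>l' + k \<le> r\<close> order_trans[of l' "r - k" t] by (simp add: le_diff_eq)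
      moreover have "t - d \<in> {l..l + k}" using t by (auto simp: d_def algebra_simps)
      ultimately show "t \<in> {t. t \<in> A \<and> t - d \<in> A}"
        using last run[OF left_end_min[OF u l]] by blast
    qed
    from short[OF this] have "r \<le> r - k + int h \<cdot> u" using k0 by simp
    moreover have "k = int h \<cdot> u + u" using int_multiple_Suc[of "int h" u] by (simp add: k_def add.commute)
    ultimately show False using u0 by (simp add: algebra_simps)
  qed
qed

text \<open>A point of \<open>A\<close> outside the erosion has fewer than \<open>h\<close> further points of its component below it,
  so it is close to the left end of this component.\<close>

lemma erosion_complement:
  "A \<subseteq> erosion u h A \<union> (\<Union>l\<in>left_ends u A. {l..l + int h \<cdot> u})" if u0: "0 < (u :: 'a)"
proof
  fix x assume x: "x \<in> A"
  show "x \<in> erosion u h A \<union> (\<Union>l\<in>left_ends u A. {l..l + int h \<cdot> u})"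
  proof (cases "x \<in> erosion u h A")
    case False
    then have ex: "\<exists>j. j \<le> h \<and> x - int j \<cdot> u \<notin> A" by (auto simp: erosion_def)
    define j where "j = (LEAST j. j \<le> h \<and> x - int j \<cdot> u \<notin> A)"
    have j: "j \<le> h" "x - int j \<cdot> u \<notin> A" unfolding j_def using LeastI_ex[OF ex] by auto
    have "j \<noteq> 0" using j(2) x by (intro notI) simp
    then have "j - 1 < (LEAST j. j \<le> h \<and> x - int j \<cdot> u \<notin> A)" unfolding j_def[symmetric] by simp
    then have "x - int (j - 1) \<cdot> u \<in> A" using not_less_Least j(1) by force
    moreover have eq: "x - int (j - 1) \<cdot> u - u = x - int j \<cdot> u"
      using int_multiple_Suc[of "int (j - 1)" u] \<open>j \<noteq> 0\<close> by (simp add: algebra_simps)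
    ultimately have "x - int (j - 1) \<cdot> u \<in> left_ends u A"
      using j(2) unfolding left_ends_def mem_Collect_eq eq by blast
    moreover have "int (j - 1) \<cdot> u \<le> int h \<cdot> u" "0 \<cdot> u \<le> int (j - 1) \<cdot> u"
      using j(1) u0 by (auto intro!: int_multiple_mono_left simp del: int_multiple_0)
    then have "x \<in> {x - int (j - 1) \<cdot> u..x - int (j - 1) \<cdot> u + int h \<cdot> u}"
      by (simp add: algebra_simps)
    ultimately show ?thesis by blast
  qed simp
qed

text \<open>By induction on the number of components. The translates of the sets of the family that meet
  them in a single interval give a family of intervals, so these have a common bound \<open>h\<close> on their
  lengths. Eroding by \<open>h + 1\<close> then kills a component of each set, and removes a bounded number of
  points.\<close>

lemma bounded_family:
  assumes u: "least_positive (u :: 'a)" and R: "dfn1 M R"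
    and bounded: "\<And>e. \<exists>a b. {t. R e t} \<subseteq> {a..b}"
    and ends: "\<And>e. finite (left_ends u {t. R e t}) \<and> card (left_ends u {t. R e t}) \<le> N"
  shows "\<exists>B. \<forall>e. finite {t. R e t} \<and> card {t. R e t} \<le> B"
  using R bounded ends
proof (induction N arbitrary: R)
  case 0
  have "{t. R e t} = {}" for e
  proof (rule ccontr)
    assume "{t. R e t} \<noteq> {}"
    then obtain t where t: "t \<in> {t. R e t}" by blast
    obtain a b where "{t. R e t} \<subseteq> {a..b}" using 0(2) by blast
    then obtain s where "s \<in> {t. R e t}" "\<And>t. t \<in> {t. R e t} \<Longrightarrow> s \<le> t"
      using definable_min[OF u order_definable_fibre[OF 0(1)] t, of a] by (metis atLeastAtMost_iff subsetD)
    from left_end_min[OF u this] show False using 0(3)[of e] by auto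
  qed
  then show ?case by (intro exI[of _ 0]) simp
next
  case (Suc N)
  note R = Suc.prems(1)
  let ?A = "\<lambda>e. {t. R e t}"
  define R1 where "R1 e t \<longleftrightarrow> R (\<lambda>i. e (Suc i)) t \<and> R (\<lambda>i. e (Suc i)) (t - e 0)" for e t
  have R1: "dfn1 M R1" unfolding R1_def
    by (intro dfn_conj dfn_subst1[OF R] dfnf_M)
  define R2 where "R2 e t \<longleftrightarrow> R1 e t \<and> (\<exists>l. (R1 e l \<and> \<not> R1 e (l - u)) \<and> (\<forall>l'. R1 e l' \<and> \<not> R1 e (l' - u) \<longrightarrow> l' = l))" for e t
  have R2: "dfn1 M R2" unfolding R2_def
    by (intro dfn_conj dfn_ex dfn_all dfn_imp dfn_not dfn_eq dfn_subst1[OF R1] dfnf_M)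
  have R2_cases: "{t. R2 e t} = {} \<or> (\<exists>l r. {t. R2 e t} = {l..r} \<and> l \<le> r)" for e
  proof (cases "\<exists>l. left_ends u {t. R1 e t} = {l}")
    case True
    then obtain l where l: "left_ends u {t. R1 e t} = {l}" by blast
    obtain a b where "?A (\<lambda>i. e (Suc i)) \<subseteq> {a..b}" using Suc.prems(2) by blast
    then have "{t. R1 e t} \<subseteq> {a..b}" by (auto simp: R1_def)
    from single_left_end[OF u order_definable_fibre[OF R1] this l]
    obtain r where r: "{t. R1 e t} = {l..r}" "l \<le> r" by blast
    have "\<And>l'. R1 e l' \<and> \<not> R1 e (l' - u) \<longleftrightarrow> l' = l" using l by (auto simp: left_ends_def)
    then have "{t. R2 e t} = {t. R1 e t}" unfolding R2_def by auto
    then show ?thesis using r by auto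
  next
    case False
    have "left_ends u {t. R1 e t} = {l}"
      if "R1 e l \<and> \<not> R1 e (l - u)" "\<forall>l'. R1 e l' \<and> \<not> R1 e (l' - u) \<longrightarrow> l' = l" for l
      using that unfolding left_ends_def by blast
    then have "{t. R2 e t} = {}" using False unfolding R2_def by blast
    then show ?thesis by blast
  qed
  obtain h where h: "\<And>e l r. {t. R2 e t} = {l..r} \<Longrightarrow> l \<le> r \<Longrightarrow> r \<le> l + int h \<cdot> u"
    using interval_family_bounded[OF u R2 R2_cases] by blast
  have u0: "0 < u" using u by (simp add: least_positive_def)
  have short: "r \<le> l + int h \<cdot> u" if A: "{t. t \<in> ?A e \<and> t - d \<in> ?A e} = {l..r}" "l \<le> r" for e d l r
  proof -
    define e' where "e' = (\<lambda>i. case i of 0 \<Rightarrow> d | Suc i \<Rightarrow> e i)"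
    have R1_eq: "R1 e' t \<longleftrightarrow> l \<le> t \<and> t \<le> r" for t
    proof -
      have "R1 e' t \<longleftrightarrow> t \<in> {t. t \<in> ?A e \<and> t - d \<in> ?A e}" by (simp add: R1_def e'_def)
      also have "\<dots> \<longleftrightarrow> t \<in> {l..r}" by (simp only: A(1))
      finally show ?thesis by simp
    qed
    have end_l: "R1 e' l' \<and> \<not> R1 e' (l' - u) \<longleftrightarrow> l' = l" for l'
    proof
      assume *: "R1 e' l' \<and> \<not> R1 e' (l' - u)"
      have "l' - u \<le> r" using * u0 unfolding R1_eq by (metis diff_le_eq le_add_same_cancel1 less_imp_le order_trans)
      then have "l' - u < l" using * unfolding R1_eq by auto
      then have "l' \<le> l" using least_positive_less[OF u] by fastforce
      then show "l' = l" using * R1_eq by auto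
    qed (use A(2) u0 in \<open>auto simp: R1_eq\<close>)
    have R2_eq: "R2 e' t \<longleftrightarrow> l \<le> t \<and> t \<le> r" for t
      unfolding R2_def end_l by (simp add: R1_eq)
    have "{t. R2 e' t} = {l..r}" by (intro equalityI subsetI) (simp_all add: R2_eq)
    then show ?thesis using A(2) by (rule h)
  qed
  define R3 where "R3 e t \<longleftrightarrow> (\<forall>j\<in>{..Suc h}. R e (t - int j \<cdot> u))" for e t
  have "dfn1 M R3" unfolding R3_def
    by (intro dfn_ball dfn_subst1[OF R] dfnf_M) simp
  moreover have R3_eq: "{t. R3 e t} = erosion u (Suc h) (?A e)" for e
    by (simp add: R3_def erosion_def)
  moreover have "\<exists>a b. {t. R3 e t} \<subseteq> {a..b}" for e
  proof -
    have "{t. R3 e t} \<subseteq> ?A e" unfolding R3_def by (auto dest: bspec[of _ _ 0])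
    then show ?thesis using Suc.prems(2) by (meson subset_trans)
  qed
  moreover have "finite (left_ends u {t. R3 e t}) \<and> card (left_ends u {t. R3 e t}) \<le> N" for e
  proof -
    obtain a b where "?A e \<subseteq> {a..b}" using Suc.prems(2) by blast
    note erosion_left_ends[OF u order_definable_fibre[OF R] this
        conjunct1[OF Suc.prems(3)] short conjunct2[OF Suc.prems(3)]]
    then show ?thesis unfolding R3_eq by (rule conjI)
  qed
  ultimately obtain B where B: "\<And>e. finite {t. R3 e t} \<and> card {t. R3 e t} \<le> B"
    using Suc.IH[of R3] by blast
  have "finite (?A e) \<and> card (?A e) \<le> B + Suc N * (h + 2)" for e
  proof -
    let ?C = "\<Union>l\<in>left_ends u (?A e). {l..l + int (Suc h) \<cdot> u}"
    have sub: "?A e \<subseteq> {t. R3 e t} \<union> ?C" unfolding R3_eq by (rule erosion_complement[OF u0])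
    have fin: "finite (left_ends u (?A e))" using Suc.prems(3) by blast
    then have finC: "finite ?C" by (intro finite_UN_I finite_multiples[OF u])
    have "card ?C \<le> (\<Sum>l\<in>left_ends u (?A e). card {l..l + int (Suc h) \<cdot> u})"
      by (rule card_UN_le[OF fin])
    also have "\<dots> = card (left_ends u (?A e)) * (h + 2)" by (subst card_multiples[OF u]) simp
    also have "\<dots> \<le> Suc N * (h + 2)" using Suc.prems(3)[of e] by (intro mult_le_mono1) blast
    finally have "card ?C \<le> Suc N * (h + 2)" .
    moreover have "card (?A e) \<le> card ({t. R3 e t} \<union> ?C)"
      using B[of e] finC sub by (intro card_mono) auto
    moreover have "card ({t. R3 e t} \<union> ?C) \<le> card {t. R3 e t} + card ?C" by (rule card_Un_le)
    moreover have "card {t. R3 e t} \<le> B" using B by blast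
    moreover have "finite (?A e)" using finite_subset[OF sub] B[of e] finC by blast
    ultimately show ?thesis by linarith
  qed
  then show ?case by blast
qed

subsection \<open>Dense groups: bounded sets\<close>

lemma dense_infinite_interval:
  assumes dense: "\<nexists>u :: 'a. least_positive u" and "a < (b :: 'a)"
  shows "infinite {a<..<b}"
proof
  assume fin: "finite {a<..<b}"
  have between: "\<exists>x. a < x \<and> x < c" if "a < c" for c :: 'a
  proof -
    obtain \<epsilon> where "0 < \<epsilon>" "int 1 \<cdot> \<epsilon> < c - a"
      using dense_small_multiple[OF dense, of "c - a" 1] \<open>a < c\<close> by auto
    then show ?thesis by (intro exI[of _ "a + \<epsilon>"]) (simp add: less_diff_eq add.commute)
  qed
  obtain x where "a < x" "x < b" using between[OF \<open>a < b\<close>] by blast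
  then have x: "x \<in> {a<..<b}" by simp
  then have "{a<..<b} \<noteq> {}" by blast
  then have m: "Min {a<..<b} \<in> {a<..<b}" by (rule Min_in[OF fin])
  then have "a < Min {a<..<b}" by auto
  from between[OF this] obtain y where y: "a < y" "y < Min {a<..<b}" by blast
  then have "y \<in> {a<..<b}" using m by auto
  from Min_le[OF fin this] y show False by auto
qed

lemma finite_multiple_preimage:
  assumes "1 \<le> m" "finite C"
  shows "finite {t :: 'a. m \<cdot> t \<in> C}"
proof -
  have "inj ((\<cdot>) m :: 'a \<Rightarrow> 'a)" using assms(1) by (auto simp: inj_def int_multiple_eq_iff)
  from finite_vimageI[OF assms(2) this] show ?thesis by (simp add: vimage_def)
qed

lemma cellular_right_nbhd:
  assumes dense: "\<nexists>u :: 'a. least_positive u" and m: "1 \<le> m" and C: "finite C" "cellular m C A" "m \<cdot> t \<notin> C"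
  obtains \<delta> :: 'a where "0 < \<delta>" "\<And>s. t \<le> s \<Longrightarrow> s < t + \<delta> \<Longrightarrow> s \<in> A \<longleftrightarrow> t \<in> A"
proof -
  obtain p :: 'a where p: "0 < p" using nontrivial by blast
  define D where "D = insert p ((\<lambda>c. c - m \<cdot> t) ` {c \<in> C. m \<cdot> t < c})"
  have D: "finite D" "D \<noteq> {}" using C(1) by (auto simp: D_def)
  have "0 < Min D" using p by (subst Min_gr_iff[OF D]) (auto simp: D_def)
  then obtain \<delta> where \<delta>: "0 < \<delta>" "int (nat m) \<cdot> \<delta> < Min D"
    using dense_small_multiple[OF dense] by blast
  have "s \<in> A \<longleftrightarrow> t \<in> A" if s: "t \<le> s" "s < t + \<delta>" for s
  proof -
    have "(m \<cdot> s < c \<longleftrightarrow> m \<cdot> t < c) \<and> (c < m \<cdot> s \<longleftrightarrow> c < m \<cdot> t)" if c: "c \<in> C" for c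
    proof (cases "m \<cdot> t < c")
      case True
      have "m \<cdot> s < m \<cdot> (t + \<delta>)" using s(2) m by (simp add: int_multiple_less_iff)
      also have "m \<cdot> (t + \<delta>) = m \<cdot> t + m \<cdot> \<delta>" by (rule int_multiple_add_right)
      also have "m \<cdot> \<delta> < c - m \<cdot> t"
      proof -
        have "Min D \<le> c - m \<cdot> t" using True c by (intro Min_le D) (auto simp: D_def)
        moreover have "m \<cdot> \<delta> < Min D" using \<delta>(2) m by simp
        ultimately show ?thesis by (rule less_le_trans[rotated])
      qed
      then have "m \<cdot> t + m \<cdot> \<delta> < c" by (simp add: less_diff_eq add.commute)
      finally show ?thesis using True by auto
    next
      case False
      then have "c < m \<cdot> t" using C(3) c by (metis linorder_neqE)
      moreover have "m \<cdot> t \<le> m \<cdot> s" using s(1) m by (simp add: int_multiple_le_iff)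
      ultimately show ?thesis by auto
    qed
    then show ?thesis using C(2) unfolding cellular_def by blast
  qed
  with \<delta>(1) show thesis by (rule that)
qed

text \<open>A point of the set outside \<open>C / m\<close> has a whole neighbourhood on its right in the set,
  so a finite set of this kind is contained in \<open>C / m\<close>.\<close>

lemma dense_finite_cellular:
  assumes dense: "\<nexists>u :: 'a. least_positive u" and m: "1 \<le> m" and C: "finite C" "cellular m C A"
    and fin: "finite (A :: 'a set)"
  shows "card A \<le> card C"
proof -
  have "m \<cdot> t \<in> C" if t: "t \<in> A" for t
  proof (rule ccontr)
    assume "m \<cdot> t \<notin> C"
    then obtain \<delta> where \<delta>: "0 < \<delta>" "\<And>s. t \<le> s \<Longrightarrow> s < t + \<delta> \<Longrightarrow> s \<in> A \<longleftrightarrow> t \<in> A"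
      using cellular_right_nbhd[OF dense m C] by blast
    then have "{t<..<t + \<delta>} \<subseteq> A" using t by (auto simp: less_imp_le)
    moreover have "infinite {t<..<t + \<delta>}" using \<delta>(1) by (intro dense_infinite_interval[OF dense]) simp
    ultimately show False using fin finite_subset by blast
  qed
  moreover have "inj_on ((\<cdot>) m) A" using m by (auto simp: inj_on_def int_multiple_eq_iff)
  ultimately show ?thesis using C(1) by (metis card_inj_on_le image_subsetI)
qed

text \<open>A bounded infinite definable set \<open>A\<close> of a dense group can be modified at finitely many points
  so that its components are all of the form \<open>[c / m, c' / m)\<close>. Let \<open>w > 0\<close> be small compared
  to all components and gaps. If \<open>x\<close> and \<open>x + w\<close> are in the set, then so is all of
  \<open>[x, x + w]\<close>; and since such \<open>x\<close> and \<open>x + w\<close> come arbitrarily close to the lower and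
  to the upper end of the set, the elements \<open>s\<close> that move all such \<open>x\<close> into the
  set are those with \<open>0 \<le> s \<le> w\<close>. This defines the interval \<open>[0, w]\<close>.\<close>

lemma dense_bounded_finite:
  assumes dense: "\<nexists>u :: 'a. least_positive u" and m: "1 \<le> m" and C: "finite C" "cellular m C A"
    and A: "dfn M (\<lambda>e. e 0 \<in> A)" "A \<subseteq> {a..b}"
  shows "finite A"
proof -
  obtain p :: 'a where p: "0 < p" using nontrivial by blast
  define D where "D = insert p ((\<lambda>(c, c'). c' - c) ` {(c, c') \<in> C \<times> C. c < c'})"
  have "finite {(c, c') \<in> C \<times> C. c < c'}"
    by (rule finite_subset[of _ "C \<times> C"]) (use C(1) in auto)
  then have D: "finite D" "D \<noteq> {}" by (auto simp: D_def)
  have "0 < Min D" using p by (subst Min_gr_iff[OF D]) (auto simp: D_def)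
  then obtain w where w: "0 < w" "int (nat (2 * m)) \<cdot> w < Min D"
    using dense_small_multiple[OF dense] by blast
  have gap: "c + m \<cdot> w + m \<cdot> w < c'" if "c \<in> C" "c' \<in> C" "c < c'" for c c'
  proof -
    have "Min D \<le> c' - c" using that by (intro Min_le D) (auto simp: D_def)
    moreover have "int (nat (2 * m)) \<cdot> w = m \<cdot> w + m \<cdot> w" using m by (simp add: int_multiple_add_left[symmetric])
    ultimately have "m \<cdot> w + m \<cdot> w < c' - c" using w(2) by simp
    then show ?thesis by (simp add: less_diff_eq add_ac)
  qed
  have mw: "0 < m \<cdot> w" using w(1) m by (intro int_multiple_pos) auto
  define A' where "A' = {t. if m \<cdot> t \<in> C then t + w \<in> A else t \<in> A}"
  have cell: "t \<in> A' \<longleftrightarrow> t' \<in> A'" if tt': "\<And>c. c \<in> C \<Longrightarrow> c \<le> m \<cdot> t \<longleftrightarrow> c \<le> m \<cdot> t'" for t t'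
  proof -
    define \<rho> where "\<rho> t = (if m \<cdot> t \<in> C then t + w else t)" for t
    have \<rho>: "(c < m \<cdot> \<rho> t \<longleftrightarrow> c \<le> m \<cdot> t) \<and> (m \<cdot> \<rho> t < c \<longleftrightarrow> \<not> c \<le> m \<cdot> t)" if c: "c \<in> C" for c t
    proof (cases "m \<cdot> t \<in> C")
      case True
      have r: "m \<cdot> \<rho> t = m \<cdot> t + m \<cdot> w" using True by (simp add: \<rho>_def int_multiple_add_right)
      show ?thesis
      proof (cases "c \<le> m \<cdot> t")
        case True
        then have "c < m \<cdot> t + m \<cdot> w" using add_le_less_mono[OF True mw] by simp
        then show ?thesis using True r by auto
      next
        case False
        then have "m \<cdot> t + m \<cdot> w + m \<cdot> w < c" using gap[OF True c] by simp
        moreover have "m \<cdot> t + m \<cdot> w < m \<cdot> t + m \<cdot> w + m \<cdot> w" using mw by simp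
        ultimately have "m \<cdot> t + m \<cdot> w < c" by (rule less_trans[rotated])
        then show ?thesis using False r by auto
      qed
    next
      case False
      then have "c \<noteq> m \<cdot> t" using c by auto
      then show ?thesis using False by (auto simp: \<rho>_def)
    qed
    have mem: "t \<in> A' \<longleftrightarrow> \<rho> t \<in> A" for t by (simp add: A'_def \<rho>_def)
    have "\<forall>c\<in>C. (m \<cdot> \<rho> t < c \<longleftrightarrow> m \<cdot> \<rho> t' < c) \<and> (c < m \<cdot> \<rho> t \<longleftrightarrow> c < m \<cdot> \<rho> t')"
    proof
      fix c assume c: "c \<in> C"
      show "(m \<cdot> \<rho> t < c \<longleftrightarrow> m \<cdot> \<rho> t' < c) \<and> (c < m \<cdot> \<rho> t \<longleftrightarrow> c < m \<cdot> \<rho> t')"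
        using \<rho>[OF c, of t] \<rho>[OF c, of t'] tt'[OF c] by simp
    qed
    then have "\<rho> t \<in> A \<longleftrightarrow> \<rho> t' \<in> A" using C(2) unfolding cellular_def by simp
    then show ?thesis unfolding mem .
  qed
  have A'_def': "t \<in> A' \<longleftrightarrow> (m \<cdot> t \<in> C \<and> t + w \<in> A) \<or> (\<not> m \<cdot> t \<in> C \<and> t \<in> A)" for t
    by (auto simp: A'_def)
  have "dfn M (\<lambda>e. \<exists>c\<in>C. m \<cdot> e 0 = c)" by (intro dfn_bex C(1) dfn_eq dfnf_M)
  then have inC: "dfn M (\<lambda>e. m \<cdot> e 0 \<in> C)" by (rule dfn_cong) auto
  have dfnA': "dfn M (\<lambda>e. e 0 \<in> A')"
    unfolding A'_def' by (intro dfn_disj dfn_conj dfn_not inC A(1) dfn_unary_subst[OF A(1)] dfnf_M)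
  have bounds: "a - w \<le> t" "t \<le> b" if "t \<in> A'" for t
  proof -
    from that have "t \<in> A \<or> t + w \<in> A" by (auto simp: A'_def split: if_splits)
    then have "a \<le> t + w \<and> t \<le> b"
    proof
      assume "t \<in> A"
      then have "a \<le> t" "t \<le> b" using A(2) by auto
      then show ?thesis using w(1) by (simp add: add_increasing2)
    next
      assume "t + w \<in> A"
      then have "a \<le> t + w" "t + w \<le> b" using A(2) by auto
      moreover have "t \<le> t + w" using w(1) by simp
      ultimately show ?thesis by (meson order_trans)
    qed
    then show "a - w \<le> t" "t \<le> b" by (auto simp: diff_le_eq)
  qed
  have empty: "A' = {}"
  proof (rule ccontr)
    assume "A' \<noteq> {}"
    then obtain t0 where t0: "t0 \<in> A'" by blast
    define T where "T = {s. \<forall>x. x \<in> A' \<and> x + w \<in> A' \<longrightarrow> x + s \<in> A'}"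
    \<comment> \<open>The lower end \<open>c1 / m\<close> and the upper end \<open>c2 / m\<close> of the modified set.\<close>
    define L where "L = {c \<in> C. \<exists>t\<in>A'. c \<le> m \<cdot> t \<and> (\<forall>c'\<in>C. c' \<le> m \<cdot> t \<longrightarrow> c' \<le> c)}"
    define U where "U = {c \<in> C. \<exists>t\<in>A'. m \<cdot> t < c \<and> (\<forall>c'\<in>C. m \<cdot> t < c' \<longrightarrow> c \<le> c')}"
    have L_ex: "\<exists>c\<in>L. c \<le> m \<cdot> t" if t: "t \<in> A'" for t
    proof -
      have ne: "{c \<in> C. c \<le> m \<cdot> t} \<noteq> {}"
      proof
        assume none: "{c \<in> C. c \<le> m \<cdot> t} = {}"
        define t' where "t' = min t (a - w - p)"
        have "m \<cdot> t' \<le> m \<cdot> t" using m by (simp add: t'_def int_multiple_le_iff)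
        then have "c \<le> m \<cdot> t \<longleftrightarrow> c \<le> m \<cdot> t'" if "c \<in> C" for c
          using none that by (auto dest: order_trans)
        then have "t' \<in> A'" using cell t by blast
        then have "a - w \<le> t'" by (rule bounds)
        moreover have "t' \<le> a - w - p" by (simp add: t'_def)
        ultimately have "a - w \<le> a - w - p" by (rule order_trans)
        then show False using p by simp
      qed
      have fin: "finite {c \<in> C. c \<le> m \<cdot> t}" using C(1) by simp
      have "Max {c \<in> C. c \<le> m \<cdot> t} \<in> {c \<in> C. c \<le> m \<cdot> t}" by (rule Max_in[OF fin ne])
      moreover have "\<forall>c'\<in>C. c' \<le> m \<cdot> t \<longrightarrow> c' \<le> Max {c \<in> C. c \<le> m \<cdot> t}" using fin by auto
      ultimately show ?thesis using t by (intro bexI[of _ "Max {c \<in> C. c \<le> m \<cdot> t}"]) (auto simp: L_def)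
    qed
    have U_ex: "\<exists>c\<in>U. m \<cdot> t < c" if t: "t \<in> A'" for t
    proof -
      have ne: "{c \<in> C. m \<cdot> t < c} \<noteq> {}"
      proof
        assume none: "{c \<in> C. m \<cdot> t < c} = {}"
        define t' where "t' = max t (b + p)"
        have "m \<cdot> t \<le> m \<cdot> t'" using m by (simp add: t'_def int_multiple_le_iff)
        then have "c \<le> m \<cdot> t \<longleftrightarrow> c \<le> m \<cdot> t'" if "c \<in> C" for c
          using none that by (auto simp: not_less dest: order_trans)
        then have "t' \<in> A'" using cell t by blast
        then have "t' \<le> b" by (rule bounds)
        moreover have "b + p \<le> t'" by (simp add: t'_def)
        ultimately have "b + p \<le> b" by (rule order_trans[rotated])
        then show False using p by simp
      qed
      have fin: "finite {c \<in> C. m \<cdot> t < c}" using C(1) by simp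
      have "Min {c \<in> C. m \<cdot> t < c} \<in> {c \<in> C. m \<cdot> t < c}" by (rule Min_in[OF fin ne])
      moreover have "\<forall>c'\<in>C. m \<cdot> t < c' \<longrightarrow> Min {c \<in> C. m \<cdot> t < c} \<le> c'" using fin by auto
      ultimately show ?thesis using t by (intro bexI[of _ "Min {c \<in> C. m \<cdot> t < c}"]) (auto simp: U_def)
    qed
    have fin: "finite L" "finite U" using C(1) by (auto simp: L_def U_def)
    have ne: "L \<noteq> {}" "U \<noteq> {}" using L_ex[OF t0] U_ex[OF t0] by auto
    define c1 where "c1 = Min L"
    define c2 where "c2 = Max U"
    have "c1 \<in> L" "c2 \<in> U" using fin ne by (auto simp: c1_def c2_def)
    then obtain t1 t2 where c1: "c1 \<in> C" "t1 \<in> A'" "c1 \<le> m \<cdot> t1" "\<And>c. c \<in> C \<Longrightarrow> c \<le> m \<cdot> t1 \<Longrightarrow> c \<le> c1"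
      and c2: "c2 \<in> C" "t2 \<in> A'" "m \<cdot> t2 < c2" "\<And>c. c \<in> C \<Longrightarrow> m \<cdot> t2 < c \<Longrightarrow> c2 \<le> c"
      by (auto simp: L_def U_def)
    have lower: "c1 \<le> m \<cdot> t" if t: "t \<in> A'" for t
    proof -
      obtain c where "c \<in> L" "c \<le> m \<cdot> t" using L_ex[OF t] by blast
      then show ?thesis using fin(1) unfolding c1_def by (meson Min_le order_trans)
    qed
    have upper: "m \<cdot> t < c2" if t: "t \<in> A'" for t
    proof -
      obtain c where "c \<in> U" "m \<cdot> t < c" using U_ex[OF t] by blast
      then show ?thesis using fin(2) unfolding c2_def by (meson Max_ge less_le_trans)
    qed
    have at_lower: "x \<in> A'" if x: "c1 \<le> m \<cdot> x" "m \<cdot> x < c1 + m \<cdot> w + m \<cdot> w" for x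
    proof -
      have "c \<le> m \<cdot> t1 \<longleftrightarrow> c \<le> m \<cdot> x" if c: "c \<in> C" for c
      proof (cases "c \<le> c1")
        case True
        then show ?thesis using x(1) c1(3) by (meson order_trans)
      next
        case False
        then have "c1 + m \<cdot> w + m \<cdot> w < c" using gap[OF c1(1) c] by simp
        then have "\<not> c \<le> m \<cdot> x" using x(2) by auto
        then show ?thesis using c1(4)[OF c] False by blast
      qed
      then show ?thesis using cell[of t1 x] c1(2) by blast
    qed
    have at_upper: "x \<in> A'" if x: "m \<cdot> x < c2" "c2 < m \<cdot> x + m \<cdot> w + m \<cdot> w" for x
    proof -
      have "c \<le> m \<cdot> t2 \<longleftrightarrow> c \<le> m \<cdot> x" if c: "c \<in> C" for c
      proof (cases "c2 \<le> c")
        case True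
        then have "m \<cdot> t2 < c" "m \<cdot> x < c" using x(1) c2(3) by (auto intro: less_le_trans)
        then show ?thesis by (simp add: linorder_not_less[symmetric])
      next
        case False
        then have "c + m \<cdot> w + m \<cdot> w < m \<cdot> x + m \<cdot> w + m \<cdot> w"
          using gap[OF c c2(1)] x(2) by (meson less_trans not_le)
        then have "c < m \<cdot> x" by simp
        then show ?thesis using c2(4)[OF c] False by (metis less_imp_le not_le)
      qed
      then show ?thesis using cell[of t2 x] c2(2) by blast
    qed
    have T_eq: "T = {0..w}"
    proof (intro equalityI subsetI)
      fix s assume s: "s \<in> {0..w}"
      have "x + s \<in> A'" if x: "x \<in> A'" "x + w \<in> A'" for x
      proof (cases "\<exists>c0\<in>C. m \<cdot> x < c0 \<and> c0 \<le> m \<cdot> (x + s)")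
        case False
        have "m \<cdot> x \<le> m \<cdot> (x + s)" using s m by (simp add: int_multiple_le_iff)
        then have "c \<le> m \<cdot> x \<longleftrightarrow> c \<le> m \<cdot> (x + s)" if "c \<in> C" for c
          using False that by (meson not_le order_trans)
        then show ?thesis using cell[of x "x + s"] x(1) by blast
      next
        case True
        then obtain c0 where c0: "c0 \<in> C" "m \<cdot> x < c0" "c0 \<le> m \<cdot> (x + s)" by blast
        have le: "m \<cdot> (x + s) \<le> m \<cdot> (x + w)" using s m by (simp add: int_multiple_le_iff)
        have "c \<le> m \<cdot> (x + s)" if c: "c \<in> C" "c \<le> m \<cdot> (x + w)" for c
        proof (rule ccontr)
          assume "\<not> c \<le> m \<cdot> (x + s)"
          then have "c0 < c" using c0(3) by auto
          then have "c0 + m \<cdot> w + m \<cdot> w < c" by (rule gap[OF c0(1) c(1)])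
          also have "c \<le> m \<cdot> x + m \<cdot> w" using c(2) by (simp add: int_multiple_add_right)
          also have "\<dots> < c0 + m \<cdot> w" using c0(2) by simp
          finally show False using mw by simp
        qed
        then have "c \<le> m \<cdot> (x + w) \<longleftrightarrow> c \<le> m \<cdot> (x + s)" if "c \<in> C" for c
          using le that by (meson order_trans)
        then show ?thesis using cell[of "x + w" "x + s"] x(2) by blast
      qed
      then show "s \<in> T" by (simp add: T_def)
    next
      fix s assume s: "s \<in> T"
      show "s \<in> {0..w}"
      proof (rule ccontr)
        assume "s \<notin> {0..w}"
        then consider "s < 0" | "w < s" by fastforce
        then show False
        proof cases
          case 1
          define \<mu> where "\<mu> = min w (- s)"
          have \<mu>: "0 < \<mu>" "\<mu> \<le> w" "\<mu> \<le> - s" using w(1) 1 by (auto simp: \<mu>_def)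
          have m\<mu>: "0 < m \<cdot> \<mu>" "m \<cdot> \<mu> \<le> m \<cdot> w" "m \<cdot> \<mu> \<le> m \<cdot> (- s)"
            using \<mu> m by (auto simp: int_multiple_le_iff int_multiple_pos)
          obtain x where x: "c1 < m \<cdot> x" "m \<cdot> x < c1 + m \<cdot> \<mu>"
            using regular_dense[OF regular dense m, of c1 "c1 + m \<cdot> \<mu>"] m\<mu>(1) by auto
          have x1: "m \<cdot> x < c1 + m \<cdot> w" using x(2) m\<mu>(2) by (meson add_left_mono less_le_trans)
          then have "m \<cdot> x < c1 + m \<cdot> w + m \<cdot> w" using mw by (meson less_add_same_cancel1 less_trans)
          then have "x \<in> A'" using at_lower x(1) by simp
          moreover have "x + w \<in> A'"
          proof (rule at_lower)
            show "m \<cdot> (x + w) < c1 + m \<cdot> w + m \<cdot> w" using x1 by (simp add: int_multiple_add_right)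
            show "c1 \<le> m \<cdot> (x + w)"
              using x(1) mw by (simp add: int_multiple_add_right add_increasing2)
          qed
          ultimately have "x + s \<in> A'" using s by (simp add: T_def)
          then have "c1 \<le> m \<cdot> (x + s)" by (rule lower)
          then have "c1 + m \<cdot> (- s) \<le> m \<cdot> x"
            by (simp add: int_multiple_add_right int_multiple_minus_right diff_le_eq)
          moreover have "c1 + m \<cdot> \<mu> \<le> c1 + m \<cdot> (- s)" using m\<mu>(3) by simp
          ultimately show False using x(2) by (meson leD order_trans)
        next
          case 2
          define \<mu> where "\<mu> = min w (s - w)"
          have \<mu>: "0 < \<mu>" "\<mu> \<le> w" "\<mu> \<le> s - w" using w(1) 2 by (auto simp: \<mu>_def)
          have m\<mu>: "0 < m \<cdot> \<mu>" "m \<cdot> \<mu> \<le> m \<cdot> w" "m \<cdot> \<mu> \<le> m \<cdot> (s - w)"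
            using \<mu> m by (auto simp: int_multiple_le_iff int_multiple_pos)
          obtain z where z: "c2 - m \<cdot> \<mu> < m \<cdot> z" "m \<cdot> z < c2"
            using regular_dense[OF regular dense m, of "c2 - m \<cdot> \<mu>" c2] m\<mu>(1) by auto
          have z1: "c2 < m \<cdot> z + m \<cdot> \<mu>" using z(1) by (simp add: diff_less_eq)
          then have z2: "c2 < m \<cdot> z + m \<cdot> w" using m\<mu>(2) by (meson add_left_mono less_le_trans)
          define x where "x = z - w"
          have zx: "z = x + w" by (simp add: x_def)
          have "c2 < m \<cdot> z + m \<cdot> w + m \<cdot> w" using z2 mw by (meson less_add_same_cancel1 less_trans)
          then have "x + w \<in> A'" using at_upper[OF z(2)] zx by simp
          moreover have "x \<in> A'"
          proof (rule at_upper)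
            show "c2 < m \<cdot> x + m \<cdot> w + m \<cdot> w" using z2 by (simp add: zx int_multiple_add_right)
            have "m \<cdot> x < m \<cdot> z" using mw by (simp add: zx int_multiple_add_right)
            then show "m \<cdot> x < c2" using z(2) by (rule less_trans)
          qed
          ultimately have "x + s \<in> A'" using s by (simp add: T_def)
          then have "m \<cdot> (x + s) < c2" by (rule upper)
          moreover have "x + s = z + (s - w)" by (simp add: zx)
          ultimately have "m \<cdot> z + m \<cdot> (s - w) < c2" by (simp only: int_multiple_add_right)
          moreover have "m \<cdot> z + m \<cdot> \<mu> \<le> m \<cdot> z + m \<cdot> (s - w)" using m\<mu>(3) by simp
          ultimately show False using z1 by (meson leD less_imp_le less_trans le_less_trans)
        qed
      qed
    qed
    have "dfn M (\<lambda>e. e 0 \<in> T)"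
      unfolding T_def mem_Collect_eq
      by (intro dfn_all dfn_imp dfn_conj dfn_unary_subst[OF dfnA'] dfnf_M)
    then show False
      using not_dfn_interval_points[OF dense_infinite_interval[OF dense w(1)]] T_eq by simp
  qed
  have "A \<subseteq> A' \<union> {t. m \<cdot> t \<in> C}" by (auto simp: A'_def)
  then show ?thesis using finite_multiple_preimage[OF m C(1)] empty finite_subset by auto
qed

subsection \<open>Fibres are uniformly finite or cofinite\<close>

lemma cellular_Compl: "cellular m C A \<Longrightarrow> cellular m C (- A)"
  unfolding cellular_def by (metis ComplD ComplI)

lemma multiple_ge: "1 \<le> m \<Longrightarrow> 0 \<le> t \<Longrightarrow> t \<le> m \<cdot> (t :: 'a)"
  using int_multiple_mono_left[of 1 m t] by simp

lemma cellular_ends: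
  fixes A :: "'a set"
  assumes m: "1 \<le> m" and C: "finite C" "cellular m C A"
  obtains b where "0 \<le> b" "(\<forall>t>b. t \<in> A) \<or> (\<forall>t>b. t \<notin> A)" "(\<forall>t < - b. t \<in> A) \<or> (\<forall>t < - b. t \<notin> A)"
proof -
  define b where "b = Max (insert 0 (C \<union> uminus ` C))"
  have fin: "finite (insert 0 (C \<union> uminus ` C))" using C(1) by simp
  have b: "0 \<le> b" "\<And>c. c \<in> C \<Longrightarrow> c \<le> b" "\<And>c. c \<in> C \<Longrightarrow> - b \<le> c"
  proof -
    show "0 \<le> b" unfolding b_def using fin by (intro Max_ge) auto
    show "c \<le> b" if "c \<in> C" for c unfolding b_def using fin that by (intro Max_ge) auto
    have "- c \<le> b" if "c \<in> C" for c unfolding b_def using fin that by (intro Max_ge) auto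
    then show "- b \<le> c" if "c \<in> C" for c using that by (metis minus_le_iff)
  qed
  have above: "c < m \<cdot> t" if "b < t" "c \<in> C" for c t
  proof -
    have "c < t" using b(2)[OF that(2)] that(1) by (rule le_less_trans)
    also have "t \<le> m \<cdot> t" using b(1) that(1) by (intro multiple_ge[OF m]) auto
    finally show ?thesis .
  qed
  have below: "m \<cdot> t < c" if "t < - b" "c \<in> C" for c t
  proof -
    have "b < - t" using that(1) by (metis less_minus_iff)
    then have "- t \<le> m \<cdot> (- t)" using b(1) by (intro multiple_ge[OF m]) (meson le_less_trans less_imp_le)
    then have "m \<cdot> t \<le> t" by (simp add: int_multiple_minus_right)
    also have "t < c" using that(1) b(3)[OF that(2)] by (rule less_le_trans)
    finally show ?thesis .
  qed
  have "t \<in> A \<longleftrightarrow> t' \<in> A" if "b < t" "b < t'" for t t'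
  proof -
    have "\<forall>c\<in>C. (m \<cdot> t < c \<longleftrightarrow> m \<cdot> t' < c) \<and> (c < m \<cdot> t \<longleftrightarrow> c < m \<cdot> t')"
      using above[OF that(1)] above[OF that(2)] by (meson less_asym)
    then show ?thesis using C(2) by (simp add: cellular_def)
  qed
  then have "(\<forall>t>b. t \<in> A) \<or> (\<forall>t>b. t \<notin> A)" by blast
  moreover have "t \<in> A \<longleftrightarrow> t' \<in> A" if "t < - b" "t' < - b" for t t'
  proof -
    have "\<forall>c\<in>C. (m \<cdot> t < c \<longleftrightarrow> m \<cdot> t' < c) \<and> (c < m \<cdot> t \<longleftrightarrow> c < m \<cdot> t')"
      using below[OF that(1)] below[OF that(2)] by (meson less_asym)
    then show ?thesis using C(2) by (simp add: cellular_def)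
  qed
  then have "(\<forall>t < - b. t \<in> A) \<or> (\<forall>t < - b. t \<notin> A)" by blast
  ultimately show thesis using b(1) that by blast
qed

text \<open>Boundedness of such sets can be expressed without the order.\<close>

lemma cellular_bounded_iff:
  fixes D :: "'a set"
  assumes "1 \<le> m" "finite C" "cellular m C D"
  shows "(\<exists>a b. D \<subseteq> {a..b}) \<longleftrightarrow> (\<exists>d. \<forall>t. \<not> (t \<in> D \<and> t - d \<in> D))"
proof
  assume "\<exists>a b. D \<subseteq> {a..b}"
  then obtain a b where ab: "\<And>t. t \<in> D \<Longrightarrow> a \<le> t \<and> t \<le> b" by (meson atLeastAtMost_iff subsetD)
  obtain p :: 'a where p: "0 < p" using nontrivial by blast
  have "\<not> (t \<in> D \<and> t - (b - a + p) \<in> D)" for t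
  proof
    assume "t \<in> D \<and> t - (b - a + p) \<in> D"
    then have "t \<le> b" "a \<le> t - (b - a + p)" using ab by auto
    then have "t \<le> b" "b + p \<le> t" by (simp_all add: algebra_simps)
    then have "b + p \<le> b" by (rule order_trans[rotated])
    then show False using p by simp
  qed
  then show "\<exists>d. \<forall>t. \<not> (t \<in> D \<and> t - d \<in> D)" by blast
next
  assume "\<exists>d. \<forall>t. \<not> (t \<in> D \<and> t - d \<in> D)"
  then obtain d where d: "\<And>t. \<not> (t \<in> D \<and> t - d \<in> D)" by blast
  obtain b where b: "(\<forall>t>b. t \<in> D) \<or> (\<forall>t>b. t \<notin> D)" "(\<forall>t < - b. t \<in> D) \<or> (\<forall>t < - b. t \<notin> D)"
    using cellular_ends[OF assms] by metis
  obtain p :: 'a where p: "0 < p" using nontrivial by blast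
  have "\<not> (\<forall>t>b. t \<in> D)"
  proof
    assume *: "\<forall>t>b. t \<in> D"
    let ?t = "max b (b + d) + p"
    have "b < ?t" "b + d < ?t" using p by (auto simp: add.commute add_strict_increasing max_def)
    then have "b < ?t" "b < ?t - d" by (auto simp: less_diff_eq)
    then show False using * d by blast
  qed
  moreover have "\<not> (\<forall>t < - b. t \<in> D)"
  proof
    assume *: "\<forall>t < - b. t \<in> D"
    let ?t = "min (- b) (- b + d) - p"
    have "?t < - b" "?t < - b + d" using p by (auto simp: min_def diff_less_eq add_strict_increasing2 add.commute not_le)
    then have "?t < - b" "?t - d < - b" by (auto simp: diff_less_eq)
    then show False using * d by blast
  qed
  ultimately have "D \<subseteq> {- b..b}" using b by (auto simp: not_less[symmetric])
  then show "\<exists>a b. D \<subseteq> {a..b}" by blast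
qed

lemma cellular_difference:
  fixes A :: "'a set"
  assumes "cellular m C A"
  shows "cellular m (C \<union> (\<lambda>c. c + m \<cdot> d) ` C) {t. t \<in> A \<and> t - d \<notin> A}"
  unfolding cellular_def
proof (intro allI impI)
  fix t t' :: 'a
  assume *: "\<forall>c\<in>C \<union> (\<lambda>c. c + m \<cdot> d) ` C. (m \<cdot> t < c \<longleftrightarrow> m \<cdot> t' < c) \<and> (c < m \<cdot> t \<longleftrightarrow> c < m \<cdot> t')"
  then have "t \<in> A \<longleftrightarrow> t' \<in> A" using assms unfolding cellular_def by blast
  moreover have "\<forall>c\<in>C. (m \<cdot> (t - d) < c \<longleftrightarrow> m \<cdot> (t' - d) < c) \<and> (c < m \<cdot> (t - d) \<longleftrightarrow> c < m \<cdot> (t' - d))"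
    using * by (auto simp: int_multiple_diff_right diff_less_eq less_diff_eq)
  then have "t - d \<in> A \<longleftrightarrow> t' - d \<in> A" using assms unfolding cellular_def by blast
  ultimately show "t \<in> {t. t \<in> A \<and> t - d \<notin> A} \<longleftrightarrow> t' \<in> {t. t \<in> A \<and> t - d \<notin> A}" by simp
qed

text \<open>Between \<open>t - u\<close> and a left end \<open>t\<close>, the multiple by \<open>m\<close> reaches or passes some element of
  \<open>C\<close>, and each element accounts for at most two left ends.\<close>

lemma cellular_left_ends:
  fixes A :: "'a set"
  assumes u: "least_positive (u :: 'a)" and m: "1 \<le> m" and C: "finite C" "cellular m C A"
  shows "finite (left_ends u A)" "card (left_ends u A) \<le> 2 * card C"
proof -
  let ?P = "\<lambda>c. {t. m \<cdot> (t - u) < c \<and> c \<le> m \<cdot> t}"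
  let ?Q = "\<lambda>c. {t. m \<cdot> (t - u) \<le> c \<and> c < m \<cdot> t}"
  have u0: "0 < u" using u by (simp add: least_positive_def)
  have mono: "m \<cdot> t \<le> m \<cdot> (t' - u)" if "t < t'" for t t'
    using least_positive_less[OF u that] m by (simp add: int_multiple_le_iff le_diff_eq)
  have sub: "left_ends u A \<subseteq> (\<Union>c\<in>C. ?P c \<union> ?Q c)"
  proof
    fix t assume "t \<in> left_ends u A"
    then have "\<not> (t - u \<in> A \<longleftrightarrow> t \<in> A)" by (auto simp: left_ends_def)
    then have "\<not> (\<forall>c\<in>C. (m \<cdot> (t - u) < c \<longleftrightarrow> m \<cdot> t < c) \<and> (c < m \<cdot> (t - u) \<longleftrightarrow> c < m \<cdot> t))"
      using C(2) unfolding cellular_def by blast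
    then obtain c where c: "c \<in> C"
      "\<not> ((m \<cdot> (t - u) < c \<longleftrightarrow> m \<cdot> t < c) \<and> (c < m \<cdot> (t - u) \<longleftrightarrow> c < m \<cdot> t))" by blast
    have le: "m \<cdot> (t - u) \<le> m \<cdot> t" using u0 m by (simp add: int_multiple_le_iff)
    have "(m \<cdot> (t - u) < c \<and> c \<le> m \<cdot> t) \<or> (m \<cdot> (t - u) \<le> c \<and> c < m \<cdot> t)"
    proof (rule ccontr)
      assume n: "\<not> ?thesis"
      consider "c < m \<cdot> (t - u)" | "m \<cdot> t < c" | "m \<cdot> (t - u) \<le> c" "c \<le> m \<cdot> t" by fastforce
      then show False
      proof cases
        case 1
        then show ?thesis using c(2) le by (meson less_asym less_le_trans)
      next
        case 2
        then show ?thesis using c(2) le by (meson less_asym le_less_trans)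
      next
        case 3
        then have "c = m \<cdot> (t - u)" "c = m \<cdot> t" using n by (auto simp: le_less)
        then show ?thesis using c(2) by simp
      qed
    qed
    then show "t \<in> (\<Union>c\<in>C. ?P c \<union> ?Q c)" using c(1) by blast
  qed
  have single: "finite S \<and> card S \<le> 1" if "\<And>t t'. t \<in> S \<Longrightarrow> t' \<in> S \<Longrightarrow> \<not> t < t'" for S :: "'a set"
  proof (cases "S = {}")
    case False
    then obtain s where "s \<in> S" by blast
    have "x = s" if "x \<in> S" for x
      using \<open>\<And>t t'. t \<in> S \<Longrightarrow> t' \<in> S \<Longrightarrow> \<not> t < t'\<close>[OF that \<open>s \<in> S\<close>]
        \<open>\<And>t t'. t \<in> S \<Longrightarrow> t' \<in> S \<Longrightarrow> \<not> t < t'\<close>[OF \<open>s \<in> S\<close> that] by simp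
    then have "S \<subseteq> {s}" by blast
    then have "finite S" "card S \<le> card {s}" using finite_subset card_mono by blast+
    then show ?thesis by simp
  qed simp
  have P: "finite (?P c) \<and> card (?P c) \<le> 1" for c
  proof (rule single)
    fix t t' assume t: "t \<in> ?P c" "t' \<in> ?P c"
    show "\<not> t < t'"
    proof
      assume "t < t'"
      from mono[OF this] t show False by auto
    qed
  qed
  have Q: "finite (?Q c) \<and> card (?Q c) \<le> 1" for c
  proof (rule single)
    fix t t' assume t: "t \<in> ?Q c" "t' \<in> ?Q c"
    show "\<not> t < t'"
    proof
      assume "t < t'"
      from mono[OF this] t show False by auto
    qed
  qed
  have "finite (\<Union>c\<in>C. ?P c \<union> ?Q c)" using C(1) P Q by (intro finite_UN_I) auto
  moreover have "card (\<Union>c\<in>C. ?P c \<union> ?Q c) \<le> 2 * card C"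
  proof -
    have "card (\<Union>c\<in>C. ?P c \<union> ?Q c) \<le> (\<Sum>c\<in>C. card (?P c \<union> ?Q c))" by (rule card_UN_le[OF C(1)])
    also have "\<dots> \<le> (\<Sum>c\<in>C. 2)"
    proof (rule sum_mono)
      fix c
      have "card (?P c \<union> ?Q c) \<le> card (?P c) + card (?Q c)" by (rule card_Un_le)
      then show "card (?P c \<union> ?Q c) \<le> 2" using P[of c] Q[of c] by linarith
    qed
    finally show ?thesis by simp
  qed
  ultimately show "finite (left_ends u A)" "card (left_ends u A) \<le> 2 * card C"
    using finite_subset[OF sub] card_mono[OF _ sub] by auto
qed

text \<open>In a dense group, the bounded differences are finite one by one, and then few because they are
  cellular. In a discrete group, the bounded members of the family of all differences are singled
  out by a condition that is definable in \<open>M\<close>, and form a family of bounded sets with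
  few components.\<close>

lemma bounded_differences:
  assumes R: "dfn1 M R" and m: "1 \<le> m"
    and cell: "\<And>e. \<exists>C. finite C \<and> card C \<le> N \<and> cellular m C {t. R e t}"
  obtains B where "\<And>e d. \<exists>a b. {t. R e t \<and> \<not> R e (t - d)} \<subseteq> {a..b} \<Longrightarrow>
    finite {t. R e t \<and> \<not> R e (t - d)} \<and> card {t. R e t \<and> \<not> R e (t - d)} \<le> B"
proof -
  define D where "D e t \<longleftrightarrow> R (\<lambda>i. e (Suc i)) t \<and> \<not> R (\<lambda>i. e (Suc i)) (t - e 0)" for e t
  have D: "dfn1 M D" unfolding D_def by (intro dfn_conj dfn_not dfn_subst1[OF R] dfnf_M)
  have cellD: "\<exists>C. finite C \<and> card C \<le> 2 * N \<and> cellular m C {t. D e t}" for e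
  proof -
    obtain C where C: "finite C" "card C \<le> N" "cellular m C {t. R (\<lambda>i. e (Suc i)) t}" using cell by blast
    let ?C = "C \<union> (\<lambda>c. c + m \<cdot> e 0) ` C"
    have "cellular m ?C {t. D e t}" using cellular_difference[OF C(3), of "e 0"] by (simp add: D_def)
    moreover have "card ?C \<le> card C + card C"
      using card_Un_le[of C "(\<lambda>c. c + m \<cdot> e 0) ` C"] card_image_le[OF C(1), of "\<lambda>c. c + m \<cdot> e 0"] by linarith
    ultimately show ?thesis using C(1,2) by (intro exI[of _ ?C]) auto
  qed
  have "\<exists>B. \<forall>e. (\<exists>a b. {t. D e t} \<subseteq> {a..b}) \<longrightarrow> finite {t. D e t} \<and> card {t. D e t} \<le> B"
  proof (cases "\<exists>u :: 'a. least_positive u")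
    case False
    have "finite {t. D e t} \<and> card {t. D e t} \<le> 2 * N" if "\<exists>a b. {t. D e t} \<subseteq> {a..b}" for e
    proof -
      obtain C where C: "finite C" "card C \<le> 2 * N" "cellular m C {t. D e t}" using cellD by blast
      obtain a b where "{t. D e t} \<subseteq> {a..b}" using \<open>\<exists>a b. {t. D e t} \<subseteq> {a..b}\<close> by blast
      from dense_bounded_finite[OF False m C(1,3) dfn_member[OF D] this]
      have "finite {t. D e t}" .
      with dense_finite_cellular[OF False m C(1,3)] C(2) show ?thesis by simp
    qed
    then show ?thesis by blast
  next
    case True
    then obtain u :: 'a where u: "least_positive u" by blast
    define D' where "D' e t \<longleftrightarrow> D e t \<and> (\<exists>d. \<forall>s. \<not> (D e s \<and> D e (s - d)))" for e t
    have D': "dfn1 M D'" unfolding D'_def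
      by (intro dfn_conj dfn_ex dfn_all dfn_not dfn_subst1[OF D] dfnf_M)
    have bounded_iff: "(\<exists>d. \<forall>s. \<not> (D e s \<and> D e (s - d))) \<longleftrightarrow> (\<exists>a b. {t. D e t} \<subseteq> {a..b})" for e
    proof -
      obtain C where C: "finite C" "cellular m C {t. D e t}" using cellD by blast
      from cellular_bounded_iff[OF m this] show ?thesis by simp
    qed
    have cases: "{t. D' e t} = (if \<exists>a b. {t. D e t} \<subseteq> {a..b} then {t. D e t} else {})" for e
      unfolding D'_def bounded_iff by simp
    have "\<exists>a b. {t. D' e t} \<subseteq> {a..b}" for e unfolding cases by simp
    moreover have "finite (left_ends u {t. D' e t}) \<and> card (left_ends u {t. D' e t}) \<le> 4 * N" for e
    proof (cases "\<exists>a b. {t. D e t} \<subseteq> {a..b}")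
      case True
      obtain C where C: "finite C" "card C \<le> 2 * N" "cellular m C {t. D e t}" using cellD by blast
      from cellular_left_ends[OF u m C(1,3)] C(2) True show ?thesis unfolding cases by simp
    next
      case False
      then show ?thesis unfolding cases by (simp add: left_ends_def)
    qed
    ultimately obtain B where B: "\<And>e. finite {t. D' e t} \<and> card {t. D' e t} \<le> B"
      using bounded_family[OF u D', of "4 * N"] by blast
    have "finite {t. D e t} \<and> card {t. D e t} \<le> B" if "\<exists>a b. {t. D e t} \<subseteq> {a..b}" for e
      using B[of e] that unfolding cases by simp
    then show ?thesis by blast
  qed
  then obtain B where B: "\<And>e. \<exists>a b. {t. D e t} \<subseteq> {a..b} \<Longrightarrow> finite {t. D e t} \<and> card {t. D e t} \<le> B"
    by blast
  have "finite {t. R e t \<and> \<not> R e (t - d)} \<and> card {t. R e t \<and> \<not> R e (t - d)} \<le> B"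
    if "\<exists>a b. {t. R e t \<and> \<not> R e (t - d)} \<subseteq> {a..b}" for e d
    using B[of "\<lambda>i. case i of 0 \<Rightarrow> d | Suc i \<Rightarrow> e i"] that by (simp add: D_def)
  then show thesis by (rule that)
qed

text \<open>If a set contains a ray in one direction and misses a ray in the other, then its differences
  with its translates contain arbitrarily many points and are bounded.\<close>

lemma one_ray_large_difference:
  fixes A :: "'a set"
  assumes b: "\<And>t. b < t \<Longrightarrow> t \<in> A" "\<And>t. t < - b \<Longrightarrow> t \<notin> A" "0 \<le> b"
  obtains d where "{t. t \<in> A \<and> t - d \<notin> A} \<subseteq> {- b..b + d}"
    "finite {t. t \<in> A \<and> t - d \<notin> A} \<Longrightarrow> B < card {t. t \<in> A \<and> t - d \<notin> A}"
proof -
  obtain p :: 'a where p: "0 < p" using nontrivial by blast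
  define d where "d = b + b + int (B + 2) \<cdot> p"
  let ?D = "{t. t \<in> A \<and> t - d \<notin> A}"
  define S where "S = (\<lambda>j. b + int (Suc j) \<cdot> p) ` {..B}"
  have "t \<in> {- b..b + d}" if "t \<in> ?D" for t
  proof -
    have "\<not> t < - b" "\<not> b < t - d" using that b by auto
    then show ?thesis by (simp add: less_diff_eq not_less diff_le_eq)
  qed
  then have bd: "?D \<subseteq> {- b..b + d}" by blast
  have "S \<subseteq> ?D"
  proof
    fix t assume "t \<in> S"
    then obtain j where j: "j \<le> B" "t = b + int (Suc j) \<cdot> p" by (auto simp: S_def)
    have "0 < int (Suc j) \<cdot> p" by (rule int_multiple_pos[OF _ p]) simp
    then have "t \<in> A" using j(2) by (intro b(1)) simp
    moreover have "int (Suc j) \<cdot> p < int (B + 2) \<cdot> p"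
      using j(1) by (subst int_multiple_less_left_iff[OF p]) simp
    then have "t - d < - b" unfolding j(2) d_def by (simp only: diff_less_eq) (simp add: add_ac)
    then have "t - d \<notin> A" by (rule b(2))
    ultimately show "t \<in> ?D" by simp
  qed
  moreover have "card S = Suc B"
  proof -
    have "i = j" if "int (Suc i) \<cdot> p = int (Suc j) \<cdot> p" for i j
      using that int_multiple_less_left_iff[OF p, of "int (Suc i)" "int (Suc j)"]
        int_multiple_less_left_iff[OF p, of "int (Suc j)" "int (Suc i)"] by simp
    then have "inj_on (\<lambda>j. b + int (Suc j) \<cdot> p) {..B}" unfolding inj_on_def add_left_cancel by blast
    then show ?thesis unfolding S_def by (simp add: card_image)
  qed
  ultimately have "B < card ?D" if "finite ?D" using card_mono[OF that, of S] by simp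
  with bd show thesis by (rule that)
qed

text \<open>According to the behaviour far to the right and far to the left, the set is bounded, or its
  complement is, or exactly one of the two directions belongs to it. The last case
  contradicts the bound for differences; in the first two, the set or its complement equals its
  difference with a far translate.\<close>

lemma fibres_finite_or_cofinite:
  assumes R: "dfn1 M R" and m: "1 \<le> m"
    and cell: "\<And>e. \<exists>C. finite C \<and> card C \<le> N \<and> cellular m C {t. R e t}"
  obtains B where "\<And>e. (finite {t. R e t} \<and> card {t. R e t} \<le> B) \<or> finite {t. \<not> R e t}"
proof -
  have R': "dfn1 M (\<lambda>e t. \<not> R e t)" using R by (rule dfn_not)
  have cell': "\<exists>C. finite C \<and> card C \<le> N \<and> cellular m C {t. \<not> R e t}" for e
    using cell[of e] cellular_Compl[of m _ "{t. R e t}"] by (auto simp: Collect_neg_eq)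
  obtain B where B: "\<And>e d. \<exists>a b. {t. R e t \<and> \<not> R e (t - d)} \<subseteq> {a..b} \<Longrightarrow>
      finite {t. R e t \<and> \<not> R e (t - d)} \<and> card {t. R e t \<and> \<not> R e (t - d)} \<le> B"
    by (fact bounded_differences[OF R m cell])
  obtain B' where B': "\<And>e d. \<exists>a b. {t. \<not> R e t \<and> \<not> \<not> R e (t - d)} \<subseteq> {a..b} \<Longrightarrow>
      finite {t. \<not> R e t \<and> \<not> \<not> R e (t - d)} \<and> card {t. \<not> R e t \<and> \<not> \<not> R e (t - d)} \<le> B'"
    by (fact bounded_differences[OF R' m cell'])
  obtain p :: 'a where p: "0 < p" using nontrivial by blast
  have apart: "\<exists>d. \<forall>t. - b \<le> t \<and> t \<le> b \<longrightarrow> \<not> (- b \<le> t - d \<and> t - d \<le> b)" for b :: 'a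
  proof (intro exI[of _ "b + b + p"] allI impI notI)
    fix t assume t: "- b \<le> t \<and> t \<le> b" "- b \<le> t - (b + b + p) \<and> t - (b + b + p) \<le> b"
    then have "b + p \<le> t" by (simp add: algebra_simps)
    then have "b + p \<le> b" using t(1) by (meson order_trans)
    then show False using p by simp
  qed
  have "(finite {t. R e t} \<and> card {t. R e t} \<le> B) \<or> finite {t. \<not> R e t}" for e
  proof -
    obtain C where C: "finite C" "cellular m C {t. R e t}" using cell by blast
    obtain b where b: "0 \<le> b" "(\<forall>t>b. t \<in> {t. R e t}) \<or> (\<forall>t>b. t \<notin> {t. R e t})"
      "(\<forall>t < - b. t \<in> {t. R e t}) \<or> (\<forall>t < - b. t \<notin> {t. R e t})"
      by (fact cellular_ends[OF m C])
    obtain d where d: "\<And>t. - b \<le> t \<Longrightarrow> t \<le> b \<Longrightarrow> \<not> (- b \<le> t - d \<and> t - d \<le> b)"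
      using apart[of b] by blast
    consider (bounded) "\<forall>t>b. \<not> R e t" "\<forall>t < - b. \<not> R e t" | (cobounded) "\<forall>t>b. R e t" "\<forall>t < - b. R e t"
      | (up) "\<forall>t>b. R e t" "\<forall>t < - b. \<not> R e t" | (down) "\<forall>t>b. \<not> R e t" "\<forall>t < - b. R e t"
      using b(2,3) by auto
    then show ?thesis
    proof cases
      case bounded
      then have inside: "- b \<le> t \<and> t \<le> b" if "R e t" for t using that by (meson not_le)
      have "{t. R e t \<and> \<not> R e (t - d)} = {t. R e t}" using inside d by blast
      moreover have "\<exists>a b. {t. R e t} \<subseteq> {a..b}" using inside by (intro exI[of _ "- b"] exI[of _ b]) auto
      ultimately show ?thesis using B[of e d] by simp
    next
      case cobounded
      then have inside: "- b \<le> t \<and> t \<le> b" if "\<not> R e t" for t using that by (meson not_le)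
      have "{t. \<not> R e t \<and> \<not> \<not> R e (t - d)} = {t. \<not> R e t}" using inside d by blast
      moreover have "\<exists>a b. {t. \<not> R e t} \<subseteq> {a..b}" using inside by (intro exI[of _ "- b"] exI[of _ b]) auto
      ultimately show ?thesis using B'[of e d] by simp
    next
      case up
      obtain d where "{t. t \<in> {t. R e t} \<and> t - d \<notin> {t. R e t}} \<subseteq> {- b..b + d}"
        "finite {t. t \<in> {t. R e t} \<and> t - d \<notin> {t. R e t}} \<Longrightarrow>
          B < card {t. t \<in> {t. R e t} \<and> t - d \<notin> {t. R e t}}"
        by (rule one_ray_large_difference[of b "{t. R e t}" B]) (use up b(1) in auto)
      then have "\<exists>a b. {t. R e t \<and> \<not> R e (t - d)} \<subseteq> {a..b}"
        "finite {t. R e t \<and> \<not> R e (t - d)} \<Longrightarrow> B < card {t. R e t \<and> \<not> R e (t - d)}" by auto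
      then show ?thesis using B[of e d] by (simp add: linorder_not_less[symmetric])
    next
      case down
      obtain d where "{t. t \<in> {t. \<not> R e t} \<and> t - d \<notin> {t. \<not> R e t}} \<subseteq> {- b..b + d}"
        "finite {t. t \<in> {t. \<not> R e t} \<and> t - d \<notin> {t. \<not> R e t}} \<Longrightarrow>
          B' < card {t. t \<in> {t. \<not> R e t} \<and> t - d \<notin> {t. \<not> R e t}}"
        by (rule one_ray_large_difference[of b "{t. \<not> R e t}" B']) (use down b(1) in auto)
      then have "\<exists>a b. {t. \<not> R e t \<and> \<not> \<not> R e (t - d)} \<subseteq> {a..b}"
        "finite {t. \<not> R e t \<and> \<not> \<not> R e (t - d)} \<Longrightarrow> B' < card {t. \<not> R e t \<and> \<not> \<not> R e (t - d)}" by auto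
      then show ?thesis using B'[of e d] by (simp add: linorder_not_less[symmetric])
    qed
  qed
  then show thesis by (rule that)
qed

end

section \<open>From lines to all dimensions\<close>

lemma lin_step:
  assumes "finite V" "i \<in> V"
  shows "lin V z (e(i := e i + s)) = lin V z e + z i \<cdot> s"
proof -
  have "lin V z (e(i := e i + s)) = lin V (z(i := 0)) e + z i \<cdot> e i + z i \<cdot> s"
    unfolding lin_upd[OF assms] int_multiple_add_right add.assoc ..
  also have "lin V (z(i := 0)) e + z i \<cdot> e i = lin V z e"
    using lin_upd[OF assms, of z e "e i"] by simp
  finally show ?thesis .
qed

text \<open>\<open>K\<close> bounds the coefficients, so a step of length \<open>s\<close> along an axis changes no linear form by more
  than \<open>K s\<close>.\<close>

lemma same_sides_small_step:
  fixes e :: "nat \<Rightarrow> 'a::linordered_ab_group_add"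
  assumes V: "finite V" "i \<in> V" and s: "0 \<le> s"
    and F: "\<And>z c. (z, c) \<in> F \<Longrightarrow> (\<forall>j\<in>V. z j = 0) \<or>
      (\<bar>z i\<bar> \<le> K \<and> (K \<cdot> s < lin V z e - c \<or> lin V z e - c < - (K \<cdot> s)))"
  shows "same_sides V F e (e(i := e i + s))"
  unfolding same_sides_def
proof clarify
  fix z c assume zc: "(z, c) \<in> F"
  show "lin V z e < c \<longleftrightarrow> lin V z (e(i := e i + s)) < c"
  proof (cases "\<forall>j\<in>V. z j = 0")
    case True
    then show ?thesis by (simp add: lin_def)
  next
    case False
    then have K: "z i \<le> K" "- K \<le> z i" and far: "K \<cdot> s < lin V z e - c \<or> lin V z e - c < - (K \<cdot> s)"
      using F[OF zc] by (auto simp: abs_le_iff)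
    have le: "z i \<cdot> s \<le> K \<cdot> s" "- (K \<cdot> s) \<le> z i \<cdot> s"
      using int_multiple_mono_left[OF K(1) s] int_multiple_mono_left[OF K(2) s]
      by (simp_all add: int_multiple_minus_left)
    have K0: "0 \<le> K \<cdot> s"
      using int_multiple_mono_left[of 0 K s] K s by simp
    from far show ?thesis
    proof
      assume *: "K \<cdot> s < lin V z e - c"
      then have "0 < lin V z e - c" using K0 by (rule le_less_trans[rotated])
      then have "\<not> lin V z e < c" by simp
      moreover have "- (z i \<cdot> s) < lin V z e - c"
        using le(2) * by (metis le_less_trans minus_le_iff)
      then have "\<not> lin V z e + z i \<cdot> s < c" by (simp add: algebra_simps not_less less_imp_le)
      ultimately show ?thesis by (simp add: lin_step[OF V])
    next
      assume *: "lin V z e - c < - (K \<cdot> s)"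
      then have "lin V z e - c < 0" using K0 by (metis less_le_trans neg_le_0_iff_le)
      then have "lin V z e < c" by simp
      moreover have "lin V z e - c < - (z i \<cdot> s)"
        using * le(1) by (meson less_le_trans neg_le_iff_le)
      then have "lin V z e + z i \<cdot> s < c" by (simp add: algebra_simps)
      ultimately show ?thesis by (simp add: lin_step[OF V])
    qed
  qed
qed

lemma lin_dfnf: "defines_plus S \<Longrightarrow> dfnf S (\<lambda>e. lin V z e)"
  unfolding lin_def by (intro dfnf_sum dfnf_int_multiple dfnf_var)

definition avoids :: "nat set \<Rightarrow> ((nat \<Rightarrow> int) \<times> 'a) set \<Rightarrow> (nat \<Rightarrow> 'a::linordered_ab_group_add) \<Rightarrow> bool" where
  "avoids V F e \<longleftrightarrow> (\<forall>(z, c)\<in>F. lin V z e \<noteq> c)"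

lemma finite_not_avoids:
  assumes V: "finite V" "i \<in> V" and F: "finite F" and e: "avoids V F e"
  shows "finite {t. \<not> avoids V F (e(i := t))}"
proof -
  have "{t. \<not> avoids V F (e(i := t))} = (\<Union>(z, c)\<in>F. {t. lin V z (e(i := t)) = c})"
    by (auto simp: avoids_def)
  moreover have "finite {t. lin V z (e(i := t)) = c}" if zc: "(z, c) \<in> F" for z c
  proof (cases "z i = 0")
    case True
    have "lin V z (e(i := t)) = lin V z e" for t
      using lin_upd[OF V, of z e t] lin_upd[OF V, of z e "e i"] True by simp
    then show ?thesis using e zc by (auto simp: avoids_def)
  next
    case False
    have "t = t'" if "lin V z (e(i := t)) = c" "lin V z (e(i := t')) = c" for t t'
      using that False by (simp add: lin_upd[OF V]) (metis add_left_cancel int_multiple_eq_iff)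
    then have "\<exists>s. {t. lin V z (e(i := t)) = c} \<subseteq> {s}" by blast
    then show ?thesis using finite_subset by blast
  qed
  ultimately show ?thesis using F by auto
qed

context reduct_without_interval
begin

lemma infinite_group: "infinite (UNIV :: 'a set)"
proof -
  obtain p :: 'a where p: "0 < p" using nontrivial by blast
  have "inj (\<lambda>n. int n \<cdot> p)"
    using int_multiple_less_left_iff[OF p]
    by (intro injI) (metis less_irrefl linorder_neqE of_nat_eq_iff)
  then show ?thesis using finite_imageD[of "\<lambda>n. int n \<cdot> p" UNIV] finite_subset[of _ "UNIV :: 'a set"]
    by (metis infinite_UNIV_nat subset_UNIV)
qed

text \<open>A point that keeps its distance from the bounding hyperplanes of \<open>P\<close> has many neighbours on
  each line parallel to an axis with the same truth value of \<open>P\<close>; by the dichotomy for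
  fibres, almost all points of the line then have this value. In a discrete group, the distance has
  to be large enough for the number of neighbours to exceed the uniform bound.\<close>

lemma lines_through_generic_points:
  assumes P: "dfn M P" and V: "finite V" "polyhedral V P"
  obtains F where "finite F" "\<And>z c. (z, c) \<in> F \<Longrightarrow> \<exists>j\<in>V. z j \<noteq> 0"
    "\<And>e i. avoids V F e \<Longrightarrow> i \<in> V \<Longrightarrow> finite {t. P (e(i := t)) \<noteq> P e}"
proof -
  obtain F where F: "finite F" "\<And>e e'. same_sides V F e e' \<Longrightarrow> P e = P e'"
    using V(2) unfolding polyhedral_def by blast
  define F1 where "F1 = {f \<in> F. \<exists>j\<in>V. fst f j \<noteq> 0}"
  define K where "K = (\<Sum>f\<in>F. \<Sum>i\<in>V. \<bar>fst f i\<bar>)"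
  have K: "\<bar>z i\<bar> \<le> K" if "(z, c) \<in> F" "i \<in> V" for z c i
  proof -
    have "\<bar>z i\<bar> \<le> (\<Sum>i\<in>V. \<bar>z i\<bar>)" using V(1) that(2) by (intro member_le_sum) auto
    also have "\<dots> = (\<Sum>i\<in>V. \<bar>fst (z, c) i\<bar>)" by simp
    also have "\<dots> \<le> K" unfolding K_def using F(1) that(1)
      by (intro member_le_sum[of "(z, c)" F "\<lambda>f. \<Sum>i\<in>V. \<bar>fst f i\<bar>"]) (auto intro: sum_nonneg)
    finally show ?thesis .
  qed
  have K0: "0 \<le> K" unfolding K_def by (intro sum_nonneg) auto
  have step: "P (e(i := e i + s)) = P e"
    if "i \<in> V" "0 \<le> s" "\<And>z c. (z, c) \<in> F1 \<Longrightarrow> K \<cdot> s < lin V z e - c \<or> lin V z e - c < - (K \<cdot> s)"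
    for e i s
  proof -
    have "same_sides V F e (e(i := e i + s))"
    proof (rule same_sides_small_step[OF V(1) that(1,2)])
      fix z c assume zc: "(z, c) \<in> F"
      show "(\<forall>j\<in>V. z j = 0) \<or> (\<bar>z i\<bar> \<le> K \<and> (K \<cdot> s < lin V z e - c \<or> lin V z e - c < - (K \<cdot> s)))"
        using K[OF zc that(1)] that(3)[of z c] zc by (auto simp: F1_def)
    qed
    from F(2)[OF this] show ?thesis by simp
  qed
  have fibre: "\<exists>B. \<forall>e. ((finite {t. P (e(i := t))} \<and> card {t. P (e(i := t))} \<le> B) \<or> finite {t. \<not> P (e(i := t))}) \<and>
      ((finite {t. \<not> P (e(i := t))} \<and> card {t. \<not> P (e(i := t))} \<le> B) \<or> finite {t. P (e(i := t))})"
    if i: "i \<in> V" for i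
  proof -
    have line: "dfn1 M (\<lambda>e t. Q (e(i := t)))" if Q: "dfn M Q" for Q
      using dfn_rename[OF Q, of "\<lambda>j. if j = i then 0 else Suc j"]
      by (simp add: fun_upd_def if_distrib cong: if_cong)
    obtain m N where m: "m \<ge> 1"
      and cell: "\<And>e. \<exists>C. finite C \<and> card C \<le> N \<and> cellular m C {t. P (e(i := t))}"
      by (fact polyhedral_fibres_cellular[OF V(1) i V(2)])
    obtain B where B: "\<And>e. (finite {t. P (e(i := t))} \<and> card {t. P (e(i := t))} \<le> B) \<or> finite {t. \<not> P (e(i := t))}"
      by (fact fibres_finite_or_cofinite[OF line[OF P] m cell])
    have cell': "\<exists>C. finite C \<and> card C \<le> N \<and> cellular m C {t. \<not> P (e(i := t))}" for e
      using cell[of e] cellular_Compl[of m _ "{t. P (e(i := t))}"] by (auto simp: Collect_neg_eq)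
    obtain B' where B': "\<And>e. (finite {t. \<not> P (e(i := t))} \<and> card {t. \<not> P (e(i := t))} \<le> B') \<or> finite {t. \<not> \<not> P (e(i := t))}"
      by (fact fibres_finite_or_cofinite[OF line[OF dfn_not[OF P]] m cell'])
    show ?thesis
    proof (intro exI[of _ "max B B'"] allI)
      fix e
      show "((finite {t. P (e(i := t))} \<and> card {t. P (e(i := t))} \<le> max B B') \<or> finite {t. \<not> P (e(i := t))}) \<and>
        ((finite {t. \<not> P (e(i := t))} \<and> card {t. \<not> P (e(i := t))} \<le> max B B') \<or> finite {t. P (e(i := t))})"
        using B[of e] B'[of e] by (auto simp: le_max_iff_disj)
    qed
  qed
  then obtain b where b: "\<And>i e. i \<in> V \<Longrightarrow>
      ((finite {t. P (e(i := t))} \<and> card {t. P (e(i := t))} \<le> b i) \<or> finite {t. \<not> P (e(i := t))}) \<and>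
      ((finite {t. \<not> P (e(i := t))} \<and> card {t. \<not> P (e(i := t))} \<le> b i) \<or> finite {t. P (e(i := t))})"
    by metis
  define B where "B = (\<Sum>i\<in>V. b i)"
  have bB: "b i \<le> B" if "i \<in> V" for i unfolding B_def using V(1) that by (intro member_le_sum) auto
  have conclude: "finite {t. P (e(i := t)) \<noteq> P e}"
    if i: "i \<in> V" and many: "finite {t. P (e(i := t)) = P e} \<Longrightarrow> B < card {t. P (e(i := t)) = P e}" for e i
  proof (cases "P e")
    case True
    then show ?thesis using b[OF i, of e] many bB[OF i] by auto
  next
    case False
    then show ?thesis using b[OF i, of e] many bB[OF i] by auto
  qed
  have F1: "finite F1" "\<And>z c. (z, c) \<in> F1 \<Longrightarrow> \<exists>j\<in>V. z j \<noteq> 0" using F(1) by (auto simp: F1_def)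
  show thesis
  proof (cases "\<exists>u :: 'a. least_positive u")
    case False
    have "finite {t. P (e(i := t)) \<noteq> P e}" if e: "avoids V F1 e" and i: "i \<in> V" for e i
    proof (rule conclude[OF i])
      obtain p :: 'a where p: "0 < p" using nontrivial by blast
      define D where "D = insert p ((\<lambda>(z, c). max (lin V z e - c) (c - lin V z e)) ` F1)"
      have D: "finite D" "D \<noteq> {}" using F1(1) by (auto simp: D_def)
      have "0 < max (lin V z e - c) (c - lin V z e)" if "(z, c) \<in> F1" for z c
        using e that by (auto simp: avoids_def less_max_iff_disj neq_iff)
      then have "0 < Min D" using p by (subst Min_gr_iff[OF D]) (auto simp: D_def)
      then obtain \<delta> where \<delta>: "0 < \<delta>" "int (nat K) \<cdot> \<delta> < Min D"
        using dense_small_multiple[OF False] by blast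
      have "{e i<..<e i + \<delta>} \<subseteq> {t. P (e(i := t)) = P e}"
      proof
        fix t assume t: "t \<in> {e i<..<e i + \<delta>}"
        define s where "s = t - e i"
        have s: "0 \<le> s" "s \<le> \<delta>" "t = e i + s" using t by (auto simp: s_def less_imp_le diff_le_eq add.commute)
        have "K \<cdot> s \<le> K \<cdot> \<delta>" using s(2) K0 by (cases "K = 0") (auto simp: int_multiple_le_iff)
        then have "K \<cdot> s < Min D" using \<delta>(2) K0 by (simp add: le_less_trans)
        then have "K \<cdot> s < max (lin V z e - c) (c - lin V z e)" if "(z, c) \<in> F1" for z c
          using Min_le[OF D(1), of "max (lin V z e - c) (c - lin V z e)"] that
          by (force simp: D_def intro: less_le_trans)
        then have "K \<cdot> s < lin V z e - c \<or> lin V z e - c < - (K \<cdot> s)" if "(z, c) \<in> F1" for z c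
          using that by (metis less_max_iff_disj less_minus_iff minus_diff_eq)
        then show "t \<in> {t. P (e(i := t)) = P e}" using step[OF i s(1)] s(3) by simp
      qed
      moreover have "infinite {e i<..<e i + \<delta>}" using \<delta>(1) by (intro dense_infinite_interval[OF False]) simp
      ultimately show "finite {t. P (e(i := t)) = P e} \<Longrightarrow> B < card {t. P (e(i := t)) = P e}"
        using finite_subset by blast
    qed
    with F1 show thesis by (rule that)
  next
    case True
    then obtain u :: 'a where u: "least_positive u" by blast
    then have u0: "0 < u" by (simp add: least_positive_def)
    define L where "L = K * int B"
    define F2 where "F2 = (\<lambda>((z, c), j). (z, c + j \<cdot> u)) ` (F1 \<times> {- L..L})"
    have F2: "finite F2" "\<And>z c. (z, c) \<in> F2 \<Longrightarrow> \<exists>j\<in>V. z j \<noteq> 0" using F1 by (auto simp: F2_def)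
    have L0: "0 \<le> L" using K0 by (simp add: L_def)
    have "finite {t. P (e(i := t)) \<noteq> P e}" if e: "avoids V F2 e" and i: "i \<in> V" for e i
    proof (rule conclude[OF i])
      have far: "L \<cdot> u < lin V z e - c \<or> lin V z e - c < - (L \<cdot> u)" if zc: "(z, c) \<in> F1" for z c
      proof (rule ccontr)
        let ?x = "lin V z e - c"
        assume "\<not> ?thesis"
        then have x: "?x \<le> L \<cdot> u" "- (L \<cdot> u) \<le> ?x" by auto
        have "0 \<le> ?x + L \<cdot> u" using x(2) by (metis add.commute diff_0 diff_le_eq)
        moreover have "?x + L \<cdot> u \<le> int (nat (L + L)) \<cdot> u"
        proof -
          have "?x + L \<cdot> u \<le> L \<cdot> u + L \<cdot> u" using x(1) by (rule add_right_mono)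
          also have "\<dots> = int (nat (L + L)) \<cdot> u" using L0 by (simp add: int_multiple_add_left[symmetric])
          finally show ?thesis .
        qed
        ultimately obtain j where j: "j \<le> nat (L + L)" "?x + L \<cdot> u = int j \<cdot> u"
          using multiples_between[OF u] by blast
        then have "?x = (int j - L) \<cdot> u" by (simp add: int_multiple_diff_left eq_diff_eq)
        then have "lin V z e = c + (int j - L) \<cdot> u" by (simp add: algebra_simps)
        moreover have "int j - L \<in> {- L..L}" using j(1) L0 by auto
        then have "(z, c + (int j - L) \<cdot> u) \<in> F2" using zc unfolding F2_def
          by (intro image_eqI[of _ _ "((z, c), int j - L)"]) auto
        ultimately show False using e by (auto simp: avoids_def)
      qed
      have "{e i..e i + int B \<cdot> u} \<subseteq> {t. P (e(i := t)) = P e}"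
      proof
        fix t assume t: "t \<in> {e i..e i + int B \<cdot> u}"
        define s where "s = t - e i"
        have s: "0 \<le> s" "s \<le> int B \<cdot> u" "t = e i + s" using t by (auto simp: s_def diff_le_eq add.commute)
        have "K \<cdot> s \<le> K \<cdot> int B \<cdot> u" using s(2) K0 by (cases "K = 0") (auto simp: int_multiple_le_iff)
        then have Ks: "K \<cdot> s \<le> L \<cdot> u" by (simp add: L_def int_multiple_assoc)
        have "K \<cdot> s < lin V z e - c \<or> lin V z e - c < - (K \<cdot> s)" if "(z, c) \<in> F1" for z c
          using far[OF that] Ks by (meson le_less_trans less_le_trans neg_le_iff_le)
        then show "t \<in> {t. P (e(i := t)) = P e}" using step[OF i s(1)] s(3) by simp
      qed
      then show "B < card {t. P (e(i := t)) = P e}" if "finite {t. P (e(i := t)) = P e}"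
        using card_mono[OF that, of "{e i..e i + int B \<cdot> u}"] card_multiples[OF u, of "e i" B] by simp
    qed
    with F2 show thesis by (rule that)
  qed
qed

text \<open>Two generic points are joined by changing one coordinate at a time, through generic
  points; on each line only finitely many values of the coordinate are excluded.\<close>

lemma generic_points_agree:
  assumes V: "finite V" "depends_on V P" and F: "finite F"
    and lines: "\<And>e i. avoids V F e \<Longrightarrow> i \<in> V \<Longrightarrow> finite {t. P (e(i := t)) \<noteq> P e}"
    and W: "finite W"
  shows "W \<subseteq> V \<Longrightarrow> avoids V F e \<Longrightarrow> avoids V F e' \<Longrightarrow> (\<And>i. i \<in> V - W \<Longrightarrow> e i = e' i) \<Longrightarrow> P e = P (e' :: nat \<Rightarrow> 'a)"
  using W
proof (induction W arbitrary: e e' rule: finite_induct)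
  case empty
  then show ?case using V(2) unfolding depends_on_def by simp
next
  case (insert i W)
  have i: "i \<in> V" using insert.prems by simp
  let ?bad = "{t. P (e(i := t)) \<noteq> P e} \<union> {t. P (e'(i := t)) \<noteq> P e'} \<union>
    {t. \<not> avoids V F (e(i := t))} \<union> {t. \<not> avoids V F (e'(i := t))}"
  have "finite ?bad"
    using lines[OF insert.prems(2) i] lines[OF insert.prems(3) i]
      finite_not_avoids[OF V(1) i F insert.prems(2)] finite_not_avoids[OF V(1) i F insert.prems(3)] by simp
  from ex_new_if_finite[OF infinite_group this] obtain r where r: "r \<notin> ?bad" by (rule exE)
  have "P (e(i := r)) = P (e'(i := r))"
  proof (rule insert.IH)
    show "avoids V F (e(i := r))" "avoids V F (e'(i := r))" using r by simp_all
    show "(e(i := r)) j = (e'(i := r)) j" if "j \<in> V - W" for j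
      using insert.prems(4)[of j] that by simp
  qed (use insert.prems in simp)
  then show ?case using r by auto
qed

text \<open>A definable polyhedral relation is almost constant, up to finitely many hyperplanes, and on
  a hyperplane one coordinate is determined by the others. This allows an induction on the
  number of coordinates.\<close>

theorem definable_in_group:
  assumes "dfn M P" "finite V" "depends_on V P"
  shows "dfn (group_structure :: (_, _, 'a) fo_structure) P"
  using assms
proof (induction "card V" arbitrary: V P rule: less_induct)
  case less
  let ?Gr = "group_structure :: (_, _, 'a) fo_structure"
  note V = less.prems(2)
  have plusG: "defines_plus ?Gr" by (rule defines_plus_group)
  have poly: "dfn ?Gr Q" if Q: "dfn M Q" "depends_on V Q" "polyhedral V Q" for Q
  proof -
    obtain F where F: "finite F" "\<And>z c. (z, c) \<in> F \<Longrightarrow> \<exists>j\<in>V. z j \<noteq> 0"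
      "\<And>e i. avoids V F e \<Longrightarrow> i \<in> V \<Longrightarrow> finite {t. Q (e(i := t)) \<noteq> Q e}"
      by (fact lines_through_generic_points[OF Q(1) V Q(3)])
    have agree: "Q e = Q e'" if "avoids V F e" "avoids V F e'" for e e'
      by (rule generic_points_agree[OF V Q(2) F(1,3) V]) (use that in auto)
    define v where "v \<longleftrightarrow> (\<exists>e. avoids V F e \<and> Q e)"
    have eq: "Q e \<longleftrightarrow> (avoids V F e \<and> v) \<or> (\<exists>f\<in>F. lin V (fst f) e = snd f \<and> Q e)" for e
    proof (cases "avoids V F e")
      case True
      then have "Q e = v" unfolding v_def using agree[OF True] by blast
      then show ?thesis using True by (auto simp: avoids_def)
    next
      case False
      then show ?thesis by (force simp: avoids_def)
    qed
    have hyperplane: "dfn ?Gr (\<lambda>e. lin V (fst f) e = snd f \<and> Q e)" if f: "f \<in> F" for f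
    proof -
      obtain z c where zc: "f = (z, c)" by force
      obtain j where j: "j \<in> V" "z j \<noteq> 0" using F(2) f zc by blast
      define Q' where "Q' e \<longleftrightarrow> (\<exists>t. lin V z (e(j := t)) = c \<and> Q (e(j := t)))" for e
      have "dfn M (\<lambda>e. lin V z e = c \<and> Q e)"
        by (intro dfn_conj dfn_eq lin_dfnf plus dfnf_const Q(1))
      from dfn_ex_upd[OF this, of j] have "dfn M Q'" by (simp add: Q'_def[abs_def])
      moreover have "depends_on (V - {j}) Q'"
        unfolding depends_on_def
      proof (intro allI impI)
        fix e e' :: "nat \<Rightarrow> 'a" assume *: "\<forall>i\<in>V - {j}. e i = e' i"
        have "lin V z (e(j := t)) = lin V z (e'(j := t))" for t by (rule lin_cong) (use * in auto)
        moreover have "Q (e(j := t)) = Q (e'(j := t))" for t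
          using Q(2) * unfolding depends_on_def by auto
        ultimately show "Q' e = Q' e'" by (simp add: Q'_def)
      qed
      moreover have "card (V - {j}) < card V" by (rule card_Diff1_less[OF V j(1)])
      ultimately have Q': "dfn ?Gr Q'" using less.hyps[of "V - {j}" Q'] V by simp
      have "lin V z e = c \<and> Q' e \<longleftrightarrow> lin V z e = c \<and> Q e" for e
      proof
        assume *: "lin V z e = c \<and> Q' e"
        then obtain t where t: "lin V z (e(j := t)) = c" "Q (e(j := t))" by (auto simp: Q'_def)
        have "lin V z e = lin V (z(j := 0)) e + z j \<cdot> e j" using lin_upd[OF V j(1), of z e "e j"] by simp
        then have "z j \<cdot> t = z j \<cdot> e j" using t(1) * by (simp add: lin_upd[OF V j(1)])
        then have "t = e j" using j(2) by (simp add: int_multiple_eq_iff)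
        then show "lin V z e = c \<and> Q e" using t(2) * by simp
      next
        assume *: "lin V z e = c \<and> Q e"
        then show "lin V z e = c \<and> Q' e" unfolding Q'_def by (auto intro!: exI[of _ "e j"])
      qed
      moreover have "dfn ?Gr (\<lambda>e. lin V z e = c \<and> Q' e)"
        by (intro dfn_conj dfn_eq lin_dfnf plusG dfnf_const Q')
      ultimately show ?thesis unfolding zc fst_conv snd_conv by (rule dfn_cong[rotated])
    qed
    have "dfn ?Gr (\<lambda>e. \<forall>f\<in>F. \<not> lin V (fst f) e = snd f)"
      by (intro dfn_ball[OF F(1)] dfn_not dfn_eq lin_dfnf plusG dfnf_const)
    then have "dfn ?Gr (avoids V F)" by (rule dfn_cong) (auto simp: avoids_def)
    then have "dfn ?Gr (\<lambda>e. (avoids V F e \<and> v) \<or> (\<exists>f\<in>F. lin V (fst f) e = snd f \<and> Q e))"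
      by (intro dfn_disj dfn_conj dfn_const dfn_bex[OF F(1)] hyperplane)
    then show ?thesis by (rule dfn_cong) (use eq in blast)
  qed
  have "presburger V P"
    by (rule dfn_presburger[OF regular index dfn_reduct[OF reduct less.prems(1)] V less.prems(3)])
  then obtain n where n: "n \<ge> 1" "\<And>a. polyhedral V (\<lambda>w. P (\<lambda>i. a i + n \<cdot> w i))"
    by (rule presburger_polyhedral_cosets) blast
  obtain R :: "'a set" where R: "finite R" "\<And>x. \<exists>r\<in>R. \<exists>y. x = r + n \<cdot> y"
    using index n(1) unfolding finite_index_def by blast
  \<comment> \<open>Cutting \<open>P\<close> into its restrictions to the cosets of \<open>n G\<close> in each coordinate.\<close>
  define reps where "reps = {a. \<forall>i. (i \<in> V \<longrightarrow> a i \<in> R) \<and> (i \<notin> V \<longrightarrow> a i = 0)}"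
  have fin: "finite reps" unfolding reps_def by (rule finite_set_of_finite_funs[OF V R(1)])
  define quot where "quot x = (if \<exists>y. x = n \<cdot> y then THE y. x = n \<cdot> y else 0)" for x :: 'a
  have uniq: "y = y'" if "n \<cdot> y = n \<cdot> y'" for y y' :: 'a using that n(1) by (simp add: int_multiple_eq_iff)
  have quot_mult: "quot (n \<cdot> y) = y" for y
    unfolding quot_def by (auto dest: uniq)
  have quot_graph: "y = quot x \<longleftrightarrow> x = n \<cdot> y \<or> ((\<not> (\<exists>y'. x = n \<cdot> y')) \<and> y = 0)" for x y
  proof (cases "\<exists>y'. x = n \<cdot> y'")
    case True
    then obtain y' where "x = n \<cdot> y'" by blast
    then show ?thesis using quot_mult uniq by auto
  next
    case False
    then show ?thesis by (auto simp: quot_def)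
  qed
  have div: "dfn ?Gr (\<lambda>e. \<exists>y. e i - a = n \<cdot> y)" for i a
    by (intro dfn_ex dfn_eq dfnf_diff dfnf_int_multiple plusG dfnf_var dfnf_const)
  have quot: "dfnf ?Gr (\<lambda>e. quot (e i - a))" for i a
    unfolding dfnf_def quot_graph
    by (intro dfn_disj dfn_conj dfn_not dfn_ex dfn_eq dfnf_diff dfnf_int_multiple plusG dfnf_var dfnf_const)
  have piece: "dfn ?Gr (\<lambda>w. P (\<lambda>i. a i + n \<cdot> w i))" for a
  proof (rule poly)
    show "dfn M (\<lambda>w. P (\<lambda>i. a i + n \<cdot> w i))"
      by (rule dfn_subst[OF less.prems(1)]) (intro dfnf_M)
    show "depends_on V (\<lambda>w. P (\<lambda>i. a i + n \<cdot> w i))"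
      using less.prems(3) by (simp add: depends_on_def)
  qed (rule n(2))
  have "dfn ?Gr (\<lambda>e. \<exists>a\<in>reps. (\<forall>i\<in>V. \<exists>y. e i - a i = n \<cdot> y) \<and> P (\<lambda>i. a i + n \<cdot> quot (e i - a i)))"
  proof (intro dfn_bex[OF fin] dfn_conj dfn_ball[OF V] div)
    fix a
    from dfn_subst[OF piece[of a], of "\<lambda>i e. quot (e i - a i)", OF quot]
    show "dfn ?Gr (\<lambda>e. P (\<lambda>i. a i + n \<cdot> quot (e i - a i)))" .
  qed
  then show ?case
  proof (rule dfn_cong)
    fix e :: "nat \<Rightarrow> 'a"
    have same: "P (\<lambda>i. a i + n \<cdot> quot (e i - a i)) = P e" if cong: "\<forall>i\<in>V. \<exists>y. e i - a i = n \<cdot> y" for a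
    proof -
      have "a i + n \<cdot> quot (e i - a i) = e i" if i: "i \<in> V" for i
      proof -
        obtain y where y: "e i - a i = n \<cdot> y" using cong i by blast
        then have "a i + n \<cdot> quot (e i - a i) = a i + (e i - a i)" by (simp only: quot_mult)
        then show ?thesis by simp
      qed
      then show ?thesis by (intro less.prems(3)[unfolded depends_on_def, rule_format])
    qed
    have "\<exists>a\<in>reps. \<forall>i\<in>V. \<exists>y. e i - a i = n \<cdot> y"
    proof -
      have "\<forall>x. \<exists>r. r \<in> R \<and> (\<exists>y. x = r + n \<cdot> y)" using R(2) by (auto simp: Bex_def)
      from choice[OF this] obtain r where r: "\<And>x. r x \<in> R \<and> (\<exists>y. x = r x + n \<cdot> y)" by blast
      let ?a = "\<lambda>i. if i \<in> V then r (e i) else 0"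
      have "\<exists>y. e i - ?a i = n \<cdot> y" if "i \<in> V" for i
      proof -
        obtain y where "e i = r (e i) + n \<cdot> y" using r by blast
        then have "e i - r (e i) = n \<cdot> y" by (metis add_diff_cancel_left')
        then show ?thesis using that by auto
      qed
      moreover have "?a \<in> reps" using r by (simp add: reps_def)
      ultimately show ?thesis by (intro bexI[of _ ?a]) auto
    qed
    then show "(\<exists>a\<in>reps. (\<forall>i\<in>V. \<exists>y. e i - a i = n \<cdot> y) \<and> P (\<lambda>i. a i + n \<cdot> quot (e i - a i))) = P e"
      using same by blast
  qed
qed

end

section \<open>The order on an interval\<close>

lemma reduct_of_dfn:
  assumes "\<And>P. dfn M P \<Longrightarrow> dfn N P"
  shows "reduct M N"
  unfolding reduct_over_def
proof (intro allI impI)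
  fix k X assume "definable M {} k X"
  then obtain P where P: "dfn M P" "\<And>e e'. (\<And>i. i < k \<Longrightarrow> e i = e' i) \<Longrightarrow> P e = P e'"
    "X = {xs. length xs = k \<and> P (\<lambda>i. xs ! i)}" by (rule dfn_of_definable) blast
  from definable_of_dfn[OF assms[OF P(1)] P(2), of k] show "definable N UNIV k X"
    unfolding P(3) by blast
qed

lemma definable_interval_order:
  fixes M :: "('f, 'r, 'a::linordered_ab_group_add) fo_structure"
  assumes plus: "defines_plus M" and I: "dfn M (\<lambda>e. e 0 \<in> I)" "I = interval_from_zero b"
  shows "definable M UNIV 1 {[x] | x. x \<in> I}"
    and "definable M UNIV 2 {[x, y] | x y. x \<in> I \<and> y \<in> I \<and> x < y}"
proof -
  have "definable M UNIV 1 {xs. length xs = 1 \<and> xs ! 0 \<in> I}"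
    by (rule definable_of_dfn[OF I(1)]) simp
  moreover have "{xs. length xs = 1 \<and> xs ! 0 \<in> I} = {[x] | x. x \<in> I}"
    by (auto simp: length_Suc_conv)
  ultimately show "definable M UNIV 1 {[x] | x. x \<in> I}" by simp
  have mem: "dfn M (\<lambda>e. f e \<in> I)" if "dfnf M f" for f
    using dfn_subst[OF I(1), of "\<lambda>j. f"] that by simp
  have "dfn M (\<lambda>e. e 0 \<in> I \<and> e 1 \<in> I \<and> e 1 - e 0 \<in> I)"
    by (intro dfn_conj mem dfnf_var dfnf_diff plus)
  then have "definable M UNIV 2 {xs. length xs = 2 \<and> xs ! 0 \<in> I \<and> xs ! 1 \<in> I \<and> xs ! 1 - xs ! 0 \<in> I}"
    by (rule definable_of_dfn) simp
  moreover have "x < y \<longleftrightarrow> y - x \<in> I" if "x \<in> I" "y \<in> I" for x y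
  proof (cases b)
    case None
    then show ?thesis by (simp add: I(2))
  next
    case (Some c)
    have "y - x < c"
    proof -
      have "y < c" "0 < x" using that Some by (auto simp: I(2))
      then have "y < c + x" by (metis add.right_neutral add_strict_mono)
      then show ?thesis by (simp add: diff_less_eq)
    qed
    then show ?thesis by (simp add: I(2) Some)
  qed
  then have "{xs. length xs = 2 \<and> xs ! 0 \<in> I \<and> xs ! 1 \<in> I \<and> xs ! 1 - xs ! 0 \<in> I} =
      {[x, y] | x y. x \<in> I \<and> y \<in> I \<and> x < y}"
    by (auto simp: length_Suc_conv numeral_2_eq_2)
  ultimately show "definable M UNIV 2 {[x, y] | x y. x \<in> I \<and> y \<in> I \<and> x < y}" by simp
qed

theorem corollary5p7:
  fixes M :: "('f, 'r, 'a::linordered_ab_group_add) fo_structure"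
  assumes "archimedean_group TYPE('h::linordered_ab_group_add)"
    and "small_quotients TYPE('h)"
    and "elementarily_equivalent
           (ordered_group_structure :: (group_symbol, order_symbol, 'a) fo_structure)
           (ordered_group_structure :: (group_symbol, order_symbol, 'h) fo_structure)"
    and "reduct M (ordered_group_structure :: (group_symbol, order_symbol, 'a) fo_structure)"
    and "proper_expansion M (group_structure :: (group_symbol, order_symbol, 'a) fo_structure)"
  shows "\<exists>b :: 'a option. let I = interval_from_zero b in
           infinite I \<and>
           definable M UNIV 1 {[x] | x. x \<in> I} \<and>
           definable M UNIV 2 {[x, y] | x y. x \<in> I \<and> y \<in> I \<and> x < y}"
proof (rule ccontr)
  assume no: "\<not> ?thesis"
  let ?Gr = "group_structure :: (group_symbol, order_symbol, 'a) fo_structure"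
  have plus: "defines_plus M"
    using defines_plus_expansion[OF _ defines_plus_group] assms(5) by (auto simp: proper_expansion_def)
  have "\<not> dfn M (\<lambda>e. e 0 \<in> interval_from_zero b)" if "infinite (interval_from_zero b)" for b
  proof
    assume "dfn M (\<lambda>e. e 0 \<in> interval_from_zero b)"
    from definable_interval_order[OF plus this refl] that no show False by (auto simp: Let_def)
  qed
  note no_interval = this
  have "dfn ?Gr P" if P: "dfn M P" for P
  proof (cases "\<exists>x :: 'a. 0 < x")
    case True
    have "reduct_without_interval M"
    proof (unfold_locales)
      show "regular_group TYPE('a)" by (rule regular_transfer[OF assms(3) archimedean_regular[OF assms(1)]])
      show "finite_index TYPE('a)"
        by (rule finite_index_transfer[OF assms(3) finite_index_of_small_quotients[OF assms(2)]])
      show "\<exists>s\<in>A. \<forall>t\<in>A. t \<le> s"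
        if "least_positive u" "dfn ordered_group_structure (\<lambda>e. e 0 \<in> A)" "a \<in> A" "\<And>x. x \<in> A \<Longrightarrow> x \<le> b"
        for u :: 'a and A :: "'a set" and a b
        by (rule definable_max_transfer[OF assms(3,1) that])
    qed (fact True plus assms(4) no_interval)+
    then interpret reduct_without_interval M .
    obtain K where K: "\<And>e e'. (\<And>i. i < K \<Longrightarrow> e i = e' i) \<Longrightarrow> P e = P e'"
      using dfn_finite_support[OF P] by blast
    have "depends_on {..<K} P" unfolding depends_on_def using K by (metis lessThan_iff)
    then show ?thesis by (intro definable_in_group[OF P]) auto
  next
    case False
    then have "x = 0" for x :: 'a by (metis linorder_neqE neg_0_less_iff_less)
    then have "e = e'" for e e' :: "nat \<Rightarrow> 'a" by (intro ext) (metis)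
    then have "P undefined \<longleftrightarrow> P e" for e by (metis (full_types))
    with dfn_const show ?thesis by (rule dfn_cong)
  qed
  then have "reduct M ?Gr" by (rule reduct_of_dfn)
  then show False using assms(5) by (auto simp: proper_expansion_def interdefinable_def)
qed

end
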